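(* Let $\mu,\nu$ be (non-empty) partitions with conjugates $\mu',\nu'$, and let $\mathbf{s}=(s_{ij})\in T(\mu,\mathbb{C})$ and $\mathbf{t}=(t_{ij})\in T(\nu,\mathbb{C})$ be tableaux whose entries are variables. Assume that the real parts of the variables $s_{i1}$ with $\mu'_2+\nu'_1\le i\le \mu'_1-1$ and of the variables $t_{1j}$ with $\nu_2+\mu_1\le j\le \nu_1-1$ are greater than or equal to $1$, and that the real parts of all other variables are greater than $1$. Let $\mathcal{G}(\mu\ast\nu)$ be the set of all partitions $\lambda$ with $c_{\mu\nu}^{\lambda}>0$. Then for every choice of a family $(\mathbf{u}_\lambda(\mathbf{s}\ast\mathbf{t})\in U_\lambda(\mathbf{s}\ast\mathbf{t}))_{\lambda\in\mathcal{G}(\mu\ast\nu)}$, $$\sum_{\mathrm{Sym}(B(\mathbf{s}\ast\mathbf{t}))}\zeta_{\mu}(\mathbf{s})\,\zeta_{\nu}(\mathbf{t})=\sum_{\mathrm{Sym}(B(\mathbf{s}\ast\mathbf{t}))}\ \sum_{\lambda\in\mathcal{G}(\mu\ast\nu)}c_{\mu\nu}^{\lambda}\,\zeta_{\lambda}(\mathbf{u}_{\lambda}(\mathbf{s}\ast\mathbf{t})),$$ where $\sum_{\mathrm{Sym}(B(\mathbf{s}\ast\mathbf{t}))}$ denotes the summation over the symmetric group permuting all the variables $\{s_{ij}\}\sqcup\{t_{ij}\}$ except those in $\{s_{i1}\mid \mu'_2+\nu'_1\le i\le\mu'_1\}\sqcup\{t_{1j}\mid \nu_2+\mu_1\le 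j\le\nu_1\}$.
   Context: **Partitions, diagrams, tableaux.** A partition $\lambda=(\lambda_1\ge\lambda_2\ge\cdots)$ has Young diagram $D(\lambda)=\{(i,j): 1\le j\le\lambda_i\}$ (row $i$, column $j$; rows numbered downwards; $\lambda_i=0$ beyond the last part). $\lambda'$ is the conjugate: $\lambda'_j=\#\{i:\lambda_i\ge j\}$. A skew partition $\delta=\lambda/\mu$ ($\mu_i\le\lambda_i$ for all $i$) has diagram $D(\lambda/\mu)=D(\lambda)\setminus D(\mu)$; a "normal" shape is one with $\mu=\emptyset$. $T(\delta,X)$ is the set of fillings of $D(\delta)$ by elements of $X$. $\mathrm{SSYT}(\delta)$ is the set of semi-standard Young tableaux of shape $\delta$: fillings by positive integers, rows weakly increasing left to right, columns strictly increasing top to bottom. Semi-standard tableaux over any other totally ordered set are defined in the same way. **Schur multiple zeta function.** For $\mathbf{s}=(s_{ij})\in T(\delta,\mathbb{C})$, $\zeta_\delta(\mathbf{s})=\sum_{M\in\mathrm{SSYT}(\delta)}\prod_{(i,j)\in D(\delta)}m_{ij}^{-s_{ij}}$, where $M=(m_{ij})$. It converges absolutely if $\Re(s_{ij})\ge1$ for all boxes and $\Re(s_{ij})>1$ at all corners (boxes $(i,j)\in D(\delta)$ with $(i+1,j),(i,j+1)\notin D(\delta)$). **Littlewood–Richardson coefficients.** $c_{\mu\nu}^\lambda$ is defined by $s_\mu s_\nu=\sum_\lambda c_{\mu\nu}^\lambda s_\lambda$ for Schur functions. **The product $\ast$.** The skew shape $\mu\ast\nu$ is obtained by taking an (empty,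 deleted) rectangle with $\mu_1$ columns and $\nu'_1$ rows and placing the diagram of $\mu$ directly below it and the diagram of $\nu$ directly to its right. Thus its outer shape $\psi$ has $\psi_i=\mu_1+\nu_i$ for $1\le i\le \nu'_1$ and $\psi_{\nu'_1+i}=\mu_i$ for $i\ge1$, and its inner shape is the rectangle. For fillings $\mathbf{s}$ of $\mu$ and $\mathbf{t}$ of $\nu$, $\mathbf{s}\ast\mathbf{t}$ is the filling of $\mu\ast\nu$ with $\mathbf{s}$ below and $\mathbf{t}$ to the right of the rectangle. **Rectification.** The row-word $w_{row}(L)$ of a tableau $L$ is obtained by reading rows from bottom to top, each from left to right. Knuth equivalence of words over a totally ordered set is the equivalence relation generated by $u\,bca\,v\sim u\,bac\,v$ for $a<b\le c$ and $u\,acb\,v\sim u\,cab\,v$ for $a\le b<c$. For a (skew) semi-standard tableau $L$, $\mathrm{Rect}(L)$ is the unique semi-standard tableau of normal shape whose row-word is Knuth equivalent to $w_{row}(L)$ (equivalently, the result of jeu de taquin on $L$). **Labeling.** $\tilde{\mathbb{N}}=\{k_l: k,l\ge1\}$ is totally ordered by $1_1<1_2<\cdots<2_1<2_2<\cdots<3_1<\cdots$. For $L\in \mathrm{SSYT}(\delta)$, $\phi_T(L)$ is the semi-standard tableau over $\tilde{\mathbb{N}}$ obtained by giving, for each $k$, the entries equal to $k$ the subscripts $1,2,\dots$ in the order in which they occur reading rows from bottom to top and each row from left to right. Entries of $\phi_T(L)$ are pairwise distinct. **$\mathbf{v}_L$ and $U_\lambda(\mathbf{v})$.** Let $\mathbf{v}=(v_{ij})\in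 T(\delta,\mathbb{C})$, $L\in \mathrm{SSYT}(\delta)$ and let $\lambda$ be the shape of $\mathrm{Rect}(L)$ (which equals the shape of $\mathrm{Rect}(\phi_T(L))$). Let $\rho_L:D(\delta)\to D(\lambda)$ be the bijection sending a box to the box of $\mathrm{Rect}(\phi_T(L))$ containing the same element of $\tilde{\mathbb{N}}$ that the original box contains in $\phi_T(L)$. Then $\mathbf{v}_L\in T(\lambda,\mathbb{C})$ is the tableau whose entry in box $\rho_L(i,j)$ is $v_{ij}$. Put $U_\lambda(\mathbf{v})=\{\mathbf{v}_L : L\in \mathrm{SSYT}(\delta),\ \mathrm{Rect}(L)\text{ has shape }\lambda\}$. Here this is applied with $\delta=\mu\ast\nu$ and $\mathbf{v}=\mathbf{s}\ast\mathbf{t}$; the sets $U_\lambda(\mathbf{s}\ast\mathbf{t})$ are non-empty for $\lambda\in\mathcal{G}(\mu\ast\nu)$. **Symmetrization.** $\sum_{\mathrm{Sym}(\cdot)}F$ means the sum, over all permutations $\sigma$ of the indicated set of variables, of the expression obtained from $F$ by substituting $\sigma(x)$ for each such variable $x$ (all other variables being fixed). In particular $\mathbf{u}_\lambda=\mathbf{v}_{L_\lambda}$ is a fixed arrangement of the variables (with $L_\lambda$ fixed) and $\sigma$ acts on the variables in it. *)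

theory Defs
  imports "HOL-Analysis.Analysis" "HOL-Combinatorics.Permutations"
begin

section \<open>Partitions and (skew) diagrams\<close>

text \<open>A partition is the list of its positive parts. Rows and columns are numbered from 1;
  \<^term>\<open>part la i\<close> is \<open>la\<^sub>i\<close>, which is 0 beyond the last part.\<close>

definition is_partition :: "nat list \<Rightarrow> bool" where
  "is_partition la \<longleftrightarrow> sorted_wrt (\<ge>) la \<and> 0 \<notin> set la"

definition part :: "nat list \<Rightarrow> nat \<Rightarrow> nat" where
  "part la i = (if 1 \<le> i \<and> i \<le> length la then la ! (i - 1) else 0)"

definition conjugate :: "nat list \<Rightarrow> nat \<Rightarrow> nat" where
  "conjugate la j = card {i. 1 \<le> i \<and> j \<le> part la i}"

type_synonym box = "nat \<times> nat"

definition diagram :: "nat list \<Rightarrow> box set" where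
  "diagram la = {(i, j). 1 \<le> i \<and> 1 \<le> j \<and> j \<le> part la i}"

text \<open>A skew shape is the pair of its outer and its inner partition.\<close>

type_synonym shape = "nat list \<times> nat list"

definition boxes :: "shape \<Rightarrow> box set" where
  "boxes \<delta> = diagram (fst \<delta>) - diagram (snd \<delta>)"

abbreviation normal_shape :: "nat list \<Rightarrow> shape" where
  "normal_shape la \<equiv> (la, [])"


section \<open>Fillings and semi-standard tableaux\<close>

text \<open>Fillings are extensional functions, so that each filling is a single function.\<close>

definition fillings :: "shape \<Rightarrow> 'a set \<Rightarrow> (box \<Rightarrow> 'a) set" where
  "fillings \<delta> X = boxes \<delta> \<rightarrow>\<^sub>E X"

definition semistandard :: "shape \<Rightarrow> (box \<Rightarrow> 'a::linorder) \<Rightarrow> bool" where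
  "semistandard \<delta> M \<longleftrightarrow>
     (\<forall>i j j'. (i, j) \<in> boxes \<delta> \<longrightarrow> (i, j') \<in> boxes \<delta> \<longrightarrow> j < j' \<longrightarrow> M (i, j) \<le> M (i, j')) \<and>
     (\<forall>i i' j. (i, j) \<in> boxes \<delta> \<longrightarrow> (i', j) \<in> boxes \<delta> \<longrightarrow> i < i' \<longrightarrow> M (i, j) < M (i', j))"

definition SSYT_over :: "'a::linorder set \<Rightarrow> shape \<Rightarrow> (box \<Rightarrow> 'a) set" where
  "SSYT_over X \<delta> = {M \<in> fillings \<delta> X. semistandard \<delta> M}"

definition SSYT :: "shape \<Rightarrow> (box \<Rightarrow> nat) set" where
  "SSYT = SSYT_over {1..}"


section \<open>Schur multiple zeta functions\<close>

text \<open>Summability in \<^typ>\<open>complex\<close> is absolute summability.\<close>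

definition schur_zeta :: "shape \<Rightarrow> (box \<Rightarrow> complex) \<Rightarrow> complex" where
  "schur_zeta \<delta> s = (\<Sum>\<^sub>\<infinity>M\<in>SSYT \<delta>. \<Prod>b\<in>boxes \<delta>. of_nat (M b) powr (- s b))"


section \<open>Schur functions and Littlewood--Richardson coefficients\<close>

text \<open>A formal power series in \<open>x\<^sub>1, x\<^sub>2, \<dots>\<close> with integer coefficients is the function giving
  the coefficient of each monomial; a monomial is the multiset of the indices of its variables.\<close>

type_synonym series = "nat multiset \<Rightarrow> int"

definition series_mult :: "series \<Rightarrow> series \<Rightarrow> series" where
  "series_mult f g = (\<lambda>m. \<Sum>a | a \<subseteq># m. f a * g (m - a))"

definition schur :: "nat list \<Rightarrow> series" where
  "schur la = (\<lambda>m. int (card {M \<in> SSYT (normal_shape la).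
     image_mset M (mset_set (boxes (normal_shape la))) = m}))"

text \<open>\<^term>\<open>lr \<mu> \<nu> la\<close> is the coefficient of \<open>s\<^sub>l\<^sub>a\<close> in the expansion of \<open>s\<^sub>\<mu> s\<^sub>\<nu>\<close> as a finite
  linear combination of Schur functions.\<close>

definition lr :: "nat list \<Rightarrow> nat list \<Rightarrow> nat list \<Rightarrow> int" where
  "lr \<mu> \<nu> = (THE c. finite {la. c la \<noteq> 0} \<and> {la. c la \<noteq> 0} \<subseteq> {la. is_partition la} \<and>
     series_mult (schur \<mu>) (schur \<nu>) = (\<lambda>m. \<Sum>la | c la \<noteq> 0. c la * schur la m))"


section \<open>The product of shapes and of fillings\<close>

definition star :: "nat list \<Rightarrow> nat list \<Rightarrow> shape" where
  "star \<mu> \<nu> = (map (\<lambda>k. part \<mu> 1 + k) \<nu> @ \<mu>, replicate (conjugate \<nu> 1) (part \<mu> 1))"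

definition star_filling ::
    "nat list \<Rightarrow> nat list \<Rightarrow> (box \<Rightarrow> 'a) \<Rightarrow> (box \<Rightarrow> 'a) \<Rightarrow> box \<Rightarrow> 'a" where
  "star_filling \<mu> \<nu> s t = (\<lambda>(i, j)\<in>boxes (star \<mu> \<nu>).
     if i \<le> conjugate \<nu> 1 then t (i, j - part \<mu> 1) else s (i - conjugate \<nu> 1, j))"


section \<open>Rectification\<close>

definition reading :: "shape \<Rightarrow> box list" where
  "reading \<delta> = concat (map (\<lambda>i. map (\<lambda>j. (i, j)) [part (snd \<delta>) i + 1 ..< part (fst \<delta>) i + 1])
     (rev [1 ..< length (fst \<delta>) + 1]))"

definition row_word :: "shape \<Rightarrow> (box \<Rightarrow> 'a) \<Rightarrow> 'a list" where
  "row_word \<delta> L = map L (reading \<delta>)"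

inductive knuth_step :: "'a::linorder list \<Rightarrow> 'a list \<Rightarrow> bool" where
  "a < b \<Longrightarrow> b \<le> c \<Longrightarrow> knuth_step (u @ [b, c, a] @ v) (u @ [b, a, c] @ v)"
| "a \<le> b \<Longrightarrow> b < c \<Longrightarrow> knuth_step (u @ [a, c, b] @ v) (u @ [c, a, b] @ v)"

definition knuth_equiv :: "'a::linorder list \<Rightarrow> 'a list \<Rightarrow> bool" where
  "knuth_equiv = equivclp knuth_step"

text \<open>The rectification is returned together with its (normal) shape. Knuth equivalent words are
  rearrangements of each other, so the entries of the rectification are those of \<open>L\<close>.\<close>

definition rect :: "shape \<Rightarrow> (box \<Rightarrow> 'a::linorder) \<Rightarrow> nat list \<times> (box \<Rightarrow> 'a)" where
  "rect \<delta> L = (THE (la, P). is_partition la \<and> P \<in> SSYT_over UNIV (normal_shape la) \<and>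
     knuth_equiv (row_word (normal_shape la) P) (row_word \<delta> L))"

definition rect_shape :: "shape \<Rightarrow> (box \<Rightarrow> 'a::linorder) \<Rightarrow> nat list" where
  "rect_shape \<delta> L = fst (rect \<delta> L)"

definition rect_tableau :: "shape \<Rightarrow> (box \<Rightarrow> 'a::linorder) \<Rightarrow> box \<Rightarrow> 'a" where
  "rect_tableau \<delta> L = snd (rect \<delta> L)"


section \<open>Labeling\<close>

text \<open>\<open>Lab k l\<close> stands for \<open>k\<^sub>l\<close>. The product type is not used because its order in the
  library is the componentwise one.\<close>

datatype labeled = Lab nat nat

instantiation labeled :: linorder
begin

fun less_eq_labeled :: "labeled \<Rightarrow> labeled \<Rightarrow> bool" where
  "Lab k l \<le> Lab k' l' \<longleftrightarrow> k < k' \<or> k = k' \<and> l \<le> l'"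

definition less_labeled :: "labeled \<Rightarrow> labeled \<Rightarrow> bool" where
  "less_labeled x y \<longleftrightarrow> x \<le> y \<and> \<not> y \<le> x"

instance
proof
  fix x y z :: labeled
  show "x < y \<longleftrightarrow> x \<le> y \<and> \<not> y \<le> x" by (rule less_labeled_def)
  show "x \<le> x" by (cases x) auto
  show "x \<le> y \<Longrightarrow> y \<le> z \<Longrightarrow> x \<le> z" by (cases x; cases y; cases z) auto
  show "x \<le> y \<Longrightarrow> y \<le> x \<Longrightarrow> x = y" by (cases x; cases y) auto
  show "x \<le> y \<or> y \<le> x" by (cases x; cases y) auto
qed

end

text \<open>The subscript of a box counts the boxes with the same entry read before it.\<close>

definition label_tableau :: "shape \<Rightarrow> (box \<Rightarrow> nat) \<Rightarrow> box \<Rightarrow> labeled" where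
  "label_tableau \<delta> L = (\<lambda>b\<in>boxes \<delta>.
     Lab (L b) (length (filter (\<lambda>c. L c = L b) (takeWhile (\<lambda>c. c \<noteq> b) (reading \<delta>))) + 1))"


section \<open>Rearranged fillings\<close>

definition rho :: "shape \<Rightarrow> (box \<Rightarrow> nat) \<Rightarrow> box \<Rightarrow> box" where
  "rho \<delta> L b = (THE c. c \<in> diagram (rect_shape \<delta> L) \<and>
     rect_tableau \<delta> (label_tableau \<delta> L) c = label_tableau \<delta> L b)"

definition rearranged :: "shape \<Rightarrow> (box \<Rightarrow> 'a) \<Rightarrow> (box \<Rightarrow> nat) \<Rightarrow> box \<Rightarrow> 'a" where
  "rearranged \<delta> v L = (\<lambda>c\<in>diagram (rect_shape \<delta> L). v (inv_into (boxes \<delta>) (rho \<delta> L) c))"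

definition U_set :: "nat list \<Rightarrow> shape \<Rightarrow> (box \<Rightarrow> 'a) \<Rightarrow> (box \<Rightarrow> 'a) set" where
  "U_set la \<delta> v = {rearranged \<delta> v L | L. L \<in> SSYT \<delta> \<and> rect_shape \<delta> L = la}"


section \<open>Variables and symmetrization\<close>

text \<open>\<open>SVar (i, j)\<close> is the variable \<open>s\<^sub>i\<^sub>j\<close> and \<open>TVar (i, j)\<close> the variable \<open>t\<^sub>i\<^sub>j\<close>. Fillings whose
  entries are variables are kept apart from their complex values, since the symmetrization permutes
  the variables, distinct ones of which may take equal values.\<close>

datatype svar = SVar box | TVar box

definition s_vars :: "nat list \<Rightarrow> box \<Rightarrow> svar" where
  "s_vars \<mu> = (\<lambda>b\<in>diagram \<mu>. SVar b)"

definition t_vars :: "nat list \<Rightarrow> box \<Rightarrow> svar" where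
  "t_vars \<nu> = (\<lambda>b\<in>diagram \<nu>. TVar b)"

fun var_value :: "(box \<Rightarrow> complex) \<Rightarrow> (box \<Rightarrow> complex) \<Rightarrow> svar \<Rightarrow> complex" where
  "var_value s t (SVar b) = s b"
| "var_value s t (TVar b) = t b"

definition permuted_vars :: "nat list \<Rightarrow> nat list \<Rightarrow> svar set" where
  "permuted_vars \<mu> \<nu> = (SVar ` diagram \<mu> \<union> TVar ` diagram \<nu>) -
     ({SVar (i, 1) | i. conjugate \<mu> 2 + conjugate \<nu> 1 \<le> i \<and> i \<le> conjugate \<mu> 1} \<union>
      {TVar (1, j) | j. part \<nu> 2 + part \<mu> 1 \<le> j \<and> j \<le> part \<nu> 1})"

text \<open>\<^term>\<open>evaluate la x w\<close> replaces each variable in the filling \<open>w\<close> of shape \<open>la\<close> by its value.\<close>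

definition evaluate :: "nat list \<Rightarrow> (svar \<Rightarrow> complex) \<Rightarrow> (box \<Rightarrow> svar) \<Rightarrow> box \<Rightarrow> complex" where
  "evaluate la x w = (\<lambda>b\<in>diagram la. x (w b))"

end

theory Submission
  imports Defs "HOL-Library.Sublist"
begin

text \<open>Expanding \<open>\<zeta>\<^sub>\<mu>(s) \<zeta>\<^sub>\<nu>(t)\<close> gives a sum over \<open>L \<in> SSYT(\<mu> \<ast> \<nu>)\<close>, and the summand of \<open>L\<close> is the
  monomial of \<open>Rect(L)\<close> with exponents \<open>v\<^sub>L\<close>. The number of \<open>L\<close> with a given rectification depends only
  on its shape: by the Pieri rule, right multiplication by a row preserves the span of the sums \<open>S\<^sub>\<lambda>\<close> of
  all tableaux of shape \<open>\<lambda>\<close> in the plactic monoid, and \<open>S\<^sub>\<nu>\<close> is a combination of products of rows. Since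
  Schur functions are linearly independent, that number is the Littlewood--Richardson coefficient. The
  arrangements \<open>v\<^sub>L\<close> of two \<open>L\<close> with the same rectified shape differ by a permutation of the
  variables which fixes the excluded ones: row insertion pushes an entry of the first column
  straight down, and the last entries of the last inserted row are never bumped, so that the place of
  an excluded variable is determined by the shape. The symmetrization removes the difference.\<close>

section \<open>Row insertion and Knuth equivalence\<close>

text \<open>The origin of the excluded sets: each of the \<nu>'_1 rows of the right factor lengthens
  the second column by at most one and adds at most one entry to the first column, no lower than
  just after the rows of length two or more. So the first-column entries from row \<mu>'_2 +
  \<nu>'_1 on keep their distance from the bottom. When the top row of \<nu> is inserted, the first
  row has at most \<mu>_1 + \<nu>_2 entries, so the letters of that row from column \<nu>_2 +
  \<mu>_1 on keep their distance from the end. The same fact gives convergence on the right-hand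
  side. Real part 1 is allowed only at excluded variables other than the last of each family; such a
  variable has the next one of its family directly below or to the right of it, hence never sits at
  a corner. The coefficients are defined by an expansion, not by a counting rule, so insertion has
  to be reversible in a controlled way. It is therefore organized row by row: a whole word passes
  through a row and the bumped word goes on to the next. Knuth invariance, reversibility and the
  Pieri rule then become inductions over rows.\<close>

fun row_insert :: "'a::linorder \<Rightarrow> 'a list \<Rightarrow> 'a list" where
  "row_insert x [] = [x]"
| "row_insert x (y # ys) = (if x < y then x # ys else y # row_insert x ys)"

fun row_bump :: "'a::linorder \<Rightarrow> 'a list \<Rightarrow> 'a list" where
  "row_bump x [] = []"
| "row_bump x (y # ys) = (if x < y then [y] else row_bump x ys)"

fun insert_row :: "'a::linorder list \<Rightarrow> 'a list \<Rightarrow> 'a list" where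
  "insert_row [] r = r"
| "insert_row (x # w) r = insert_row w (row_insert x r)"

fun bumped :: "'a::linorder list \<Rightarrow> 'a list \<Rightarrow> 'a list" where
  "bumped [] r = []"
| "bumped (x # w) r = row_bump x r @ bumped w (row_insert x r)"

lemma length_row_bump: "length (row_bump x r) \<le> 1"
  by (induction r) auto

lemma length_bumped: "length (bumped w r) \<le> length w"
proof (induction w arbitrary: r)
  case (Cons x w)
  show ?case using Cons[of "row_insert x r"] length_row_bump[of x r] by simp
qed simp

text \<open>All letters pass through one row before anything enters the next. A row sees only the
  letters bumped from above, in their order, so this agrees with inserting one letter after another
  (\<open>insert_word_append\<close>), and statements about a single row extend by induction over
  the rows. Below the last row the recursion goes on until no letter is left.\<close>

function insert_word :: "'a::linorder list \<Rightarrow> 'a list list \<Rightarrow> 'a list list" where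
  "insert_word w [] = (if w = [] then [] else insert_row w [] # insert_word (bumped w []) [])"
| "insert_word w (r # T) = insert_row w r # insert_word (bumped w r) T"
  by pat_completeness auto
termination
proof (relation "measures [\<lambda>(w, T). length T, \<lambda>(w, T). length w]"; simp)
  fix w :: "'a list"
  assume "w \<noteq> []"
  \<comment> \<open>The first letter merely fills the empty row, so at least one letter is not
    passed on.\<close>
  then show "length (bumped w []) < length w"
    by (cases w) (auto simp: less_Suc_eq_le intro: length_bumped)
qed

declare insert_word.simps(1) [simp del]

lemma insert_word_empty [simp]: "insert_word [] [] = []"
  by (simp add: insert_word.simps(1))

lemma insert_word_start:
  "w \<noteq> [] \<Longrightarrow> insert_word w [] = insert_row w [] # insert_word (bumped w []) []"
  by (simp add: insert_word.simps(1))

fun strictly_above :: "'a::linorder list \<Rightarrow> 'a list \<Rightarrow> bool" where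
  "strictly_above r [] = True"
| "strictly_above [] (y # s) = False"
| "strictly_above (x # r) (y # s) = (x < y \<and> strictly_above r s)"

fun first_row :: "'a list list \<Rightarrow> 'a list" where
  "first_row [] = []"
| "first_row (r # T) = r"

fun is_tableau :: "'a::linorder list list \<Rightarrow> bool" where
  "is_tableau [] = True"
| "is_tableau (r # T) =
     (sorted r \<and> r \<noteq> [] \<and> strictly_above r (first_row T) \<and> is_tableau T)"

definition tableau_word :: "'a list list \<Rightarrow> 'a list" where
  "tableau_word T = concat (rev T)"

lemma tableau_word_simps [simp]:
  "tableau_word [] = []"
  "tableau_word (r # T) = tableau_word T @ r"
  by (simp_all add: tableau_word_def)

lemma first_row_insert_word: "first_row (insert_word w T) = insert_row w (first_row T)"
  by (cases T; cases "w = []") (auto simp: insert_word_start)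

lemma insert_word_Nil [simp]: "insert_word [] T = T"
  by (induction T) auto

lemma insert_row_append: "insert_row (u @ v) r = insert_row v (insert_row u r)"
  by (induction u arbitrary: r) auto

lemma bumped_append: "bumped (u @ v) r = bumped u r @ bumped v (insert_row u r)"
  by (induction u arbitrary: r) auto

lemma insert_word_append: "insert_word (u @ v) T = insert_word v (insert_word u T)"
proof (induction u T arbitrary: v rule: insert_word.induct)
  case (1 u)
  then show ?case
    by (cases "u = []") (auto simp: insert_word_start insert_row_append bumped_append)
next
  case (2 u r T)
  then show ?case by (simp add: insert_row_append bumped_append)
qed

lemma row_insert_neq_Nil [simp]: "row_insert x r \<noteq> []"
  by (cases r) auto

lemma set_row_insert: "set (row_insert x r) \<subseteq> insert x (set r)"
  by (induction r) auto

lemma sorted_row_insert: "sorted r \<Longrightarrow> sorted (row_insert x r)"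
proof (induction r)
  case (Cons y r)
  then show ?case using set_row_insert[of x r] by (fastforce simp: less_imp_le)
qed simp

lemma sorted_insert_row: "sorted r \<Longrightarrow> sorted (insert_row w r)"
  by (induction w arbitrary: r) (auto simp: sorted_row_insert)

lemma mset_row_insert: "mset (row_insert x r) + mset (row_bump x r) = add_mset x (mset r)"
  by (induction r) auto

lemma mset_insert_row: "mset (insert_row w r) + mset (bumped w r) = mset w + mset r"
proof (induction w arbitrary: r)
  case (Cons x w)
  show ?case using Cons[of "row_insert x r"] mset_row_insert[of x r]
    by (simp add: algebra_simps)
qed simp

lemma row_bump_greater: "y \<in> set (row_bump x r) \<Longrightarrow> x < y"
  by (induction r) (auto split: if_splits)

lemma row_bump_in: "set (row_bump x r) \<subseteq> set r"
  by (induction r) auto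

lemma insert_row_Cons_le:
  "\<forall>x\<in>set w. y \<le> x \<Longrightarrow> insert_row w (y # ys) = y # insert_row w ys"
  "\<forall>x\<in>set w. y \<le> x \<Longrightarrow> bumped w (y # ys) = bumped w ys"
  by (induction w arbitrary: ys) auto

text \<open>Half of the row bumping lemma: a letter that is not smaller than its predecessor acts
  further to the right, where a sorted row has no smaller entries.\<close>

lemma row_bump_mono:
  "x \<le> x' \<Longrightarrow> sorted r \<Longrightarrow> row_bump x r = [y] \<Longrightarrow> row_bump x' (row_insert x r) = [y'] \<Longrightarrow> y \<le> y'"
proof (induction r)
  case (Cons z r)
  show ?case
  proof (cases "x < z")
    case True
    then have "y' \<in> set r" "y = z"
      using Cons row_bump_in[of x' r] by (auto split: if_splits)
    then show ?thesis using Cons by auto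
  next
    case False
    then have "\<not> x' < z" using Cons.prems(1) by simp
    then show ?thesis using Cons False by simp
  qed
qed simp

lemma row_bump_None_mono:
  "x \<le> x' \<Longrightarrow> row_bump x r = [] \<Longrightarrow> row_bump x' (row_insert x r) = []"
  by (induction r) (auto split: if_splits)

text \<open>Once \<open>c\<close> is in the row, some entry exceeds \<open>b\<close>, and the
  leftmost such entry is at most \<open>c\<close>.\<close>

lemma row_bump_after:
  "b < c \<Longrightarrow> sorted r \<Longrightarrow> \<exists>y. row_bump b (row_insert c r) = [y] \<and> y \<le> c"
  by (induction r) auto

lemma row_bump_cases:
  obtains "row_bump x r = []" | y where "row_bump x r = [y]" "x < y" "y \<in> set r"
proof (cases "row_bump x r")
  case (Cons y l)
  then have "row_bump x r = [y]" using length_row_bump[of x r] by auto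
  then show ?thesis using that(2)[of y] row_bump_greater[of y x r] row_bump_in[of x r] by auto
qed (use that in auto)

section \<open>Knuth equivalence as a congruence on words\<close>

lemma knuth_equiv_refl [simp]: "knuth_equiv u u"
  by (simp add: knuth_equiv_def)

lemma knuth_equiv_sym: "knuth_equiv u v \<Longrightarrow> knuth_equiv v u"
  by (simp add: knuth_equiv_def equivclp_sym)

lemma knuth_equiv_trans [trans]: "knuth_equiv u v \<Longrightarrow> knuth_equiv v w \<Longrightarrow> knuth_equiv u w"
  unfolding knuth_equiv_def by (rule equivclp_trans)

lemma knuth_equiv_step: "knuth_step u v \<Longrightarrow> knuth_equiv u v"
  unfolding knuth_equiv_def by (rule r_into_equivclp)

lemma knuth_equiv_induct [consumes 1, case_names refl step sym_step]:
  assumes "knuth_equiv u v" and "P u"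
    and "\<And>v w. P v \<Longrightarrow> knuth_step v w \<Longrightarrow> P w"
    and "\<And>v w. P v \<Longrightarrow> knuth_step w v \<Longrightarrow> P w"
  shows "P v"
  using assms(1) unfolding knuth_equiv_def
  by (induction rule: equivclp_induct) (use assms(2-4) in blast)+

lemma knuth_step_context: "knuth_step u v \<Longrightarrow> knuth_step (p @ u @ q) (p @ v @ q)"
proof (induction rule: knuth_step.induct)
  case (1 a b c u v)
  show ?case using knuth_step.intros(1)[OF 1, of "p @ u" "v @ q"] by simp
next
  case (2 a b c u v)
  show ?case using knuth_step.intros(2)[OF 2, of "p @ u" "v @ q"] by simp
qed

lemma knuth_equiv_context: "knuth_equiv u v \<Longrightarrow> knuth_equiv (p @ u @ q) (p @ v @ q)"
proof (induction rule: knuth_equiv_induct)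
  case (step v w)
  then show ?case
    using knuth_equiv_step knuth_equiv_trans knuth_step_context by blast
next
  case (sym_step v w)
  then show ?case
    using knuth_equiv_step knuth_equiv_sym knuth_equiv_trans knuth_step_context by blast
qed simp

lemma knuth_equiv_append:
  "knuth_equiv u u' \<Longrightarrow> knuth_equiv v v' \<Longrightarrow> knuth_equiv (u @ v) (u' @ v')"
  using knuth_equiv_context[of u u' "[]" v] knuth_equiv_context[of v v' u' "[]"]
  by (auto intro: knuth_equiv_trans)

section \<open>Invariance of insertion under Knuth equivalence\<close>

lemma knuth_equiv_triple1:
  "a < b \<Longrightarrow> b \<le> c \<Longrightarrow> knuth_equiv ([b, c, a]) ([b, a, c])"
  using knuth_equiv_step[OF knuth_step.intros(1)[of a b c "[]" "[]"]] by simp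

lemma knuth_equiv_triple2:
  "a \<le> b \<Longrightarrow> b < c \<Longrightarrow> knuth_equiv ([a, c, b]) ([c, a, b])"
  using knuth_equiv_step[OF knuth_step.intros(2)[of a b c "[]" "[]"]] by simp

lemma knuth_equiv_mset: "knuth_equiv u v \<Longrightarrow> mset u = mset v"
  by (induction rule: knuth_equiv_induct) (auto elim!: knuth_step.cases)

text \<open>Induction over the row, by the place of its first entry \<open>y\<close> relative to
  \<open>a\<close> and \<open>b\<close>. If \<open>a\<close> bumps \<open>y\<close>, or if
  \<open>b\<close> bumps \<open>y\<close> and is then bumped by \<open>a\<close>, the bumped words
  differ by at most a relation of the first kind again. If \<open>y\<close> stays, the claim passes
  to the tail.\<close>

lemma insert_row_triple1:
  assumes "a < b" "b \<le> c" "sorted r"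
  shows "insert_row [b, c, a] r = insert_row [b, a, c] r \<and>
    knuth_equiv (bumped [b, c, a] r) (bumped [b, a, c] r)"
  using assms(3)
proof (induction r)
  case Nil
  then show ?case using assms by auto
next
  case (Cons y r)
  consider "y \<le> a" | "a < y" "y \<le> b" | "b < y" by force
  then show ?case
  proof cases
    case 1
    then show ?thesis using Cons assms by auto
  next
    case 2
    have "knuth_equiv (row_bump b r @ row_bump c (row_insert b r) @ [y])
       (row_bump b r @ [y] @ row_bump c (row_insert b r))"
    proof (cases rule: row_bump_cases[of b r])
      case 1
      then show ?thesis using row_bump_None_mono[OF assms(2) 1] by simp
    next
      case b: (2 z)
      show ?thesis
      proof (cases rule: row_bump_cases[of c "row_insert b r"])
        case c: (2 z')
        have "z \<le> z'" using row_bump_mono[OF assms(2) _ b(1) c(1)] Cons by simp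
        moreover have "y < z" using b 2 by simp
        ultimately show ?thesis using b c knuth_equiv_triple1[of y z z'] by simp
      qed (use b in simp)
    qed
    then show ?thesis using 2 assms by auto
  next
    case 3
    have "knuth_equiv ([y] @ row_bump c r @ [b]) ([y] @ [b] @ row_bump c r)"
    proof (cases rule: row_bump_cases[of c r])
      case c: (2 z)
      then show ?thesis using 3 Cons knuth_equiv_triple1[of b y z] by auto
    qed simp
    then show ?thesis using 3 assms by auto
  qed
qed

text \<open>If \<open>a\<close> bumps \<open>y\<close> and \<open>y \<le> c\<close>, the bumped
  words differ by at most a relation of the second kind. If \<open>c < y\<close>, the relation
  changes its kind: \<open>c\<close> itself gets bumped, and with \<open>z\<close> the entry after
  \<open>y\<close> the words \<open>y z c\<close> and \<open>y c z\<close> are related by the first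
  kind.\<close>

lemma insert_row_triple2:
  assumes "a \<le> b" "b < c" "sorted r"
  shows "insert_row [a, c, b] r = insert_row [c, a, b] r \<and>
    knuth_equiv (bumped [a, c, b] r) (bumped [c, a, b] r)"
  using assms(3)
proof (induction r)
  case Nil
  then show ?case using assms by auto
next
  case (Cons y r)
  have *: "knuth_equiv ([y] @ row_bump c r @ row_bump b (row_insert c r))
       (row_bump c r @ [y] @ row_bump b (row_insert c r))" if "y \<le> c"
  proof (cases rule: row_bump_cases[of c r])
    case c: (2 z)
    obtain z' where z': "row_bump b (row_insert c r) = [z']" "z' \<le> c"
      using row_bump_after[OF assms(2), of r] Cons by auto
    have "y \<le> z'"
      using row_bump_in[of b "row_insert c r"] set_row_insert[of c r] z' Cons that by auto
    then show ?thesis using z' c knuth_equiv_triple2[of y z' z] by simp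
  qed simp
  consider "y \<le> a" | "a < y" "y \<le> c" | "c < y" by force
  then show ?case
  proof cases
    case 1
    then show ?thesis using Cons assms by auto
  next
    case 2
    then show ?thesis using assms * by auto
  next
    case 3
    show ?thesis
    proof (cases r)
      case (Cons z r')
      then show ?thesis using 3 assms knuth_equiv_triple1[of c y z] \<open>sorted (y # r)\<close> by auto
    qed (use assms 3 in auto)
  qed
qed

lemma insert_row_knuth_step:
  assumes "knuth_step u v" "sorted r"
  shows "insert_row u r = insert_row v r \<and> knuth_equiv (bumped u r) (bumped v r)"
  using assms(1)
proof cases
  case (1 a b c p q)
  have "insert_row (p @ m @ q) r = insert_row q (insert_row m (insert_row p r)) \<and>
      bumped (p @ m @ q) r = bumped p r @ bumped m (insert_row p r) @
        bumped q (insert_row m (insert_row p r))" for m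
    by (simp only: insert_row_append bumped_append)
  then show ?thesis
    using insert_row_triple1[OF 1(3,4) sorted_insert_row[OF assms(2)], of p]
    unfolding 1(1,2) by (metis knuth_equiv_context)
next
  case (2 a b c p q)
  have "insert_row (p @ m @ q) r = insert_row q (insert_row m (insert_row p r)) \<and>
      bumped (p @ m @ q) r = bumped p r @ bumped m (insert_row p r) @
        bumped q (insert_row m (insert_row p r))" for m
    by (simp only: insert_row_append bumped_append)
  then show ?thesis
    using insert_row_triple2[OF 2(3,4) sorted_insert_row[OF assms(2)], of p]
    unfolding 2(1,2) by (metis knuth_equiv_context)
qed

lemma insert_row_knuth_equiv:
  assumes "knuth_equiv u v" "sorted r"
  shows "insert_row u r = insert_row v r \<and> knuth_equiv (bumped u r) (bumped v r)"
  using assms(1)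
proof (induction rule: knuth_equiv_induct)
  case (step v w)
  then show ?case using insert_row_knuth_step[OF step(2) assms(2)] knuth_equiv_trans by metis
next
  case (sym_step v w)
  then show ?case
    using insert_row_knuth_step[OF sym_step(2) assms(2)] knuth_equiv_trans knuth_equiv_sym by metis
qed simp

text \<open>Equivalent words leave equal rows behind and send equivalent words on, so the argument
  repeats in every row.\<close>

lemma insert_word_knuth_equiv:
  "knuth_equiv u v \<Longrightarrow> \<forall>r\<in>set T. sorted r \<Longrightarrow> insert_word u T = insert_word v T"
proof (induction u T arbitrary: v rule: insert_word.induct)
  case (1 w)
  show ?case
  proof (cases "w = []")
    case True
    then show ?thesis using knuth_equiv_mset[OF 1(2)] by simp
  next
    case False
    then have "v \<noteq> []" using knuth_equiv_mset[OF 1(2)] by auto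
    then show ?thesis
      using 1 False insert_row_knuth_equiv[OF 1(2), of "[]"] by (simp add: insert_word_start)
  qed
next
  case (2 w r T)
  then show ?case using insert_row_knuth_equiv[OF 2(2), of r] by simp
qed

section \<open>A tableau is recovered from its word\<close>

lemma is_tableau_sorted: "is_tableau T \<Longrightarrow> r \<in> set T \<Longrightarrow> sorted r \<and> r \<noteq> []"
  by (induction T) auto

lemma insert_row_Nil: "sorted w \<Longrightarrow> insert_row w [] = w \<and> bumped w [] = []"
  by (induction w) (auto simp: insert_row_Cons_le)

text \<open>Each letter of \<open>r\<close> bumps exactly the entry below it: that entry is larger,
  and everything to its left has already been replaced by letters of \<open>r\<close> that are not
  larger. The remaining letters are appended.\<close>

lemma insert_row_above:
  "sorted r \<Longrightarrow> sorted s \<Longrightarrow> strictly_above r s \<Longrightarrow> insert_row r s = r \<and> bumped r s = s"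
  by (induction r s rule: strictly_above.induct) (auto simp: insert_row_Nil insert_row_Cons_le)

lemma insert_word_above:
  "is_tableau (r # T) \<Longrightarrow> insert_word r T = r # T"
proof (induction T arbitrary: r)
  case Nil
  then show ?case using insert_row_Nil[of r] by (auto simp: insert_word_start)
next
  case (Cons s T)
  then have "insert_word s T = s # T" by simp
  then show ?case using Cons.prems insert_row_above[of r s] by simp
qed

lemma insert_word_tableau_word: "is_tableau T \<Longrightarrow> insert_word (tableau_word T) [] = T"
  by (induction T) (auto simp: insert_word_append insert_word_above)

section \<open>A word is Knuth equivalent to the word of its insertion tableau\<close>

text \<open>The small letter \<open>x\<close> moves left by relations of the first kind, its second
  neighbour to the left being the middle value each time, until it stands right behind
  \<open>z\<close>.\<close>

lemma knuth_equiv_row_move: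
  "sorted (z # ys) \<Longrightarrow> x < z \<Longrightarrow> knuth_equiv (z # ys @ [x]) (z # x # ys)"
proof (induction ys rule: rev_induct)
  case (snoc c ys)
  define b where "b = last (z # ys)"
  define p where "p = butlast (z # ys)"
  have pb: "z # ys = p @ [b]" by (simp add: p_def b_def)
  have "b \<in> set (z # ys)" using pb by simp
  then have "b \<le> c" "x < b" using snoc(2,3) by (auto simp: sorted_append)
  then have "knuth_equiv (p @ [b, c, x]) (p @ [b, x, c])"
    using knuth_equiv_step[OF knuth_step.intros(1)[of x b c p "[]"]] by simp
  moreover have "z # (ys @ [c]) @ [x] = p @ [b, c, x]"
    using arg_cong[OF pb, of "\<lambda>l. l @ [c, x]"] by simp
  moreover have "(z # ys @ [x]) @ [c] = p @ [b, x, c]"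
    using arg_cong[OF pb, of "\<lambda>l. l @ [x, c]"] by simp
  ultimately have "knuth_equiv (z # (ys @ [c]) @ [x]) ((z # ys @ [x]) @ [c])"
    by (simp only:)
  also have "knuth_equiv ((z # ys @ [x]) @ [c]) ((z # x # ys) @ [c])"
    using snoc by (intro knuth_equiv_append) (auto simp: sorted_append)
  finally show ?case by simp
qed simp

text \<open>The bumped letter is carried to the front through the unaffected entries by relations of
  the second kind, the letter right after it being the middle value.\<close>

lemma knuth_equiv_row_insert:
  "sorted r \<Longrightarrow> knuth_equiv (r @ [x]) (row_bump x r @ row_insert x r)"
proof (induction r)
  case (Cons z ys)
  show ?case
  proof (cases "x < z")
    case True
    then show ?thesis using knuth_equiv_row_move[of z ys x] Cons by simp
  next
    case False
    have IH: "knuth_equiv ([z] @ ys @ [x]) ([z] @ row_bump x ys @ row_insert x ys)"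
      using Cons by (intro knuth_equiv_append[of "[z]" "[z]"]) auto
    show ?thesis
    proof (cases rule: row_bump_cases[of x ys])
      case 1
      then show ?thesis using IH False by simp
    next
      case (2 y)
      obtain h t where ht: "row_insert x ys = h # t"
        by (meson neq_Nil_conv row_insert_neq_Nil)
      have "h \<le> x" using ht False Cons by (cases ys) (auto split: if_splits)
      moreover have "z \<le> h" using ht False Cons by (cases ys) (auto split: if_splits)
      ultimately have "knuth_equiv ([z, y, h] @ t) ([y, z, h] @ t)"
        using 2 by (intro knuth_equiv_append knuth_equiv_triple2) auto
      then show ?thesis using IH False 2 ht knuth_equiv_trans by simp
    qed
  qed
qed simp

lemma knuth_equiv_insert_row:
  "sorted r \<Longrightarrow> knuth_equiv (r @ w) (bumped w r @ insert_row w r)"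
proof (induction w arbitrary: r)
  case (Cons x w)
  have "knuth_equiv ((r @ [x]) @ w) ((row_bump x r @ row_insert x r) @ w)"
    using Cons by (intro knuth_equiv_append knuth_equiv_row_insert) auto
  moreover have "knuth_equiv (row_bump x r @ row_insert x r @ w)
      (row_bump x r @ bumped w (row_insert x r) @ insert_row w (row_insert x r))"
    using Cons by (intro knuth_equiv_append Cons.IH) (auto simp: sorted_row_insert)
  ultimately show ?case using knuth_equiv_trans by (simp) blast
qed simp

lemma knuth_equiv_insert_word:
  "\<forall>r\<in>set T. sorted r \<Longrightarrow> knuth_equiv (tableau_word T @ w) (tableau_word (insert_word w T))"
proof (induction w T rule: insert_word.induct)
  case (1 w)
  show ?case
  proof (cases "w = []")
    case False
    have "knuth_equiv (bumped w [] @ insert_row w [])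
        (tableau_word (insert_word (bumped w []) []) @ insert_row w [])"
      using 1(1)[OF False] by (intro knuth_equiv_append) auto
    moreover have "knuth_equiv w (bumped w [] @ insert_row w [])"
      using knuth_equiv_insert_row[of "[]" w] by simp
    ultimately show ?thesis
      using False knuth_equiv_trans by (simp add: insert_word_start) blast
  qed simp
next
  case (2 w r T)
  have "knuth_equiv (tableau_word T @ (r @ w)) (tableau_word T @ (bumped w r @ insert_row w r))"
    using 2 by (intro knuth_equiv_append knuth_equiv_insert_row) auto
  moreover have "knuth_equiv ((tableau_word T @ bumped w r) @ insert_row w r)
      (tableau_word (insert_word (bumped w r) T) @ insert_row w r)"
    using 2 by (intro knuth_equiv_append) auto
  ultimately show ?case using knuth_equiv_trans by simp blast
qed

section \<open>Insertion preserves tableaux\<close>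

lemma row_insert_above:
  "strictly_above r s \<Longrightarrow> sorted r \<Longrightarrow> strictly_above (row_insert x r) s"
  by (induction r s rule: strictly_above.induct) auto

text \<open>The entry of \<open>s\<close> below the bumped \<open>y\<close> is larger than
  \<open>y\<close>, so \<open>y\<close> lands in that column or to its left. There the entry above
  it is at most \<open>x\<close>, which is smaller than \<open>y\<close>.\<close>

lemma row_insert_above_bump:
  "strictly_above r s \<Longrightarrow> sorted r \<Longrightarrow> sorted s \<Longrightarrow> row_bump x r = [y] \<Longrightarrow>
   strictly_above (row_insert x r) (row_insert y s)"
proof (induction r s rule: strictly_above.induct)
  case (1 r)
  have "x < y" using row_bump_greater[of y x r] 1 by simp
  then show ?case using 1 by (cases r) auto
next
  case (3 a r z s)
  have "a < y" if "\<not> x < a" 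
    using that 3 row_bump_greater[of y x r] by (auto split: if_splits)
  then show ?case using 3 by (auto simp: row_insert_above split: if_splits)
qed simp

lemma insert_row_above_bumped:
  "strictly_above r s \<Longrightarrow> sorted r \<Longrightarrow> sorted s \<Longrightarrow>
   strictly_above (insert_row w r) (insert_row (bumped w r) s)"
proof (induction w arbitrary: r s)
  case (Cons x w)
  show ?case
  proof (cases rule: row_bump_cases[of x r])
    case 1
    then show ?thesis using Cons by (simp add: row_insert_above sorted_row_insert)
  next
    case (2 y)
    then show ?thesis using Cons by (simp add: row_insert_above_bump sorted_row_insert)
  qed
qed simp

lemma insert_row_neq_Nil: "r \<noteq> [] \<or> w \<noteq> [] \<Longrightarrow> insert_row w r \<noteq> []"
  by (induction w arbitrary: r) auto

lemma sorted_first_row: "is_tableau T \<Longrightarrow> sorted (first_row T)"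
  by (cases T) auto

lemma is_tableau_insert_word: "is_tableau T \<Longrightarrow> is_tableau (insert_word w T)"
proof (induction w T rule: insert_word.induct)
  case (1 w)
  then show ?case
    using insert_row_above_bumped[of "[]" "[]" w]
    by (cases "w = []")
      (simp_all add: insert_word_start first_row_insert_word sorted_insert_row insert_row_neq_Nil)
next
  case (2 w r T)
  then show ?case using insert_row_above_bumped[of r "first_row T" w]
    by (auto simp: first_row_insert_word sorted_insert_row insert_row_neq_Nil sorted_first_row)
qed

text \<open>Schensted's insertion tableau of a word.\<close>

definition P_tableau :: "'a::linorder list \<Rightarrow> 'a list list" where
  "P_tableau w = insert_word w []"

lemma is_tableau_P: "is_tableau (P_tableau w)"
  by (simp add: P_tableau_def is_tableau_insert_word)

lemma knuth_equiv_P: "knuth_equiv (tableau_word (P_tableau w)) w"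
  using knuth_equiv_insert_word[of "[]" w] by (simp add: P_tableau_def knuth_equiv_sym)

text \<open>Insertion does not distinguish equivalent words and returns a tableau from its own word,
  so a Knuth class contains the word of at most one tableau.\<close>

lemma P_tableau_unique:
  assumes "is_tableau T" "knuth_equiv (tableau_word T) w"
  shows "T = P_tableau w"
  using insert_word_knuth_equiv[OF assms(2), of "[]"] insert_word_tableau_word[OF assms(1)]
  by (simp add: P_tableau_def)

section \<open>The first column and the first row of a product\<close>

text \<open>For a sorted word the fate of the first entry \<open>y\<close> is decided by the first
  letter: either \<open>x\<close> replaces \<open>y\<close> and no later letter disturbs
  \<open>x\<close>, or every letter passes \<open>y\<close>. This gives a recursion along the row
  instead of along the word, on which the following inductions rest.\<close>

lemma insert_row_sorted_Cons:
  assumes "sorted (x # w)"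
  shows "insert_row (x # w) (y # ys) =
      (if x < y then x # insert_row w ys else y # insert_row (x # w) ys)"
    and "bumped (x # w) (y # ys) = (if x < y then y # bumped w ys else bumped (x # w) ys)"
proof -
  have "x < y \<or> (\<forall>z\<in>set (x # w). y \<le> z)" using assms by force
  then show "insert_row (x # w) (y # ys) =
      (if x < y then x # insert_row w ys else y # insert_row (x # w) ys)"
    and "bumped (x # w) (y # ys) = (if x < y then y # bumped w ys else bumped (x # w) ys)"
    using assms insert_row_Cons_le[of "x # w" y ys] insert_row_Cons_le[of w x ys] by auto
qed

lemma sorted_bumped:
  "sorted w \<Longrightarrow> sorted r \<Longrightarrow> sorted (bumped w r) \<and> set (bumped w r) \<subseteq> set r"
proof (induction r arbitrary: w)
  case Nil
  then show ?case by (simp add: insert_row_Nil)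
next
  case (Cons y ys)
  show ?case
  proof (cases w)
    case w: (Cons x w')
    then show ?thesis
      using Cons.IH[of w] Cons.IH[of w'] Cons.prems
      by (auto simp: insert_row_sorted_Cons simp del: insert_row.simps bumped.simps)
  qed simp
qed

lemma length_insert_row: "length (insert_row w r) + length (bumped w r) = length w + length r"
  using arg_cong[OF mset_insert_row[of w r], of size] by simp

lemma length_row_insert: "length (row_insert x r) \<ge> length r"
  by (induction r) auto

lemma length_insert_row_ge: "length (insert_row w r) \<ge> length r"
proof (induction w arbitrary: r)
  case (Cons x w)
  show ?case using Cons[of "row_insert x r"] length_row_insert[of r x] by simp
qed simp

lemma length_bumped_le: "sorted w \<Longrightarrow> length (bumped w r) \<le> length r"
proof (induction r arbitrary: w)
  case Nil
  then show ?case by (simp add: insert_row_Nil)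
next
  case (Cons y ys)
  show ?case
  proof (cases w)
    case w: (Cons x w')
    then show ?thesis
      using Cons.IH[of w] Cons.IH[of w'] Cons.prems
      by (auto simp: insert_row_sorted_Cons simp del: insert_row.simps bumped.simps)
  qed simp
qed

lemma strictly_above_length: "strictly_above r s \<Longrightarrow> length s \<le> length r"
  by (induction r s rule: strictly_above.induct) auto

lemma is_tableau_length: "is_tableau T \<Longrightarrow> r \<in> set T \<Longrightarrow> length r \<le> length (first_row T)"
proof (induction T)
  case (Cons s T)
  then show ?case using strictly_above_length[of s "first_row T"] by auto
qed simp

text \<open>For a tableau this is the length of its second column, hence
  \<open>conjugate \<mu> 2\<close> for shape \<mu>.\<close>

definition long_rows :: "'a list list \<Rightarrow> nat" where
  "long_rows T = length (filter (\<lambda>r. 2 \<le> length r) T)"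

lemma long_rows_simps [simp]:
  "long_rows [] = 0"
  "long_rows (r # T) = (if 2 \<le> length r then 1 else 0) + long_rows T"
  by (simp_all add: long_rows_def)

lemma long_rows_eq_0: "is_tableau T \<Longrightarrow> length (first_row T) \<le> 1 \<Longrightarrow> long_rows T = 0"
  unfolding long_rows_def using is_tableau_length[of T] by (fastforce simp: filter_empty_conv)

text \<open>A chain reaction: the letter that replaces the corner sends the old corner on as the
  first letter of the bumped word, and by column strictness that letter is smaller than the head of
  the next row.\<close>

lemma first_column_push:
  assumes "is_tableau T" "sorted (x # w)" "T = [] \<or> x < hd (first_row T)"
  shows "map hd (insert_word (x # w) T) = x # map hd T"
  using assms
proof (induction T arbitrary: x w)
  case Nil
  then show ?case by (simp add: insert_word_start insert_row_Nil insert_row_Cons_le)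
next
  case (Cons s T)
  obtain c s' where s: "s = c # s'" using Cons.prems(1) by (cases s) auto
  then have xc: "x < c" using Cons.prems(3) by simp
  have e: "bumped (x # w) s = c # bumped w s'"
    using xc insert_row_sorted_Cons(2)[OF Cons.prems(2), of c s'] s by simp
  have e2: "insert_row (x # w) s = x # insert_row w s'"
    using xc insert_row_sorted_Cons(1)[OF Cons.prems(2), of c s'] s by simp
  have "sorted (c # bumped w s')"
    using sorted_bumped[of "x # w" s] Cons.prems e by auto
  moreover have "T = [] \<or> c < hd (first_row T)"
    using Cons.prems s by (cases T; cases "first_row T") auto
  ultimately have "map hd (insert_word (c # bumped w s') T) = c # map hd T"
    using Cons by auto
  then show ?case using e e2 s by (simp del: insert_row.simps bumped.simps)
qed

text \<open>A new entry of the first column comes from a row above which had at least two entries, and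
  only the first letter of a sorted word can cause it.\<close>

lemma first_column_insert:
  assumes "is_tableau T" "sorted w"
  shows "map hd (insert_word w T) = map hd T \<or>
    (\<exists>A z B. map hd T = A @ B \<and> map hd (insert_word w T) = A @ z # B \<and> length A \<le> long_rows T)"
  using assms
proof (induction T arbitrary: w)
  case Nil
  show ?case
  proof (cases w)
    case (Cons x w')
    then show ?thesis using first_column_push[of "[]" x w'] Nil by fastforce
  qed simp
next
  case (Cons r T)
  obtain a r' where r: "r = a # r'" using Cons.prems(1) by (cases r) auto
  show ?case
  proof (cases w)
    case w: (Cons x w')
    show ?thesis
    proof (cases "x < a")
      case True
      then show ?thesis using first_column_push[of "r # T" x w'] Cons.prems r w by fastforce
    next
      case False
      then have ge: "\<forall>y\<in>set w. a \<le> y" using w Cons.prems(2) by auto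
      have e: "insert_row w r = a # insert_row w r'" "bumped w r = bumped w r'"
        using insert_row_Cons_le[OF ge] r by auto
      show ?thesis
      proof (cases "bumped w r' = []")
        case True
        then show ?thesis using e r by simp
      next
        case b: False
        then have "2 \<le> length r" using r Cons.prems(2) by (cases r') (auto simp: insert_row_Nil)
        moreover have "sorted (bumped w r')"
          using sorted_bumped[of w r'] Cons.prems r by auto
        ultimately have "map hd (insert_word (bumped w r') T) = map hd T \<or>
            (\<exists>A z B. map hd (r # T) = (a # A) @ B \<and>
              map hd (insert_word w (r # T)) = (a # A) @ z # B \<and>
              length (a # A) \<le> long_rows (r # T))"
          using Cons.IH[of "bumped w r'"] Cons.prems(1) e r by fastforce
        then show ?thesis using e r by (metis insert_word.simps(2) list.sel(1) list.simps(9))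
      qed
    qed
  qed simp
qed

text \<open>In a single column every row passes on its only entry, which is smaller than the next
  one, so the column moves down as a whole and stays a single column.\<close>

lemma long_rows_push:
  assumes "is_tableau T" "T = [] \<or> x < hd (first_row T)" "length (first_row T) \<le> 1"
  shows "long_rows (insert_word [x] T) = 0"
  using assms
proof (induction T arbitrary: x)
  case Nil
  then show ?case by (simp add: insert_word_start)
next
  case (Cons s T)
  obtain c where s: "s = [c]" using Cons.prems(1,3) by (cases s) auto
  have "T = [] \<or> c < hd (first_row T)"
    using Cons.prems s by (cases T; cases "first_row T") auto
  moreover have "length (first_row T) \<le> 1"
    using Cons.prems strictly_above_length[of s "first_row T"] by simp
  ultimately show ?case using Cons s by simp
qed

text \<open>Long rows stay long. A row \<open>[c]\<close> may become long itself, but it can pass on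
  at most \<open>c\<close>, and below it there is only a single column, which \<open>c\<close>
  pushes down without creating a further long row.\<close>

lemma long_rows_insert:
  assumes "is_tableau T" "sorted w"
  shows "long_rows (insert_word w T) \<le> Suc (long_rows T)"
  using assms
proof (induction T arbitrary: w)
  case Nil
  then show ?case by (cases "w = []") (simp_all add: insert_word_start insert_row_Nil)
next
  case (Cons r T)
  have sb: "sorted (bumped w r)" using sorted_bumped[of w r] Cons.prems by simp
  show ?case
  proof (cases "2 \<le> length r")
    case True
    then show ?thesis
      using Cons.IH[OF _ sb] Cons.prems length_insert_row_ge[of r w] by simp
  next
    case False
    then obtain c where r: "r = [c]" using Cons.prems(1) by (cases r; cases "tl r") auto
    have l: "length (first_row T) \<le> 1"
      using Cons.prems strictly_above_length[of r "first_row T"] r by simp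
    have "T = [] \<or> c < hd (first_row T)"
      using Cons.prems r by (cases T; cases "first_row T") auto
    then have "long_rows (insert_word [c] T) = 0" using long_rows_push[of T c] l Cons.prems by simp
    moreover have "bumped w r = [] \<or> bumped w r = [c]"
      using sorted_bumped[of w r] length_bumped_le[of w r] Cons.prems r
      by (cases "bumped w r"; cases "tl (bumped w r)") auto
    moreover have "long_rows T = 0" using long_rows_eq_0[of T] Cons.prems l by simp
    ultimately show ?thesis by auto
  qed
qed

text \<open>The rows of \<open>N\<close> are inserted from the bottom up. Each inserts at most one
  entry into the first column, at an index not exceeding the current number of long rows, and raises
  that number by at most one. Entries from index \<open>d\<close> on are therefore never separated
  or overtaken.\<close>

lemma first_column_suffix:
  assumes "is_tableau M" "is_tableau N" "long_rows M + length N \<le> Suc d"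
  shows "long_rows (insert_word (tableau_word N) M) \<le> long_rows M + length N \<and>
    length M \<le> length (insert_word (tableau_word N) M) \<and>
    (d < length M \<longrightarrow> (\<exists>C. map hd (insert_word (tableau_word N) M) = C @ drop d (map hd M) \<and> d \<le> length C))"
  using assms(2,3)
proof (induction N)
  case Nil
  then show ?case by (auto intro: exI[of _ "take d (map hd M)"])
next
  case (Cons r N)
  define T where "T = insert_word (tableau_word N) M"
  have T: "is_tableau T" using assms(1) by (simp add: T_def is_tableau_insert_word)
  have IH: "long_rows T \<le> long_rows M + length N" "length M \<le> length T"
    "d < length M \<Longrightarrow> (\<exists>C. map hd T = C @ drop d (map hd M) \<and> d \<le> length C)"
    using Cons by (auto simp: T_def)
  have r: "sorted r" using Cons.prems by simp
  have e: "insert_word (tableau_word (r # N)) M = insert_word r T"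
    by (simp add: T_def insert_word_append)
  have "long_rows (insert_word r T) \<le> Suc (long_rows T)" using long_rows_insert T r by blast
  moreover have "length M \<le> length (insert_word r T) \<and> (d < length M \<longrightarrow>
    (\<exists>C. map hd (insert_word r T) = C @ drop d (map hd M) \<and> d \<le> length C))"
    using first_column_insert[OF T r]
  proof (elim disjE exE conjE)
    assume "map hd (insert_word r T) = map hd T"
    moreover from this have "length (insert_word r T) = length T"
      using map_eq_imp_length_eq by blast
    ultimately show ?thesis using IH by simp
  next
    fix A z B
    assume AB: "map hd T = A @ B" "map hd (insert_word r T) = A @ z # B"
      and A: "length A \<le> long_rows T"
    have "length (insert_word r T) = Suc (length T)"
      using AB by (metis add_Suc_right length_Cons length_append length_map)
    moreover have "\<exists>C. map hd (insert_word r T) = C @ drop d (map hd M) \<and> d \<le> length C"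
      if d: "d < length M"
    proof -
      obtain C where C: "map hd T = C @ drop d (map hd M)" "d \<le> length C" using IH(3) d by blast
      \<comment> \<open>The row \<open>r\<close> meets at most
        \<open>long_rows M + length N \<le> d\<close> long rows; since \<open>r\<close> itself is
        counted in the hypothesis, the bound there may be \<open>Suc d\<close>. Hence the new entry
        falls inside \<open>C\<close>, above the preserved suffix.\<close>
      have "length A \<le> length C" using A IH(1) Cons.prems C(2) by simp
      then obtain D where "C = A @ D" "B = D @ drop d (map hd M)"
        using AB(1) C(1) by (auto simp: append_eq_append_conv2)
      then show ?thesis using AB C(2) by (intro exI[of _ "A @ z # D"]) simp
    qed
    ultimately show ?thesis using IH(2) by simp
  qed
  ultimately show ?case using IH(1) e by simp
qed

text \<open>The preserved suffix places the entry by its distance from the bottom of the first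
  column, so its row depends only on the lengths of the columns.\<close>

lemma insert_word_first_column:
  assumes "is_tableau M" "is_tableau N" "long_rows M + length N \<le> Suc i" "i < length M"
  defines "T \<equiv> insert_word (tableau_word N) M"
  shows "length M \<le> length T" "hd (T ! (length T - length M + i)) = hd (M ! i)"
proof -
  show l: "length M \<le> length T"
    using first_column_suffix[OF assms(1-3)] by (simp add: T_def)
  obtain C where C: "map hd T = C @ drop i (map hd M)"
    using first_column_suffix[OF assms(1-3)] assms(4) by (auto simp: T_def)
  have lC: "length C + (length M - i) = length T"
    using arg_cong[OF C, of length] by simp
  then have "length T - length M + i = length C" using l assms(4) by simp
  then have "map hd T ! (length T - length M + i) = map hd M ! i"
    using C assms(4) by (simp only: nth_append_length_plus[of C _ 0, simplified]) simp
  then show "hd (T ! (length T - length M + i)) = hd (M ! i)"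
    using assms(4) l by simp
qed

section \<open>The first row of a product\<close>

text \<open>Later letters of a sorted word are not smaller than the earlier ones and so never bump
  them.\<close>

lemma subseq_insert_row: "sorted w \<Longrightarrow> sorted r \<Longrightarrow> subseq w (insert_row w r)"
proof (induction r arbitrary: w)
  case Nil
  then show ?case by (simp add: insert_row_Nil)
next
  case (Cons y ys)
  show ?case
  proof (cases w)
    case w: (Cons x w')
    then show ?thesis
      using Cons.IH[of w] Cons.IH[of w'] Cons.prems subseq_Cons'[of x w' "insert_row w ys"]
      by (auto simp: insert_row_sorted_Cons simp del: insert_row.simps bumped.simps)
  qed simp
qed

text \<open>Every letter of \<open>w'\<close> present in the row gives the letter of
  \<open>w\<close> above it something larger to bump, so at least \<open>length w'\<close> of the
  letters of \<open>w\<close> do not lengthen the row.\<close>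

lemma length_insert_row_above:
  assumes "sorted w" "subseq w' r" "strictly_above w w'"
  shows "length (insert_row w r) + length w' \<le> length r + length w"
  using assms
proof (induction r arbitrary: w w')
  case Nil
  then show ?case by (simp add: insert_row_Nil)
next
  case (Cons y ys)
  show ?case
  proof (cases w')
    case Nil
    then show ?thesis using length_insert_row[of w "y # ys"] by simp
  next
    case w': (Cons z w1')
    then obtain x w1 where w: "w = x # w1" "x < z" "strictly_above w1 w1'"
      using Cons.prems by (cases w) auto
    show ?thesis
    proof (cases "x < y")
      case True
      have "subseq w1' ys" using Cons.prems(2) w' by (cases "z = y") (auto dest: subseq_Cons')
      then show ?thesis using Cons.IH[of w1 w1'] True w w' Cons.prems(1)
        by (auto simp: insert_row_sorted_Cons simp del: insert_row.simps bumped.simps)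
    next
      case False
      then have "subseq w' ys" using Cons.prems(2) w' w(2) by auto
      then show ?thesis using Cons.IH[of w w'] False w Cons.prems
        by (auto simp: insert_row_sorted_Cons simp del: insert_row.simps bumped.simps)
    qed
  qed
qed

text \<open>The letter of index \<open>q\<close> of a sorted word lands at index \<open>q\<close> or
  later. In a row of at most \<open>Suc q\<close> entries this is the last place or beyond, so
  nothing but the rest of the word can stand to its right.\<close>

lemma insert_row_suffix:
  assumes "sorted w" "length r \<le> Suc q"
  shows "suffix (drop q w) (insert_row w r)"
  using assms
proof (induction r arbitrary: w q)
  case Nil
  then show ?case by (simp add: insert_row_Nil suffix_drop)
next
  case (Cons y ys)
  show ?case
  proof (cases w)
    case w: (Cons x w')
    show ?thesis
    proof (cases q)
      case 0
      then have "ys = []" using Cons.prems(2) by simp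
      then show ?thesis using w 0 Cons.prems(1)
        by (auto simp: insert_row_sorted_Cons insert_row_Nil suffix_ConsI
            simp del: insert_row.simps bumped.simps)
    next
      case (Suc q')
      have "suffix (drop q w) (drop q' w)"
        by (metis Suc drop_drop plus_1_eq_Suc suffix_drop)
      then show ?thesis
        using Cons.IH[of w q'] Cons.IH[of w' q'] Cons.prems w Suc suffix_order.trans
        by (auto simp: insert_row_sorted_Cons suffix_ConsI simp del: insert_row.simps bumped.simps)
    qed
  qed simp
qed

text \<open>The growth telescopes: after a row of \<open>N\<close> has been inserted, it is still
  contained in the first row, so the next row up adds at most the difference of the two
  lengths.\<close>

lemma first_row_length:
  assumes "sorted (first_row M)" "is_tableau N"
  shows "length (insert_row (tableau_word N) (first_row M))
     \<le> length (first_row M) + length (first_row N) \<and>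
    subseq (first_row N) (insert_row (tableau_word N) (first_row M))"
  using assms(2)
proof (induction N)
  case (Cons r N)
  define r1 where "r1 = insert_row (tableau_word N) (first_row M)"
  have r: "sorted r" using Cons.prems by simp
  have r1: "length r1 \<le> length (first_row M) + length (first_row N)" "subseq (first_row N) r1"
    using Cons by (auto simp: r1_def)
  have e: "insert_row (tableau_word (r # N)) (first_row M) = insert_row r r1"
    by (simp add: r1_def insert_row_append)
  have "length (insert_row r r1) + length (first_row N) \<le> length r1 + length r"
    using length_insert_row_above[OF r r1(2)] Cons.prems by simp
  moreover have "subseq r (insert_row r r1)"
    using subseq_insert_row[OF r] assms(1) by (simp add: r1_def sorted_insert_row)
  ultimately show ?case using r1 e by simp
qed simp

text \<open>Before the top row \<open>r\<close> arrives, the first row has at most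
  \<open>length (first_row M) + length (first_row N)\<close> entries. The bound by
  \<open>Suc j\<close> is what \<open>insert_row_suffix\<close> needs to keep the letters of
  \<open>r\<close> from index \<open>j\<close> on at the end.\<close>

lemma insert_word_first_row:
  assumes "is_tableau M" "is_tableau (r # N)"
    and "length (first_row M) + length (first_row N) \<le> Suc j" "j < length r"
  defines "T \<equiv> insert_word (tableau_word (r # N)) M"
  shows "length r \<le> length (first_row T)"
    "first_row T ! (length (first_row T) - length r + j) = r ! j"
proof -
  define r1 where "r1 = insert_row (tableau_word N) (first_row M)"
  have s: "sorted (first_row M)" using assms(1) by (rule sorted_first_row)
  have T: "first_row T = insert_row r r1"
    by (simp add: T_def r1_def first_row_insert_word insert_row_append)
  have sr: "sorted r" using assms(2) by simp
  show l: "length r \<le> length (first_row T)"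
    using list_emb_length[OF subseq_insert_row[OF sr, of r1]] s
    by (simp add: T r1_def sorted_insert_row)
  have "length r1 \<le> Suc j"
    using first_row_length[OF s, of N] assms(2,3) by (simp add: r1_def)
  then obtain C where C: "first_row T = C @ drop j r"
    using insert_row_suffix[OF sr] T by (metis suffixE)
  have "length C + (length r - j) = length (first_row T)"
    using arg_cong[OF C, of length] by simp
  then have "length (first_row T) - length r + j = length C" using l assms(4) by simp
  then show "first_row T ! (length (first_row T) - length r + j) = r ! j"
    using C assms(4) by (simp only: nth_append_length_plus[of C _ 0, simplified]) simp
qed

section \<open>The Pieri rule and structure constants\<close>

text \<open>Inverse of inserting a sorted word into a row of length \<open>m\<close>, with resulting row \<open>t\<close> and bumped
  word \<open>b\<close>: the first entry of \<open>t\<close> was already in the row iff the rest of \<open>t\<close> leaves enough room for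
  all bumping positions. The second equation is junk.\<close>

fun unbump :: "nat \<Rightarrow> 'a::linorder list \<Rightarrow> 'a list \<Rightarrow> 'a list \<times> 'a list" where
  "unbump 0 t b = ([], t)"
| "unbump (Suc m) [] b = ([], [])"
| "unbump (Suc m) (x # t) b =
     (if strictly_above (take m t) b
      then (x # fst (unbump m t b), snd (unbump m t b))
      else (hd b # fst (unbump m t (tl b)), x # snd (unbump m t (tl b))))"

text \<open>The entries of \<open>l\<close> move one column to the right, so each letter of
  \<open>b\<close> now stands below an entry that is not larger than before.\<close>

lemma strictly_above_Cons: "sorted (y # l) \<Longrightarrow> strictly_above l b \<Longrightarrow> strictly_above (y # l) b"
proof (induction l b arbitrary: y rule: strictly_above.induct)
  case (3 x r z s)
  then show ?case by auto
qed auto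

text \<open>This detects that \<open>y\<close> was bumped from the column before \<open>ys\<close>.
  If the shifted word fitted, each column in turn would have to bump its entry, because an old entry
  cannot be smaller than the bumped one preceding it; finally no column would be left.\<close>

lemma not_strictly_above_bumped:
  "sorted (y # ys) \<Longrightarrow> sorted w \<Longrightarrow>
   \<not> strictly_above (take (length ys) (insert_row w ys)) (y # bumped w ys)"
proof (induction ys arbitrary: y w)
  case (Cons z zs)
  show ?case
  proof (cases w)
    case w: (Cons x w')
    then show ?thesis
      using Cons.IH[of z w'] Cons.prems
      by (auto simp: insert_row_sorted_Cons simp del: insert_row.simps bumped.simps)
  qed (use Cons.prems in auto)
qed simp

text \<open>The second conjunct drives the induction: it makes the test in \<open>unbump\<close>
  succeed when the first entry stayed, while \<open>not_strictly_above_bumped\<close> makes it fail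
  when the entry was bumped.\<close>

lemma unbump_insert_row:
  assumes "sorted r" "sorted w"
  shows "unbump (length r) (insert_row w r) (bumped w r) = (r, w) \<and>
    strictly_above (take (length r) (insert_row w r)) (bumped w r)"
  using assms
proof (induction r arbitrary: w)
  case Nil
  then show ?case by (simp add: insert_row_Nil)
next
  case (Cons y ys)
  have sorted_take: "sorted (take n (insert_row w (y # ys)))" for n
    using Cons.prems sorted_insert_row sorted_wrt_take by blast
  show ?case
  proof (cases "w = [] \<or> y \<le> hd w")
    case True
    then have "\<forall>x\<in>set w. y \<le> x" using Cons.prems(2) by (cases w) auto
    then have e: "insert_row w (y # ys) = y # insert_row w ys" "bumped w (y # ys) = bumped w ys"
      by (simp_all add: insert_row_Cons_le)
    then show ?thesis
      using Cons.IH[of w] Cons.prems sorted_take[of "Suc (length ys)"]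
      by (auto intro: strictly_above_Cons)
  next
    case False
    then obtain x w' where w: "w = x # w'" "x < y" by (cases w) auto
    then have e: "insert_row w (y # ys) = x # insert_row w' ys"
       "bumped w (y # ys) = y # bumped w' ys"
      using Cons.prems by (auto simp: insert_row_sorted_Cons simp del: insert_row.simps bumped.simps)
    then show ?thesis
      using Cons.IH[of w'] Cons.prems w not_strictly_above_bumped[of y ys w'] by auto
  qed
qed

lemma insert_row_unbump:
  assumes "sorted t" "sorted b" "m \<le> length t" "strictly_above (take m t) b"
    and "unbump m t b = (r, w)"
  shows "insert_row w r = t \<and> bumped w r = b \<and> length r = m \<and> sorted r \<and> sorted w"
  using assms
proof (induction m t b arbitrary: r w rule: unbump.induct)
  case (1 t b)
  then show ?case by (cases b) (auto simp: insert_row_Nil)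
next
  case (3 m x t b)
  show ?case
  proof (cases "strictly_above (take m t) b")
    case True
    define r' where "r' = fst (unbump m t b)"
    have "(x # r', snd (unbump m t b)) = (r, w)"
      using "3.prems"(5) True by (simp only: unbump.simps if_True r'_def)
    then have r': "r = x # r'" "unbump m t b = (r', w)" by (simp_all add: r'_def prod_eq_iff)
    have IH: "insert_row w r' = t \<and> bumped w r' = b \<and> length r' = m \<and> sorted r' \<and> sorted w"
      by (rule "3.IH"(1)[OF True]) (use "3.prems"(1-3) True r'(2) in simp_all)
    have "\<forall>z\<in>set b. x \<le> z"
    proof (cases b)
      case (Cons z b')
      then have "x < z" using "3.prems"(4) by simp
      then show ?thesis using "3.prems"(2) Cons by auto
    qed simp
    then have "\<forall>z\<in>set t \<union> set b. x \<le> z" using "3.prems"(1) by auto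
    moreover have "set w \<union> set r' = set t \<union> set b"
      using IH mset_insert_row[of w r'] by (metis set_mset_mset set_mset_union)
    ultimately have "\<forall>z\<in>set w \<union> set r'. x \<le> z" by simp
    then show ?thesis using IH r' by (auto simp: insert_row_Cons_le)
  next
    case False
    then obtain y b' where b: "b = y # b'" by (cases b) auto
    define r' w' where "r' = fst (unbump m t b')" and "w' = snd (unbump m t b')"
    have "(y # r', x # w') = (r, w)"
      using "3.prems"(5) False by (simp only: unbump.simps if_False r'_def w'_def b list.sel)
    then have r': "r = y # r'" "w = x # w'" "unbump m t b' = (r', w')"
      by (simp_all add: r'_def w'_def prod_eq_iff)
    have xy: "x < y" "strictly_above (take m t) b'" using "3.prems"(4) b by auto
    have "insert_row w' r' = t \<and> bumped w' r' = tl b \<and> length r' = m \<and> sorted r' \<and> sorted w'"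
      by (rule "3.IH"(3)[OF False]) (use "3.prems"(1-3) r'(3) b xy in simp_all)
    then have IH: "insert_row w' r' = t \<and> bumped w' r' = b' \<and> length r' = m \<and> sorted r' \<and> sorted w'"
      using b by simp
    have "\<forall>z\<in>set t \<union> set b'. x \<le> z" using "3.prems"(1,2) b xy by auto
    moreover have "set w' \<union> set r' = set t \<union> set b'"
      using IH mset_insert_row[of w' r'] by (metis set_mset_mset set_mset_union)
    ultimately have "\<forall>z\<in>set w'. x \<le> z" by auto
    then have sw: "sorted w" using IH r' by simp
    \<comment> \<open>Suppose \<open>hd r'\<close> is smaller than \<open>y\<close>. If it stays in
      the row, it heads \<open>t\<close>, so \<open>b\<close> would fit below
      \<open>take m t\<close> and the test would have succeeded. If it is bumped, it occurs in
      \<open>b'\<close> behind the larger \<open>y\<close>, although \<open>b\<close> is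
      sorted.\<close>
    have "y \<le> hd r'" if ne: "r' \<noteq> []"
    proof (rule ccontr)
      assume y: "\<not> y \<le> hd r'"
      obtain z zs where z: "r' = z # zs" using ne by (cases r') auto
      show False
      proof (cases "w' = [] \<or> z \<le> hd w'")
        case True
        then have "\<forall>x\<in>set w'. z \<le> x" using IH by (cases w') auto
        then have e: "t = z # insert_row w' zs" "b' = bumped w' zs"
          using IH z by (simp_all add: insert_row_Cons_le)
        have "strictly_above (take (length zs) (insert_row w' zs)) b'"
          using unbump_insert_row[of zs w'] IH z e by simp
        then have "strictly_above (take m t) (y # b')" using e IH z y by auto
        then show False using False b by simp
      next
        case F: False
        then obtain u w'' where w'': "w' = u # w''" "u < z" by (cases w') auto
        have "z \<in> set b'" using IH z w'' insert_row_sorted_Cons(2)[of u w'' z zs] by auto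
        then show False using "3.prems"(2) b y z by auto
      qed
    qed
    then have "sorted r" using IH r' by (cases r') auto
    moreover have "insert_row w r = x # t \<and> bumped w r = b"
      using r' xy IH b sw insert_row_sorted_Cons[of x w' y r'] by simp
    ultimately show ?thesis using IH r' sw by simp
  qed
qed auto

text \<open>Deleting letters of \<open>s\<close> moves the others to the left, below entries of
  \<open>t\<close> that are not larger.\<close>

lemma strictly_above_subseq:
  "strictly_above t s \<Longrightarrow> subseq b s \<Longrightarrow> sorted t \<Longrightarrow> strictly_above t b"
proof (induction t s arbitrary: b rule: strictly_above.induct)
  case (3 x r y s)
  show ?case
  proof (cases "b \<noteq> [] \<and> hd b = y")
    case True
    then obtain b' where b: "b = y # b'" by (cases b) auto
    then have "subseq b' s" using 3 by simp
    then show ?thesis using 3 b by simp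
  next
    case False
    then have "subseq b s" using 3(3) by (cases b) auto
    then have "strictly_above r b" using 3 by simp
    then show ?thesis using 3 strictly_above_Cons by blast
  qed
next
  case (1 r)
  then show ?case by (cases b) auto
qed auto

lemma strictly_above_take: "strictly_above t b \<Longrightarrow> length b \<le> m \<Longrightarrow> strictly_above (take m t) b"
proof (induction t b arbitrary: m rule: strictly_above.induct)
  case (3 x r y s)
  then show ?case by (cases m) auto
qed auto

text \<open>As long as letters bump, the length of \<open>r\<close> is unchanged and strictness is
  preserved, which bounds the length of the lower row. After the first letter that bumps nothing, no
  later letter of a sorted word bumps.\<close>

lemma length_insert_row_bumped:
  assumes "sorted r" "sorted s" "sorted w" "strictly_above r s"
  shows "length (insert_row (bumped w r) s) \<le> length r"
  using assms
proof (induction w arbitrary: r s)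
  case Nil
  then show ?case by (simp add: strictly_above_length)
next
  case (Cons x w)
  show ?case
  proof (cases rule: row_bump_cases[of x r])
    case 1
    have *: "bumped w (row_insert x r) = []"
      using 1 Cons.prems(3)
    proof (induction w arbitrary: x r)
      case (Cons x' w)
      then show ?case using row_bump_None_mono[of x x' r] by simp
    qed simp
    then show ?thesis using 1 Cons.prems by (simp add: strictly_above_length)
  next
    case (2 y)
    have "length (row_insert x r) = length r"
      using arg_cong[OF mset_row_insert[of x r], of size] 2 by simp
    then show ?thesis
      using Cons.IH[of "row_insert x r" "row_insert y s"] Cons.prems 2 
      by (simp add: row_insert_above_bump sorted_row_insert)
  qed
qed

text \<open>The case \<open>b0 = []\<close> is the one of interest. In the induction over the columns, \<open>b0\<close> holds the
  letters which have left the remaining columns of \<open>s\<close> but not yet those of \<open>r\<close>.\<close>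

lemma strictly_above_before:
  assumes "sorted r" "sorted s" "sorted w" "bumped w r = b0 @ bs"
    and "strictly_above (insert_row w r) (insert_row bs s)"
    and "length (insert_row bs s) \<le> length r"
    and "\<forall>x\<in>set b0. \<forall>z\<in>set s. x < z"
  shows "strictly_above r s"
  using assms
proof (induction s arbitrary: r w b0 bs)
  case (Cons z s)
  note insert_row.simps [simp del] bumped.simps [simp del]
  obtain y r' where r: "r = y # r'"
    using Cons.prems(6) length_insert_row_ge[of "z # s" bs] by (cases r) auto
  have sb: "sorted (b0 @ bs)" using sorted_bumped[of w r] Cons.prems by simp
  then have sbs: "sorted bs" by (simp add: sorted_append)
  have bs_cases: "insert_row bs (z # s) = z # insert_row bs s \<or>
     (\<exists>b bs'. bs = b # bs' \<and> b < z \<and> insert_row bs (z # s) = b # insert_row bs' s)"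
    using sbs by (cases bs) (auto simp: insert_row_sorted_Cons insert_row.simps(1))
  show ?case
  proof (cases "w = [] \<or> y \<le> hd w")
    case True
    then have "\<forall>x\<in>set w. y \<le> x" using Cons.prems(3) by (cases w) auto
    then have e: "insert_row w r = y # insert_row w r'" "bumped w r = bumped w r'"
      by (simp_all add: insert_row_Cons_le r)
    show ?thesis using bs_cases
    proof (elim disjE exE conjE)
      assume i: "insert_row bs (z # s) = z # insert_row bs s"
      have "strictly_above r' s"
        using Cons.prems e r i by (intro Cons.IH[of r' w b0 bs]) auto
      then show ?thesis using Cons.prems(5) e i r by simp
    next
      fix b bs'
      assume b: "bs = b # bs'" "b < z" "insert_row bs (z # s) = b # insert_row bs' s"
      have "strictly_above r' s"
        using Cons.prems e r b by (intro Cons.IH[of r' w "b0 @ [b]" bs']) auto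
      then show ?thesis using Cons.prems(5) e b r by auto
    qed
  next
    case False
    then obtain x w' where w: "w = x # w'" "x < y" by (cases w) auto
    then have e: "insert_row w r = x # insert_row w' r'" "bumped w r = y # bumped w' r'"
      using Cons.prems(3) r by (auto simp: insert_row_sorted_Cons)
    show ?thesis
    proof (cases b0)
      case b0: (Cons u b0')
      then have u: "u = y" "bumped w' r' = b0' @ bs" using Cons.prems(4) e by auto
      have "y < z" using Cons.prems(7) b0 u by simp
      moreover from bs_cases have "strictly_above r' s"
      proof (elim disjE exE conjE)
        assume i: "insert_row bs (z # s) = z # insert_row bs s"
        show ?thesis
          using Cons.prems e r i w u b0 by (intro Cons.IH[of r' w' b0' bs]) auto
      next
        fix b bs'
        assume b: "bs = b # bs'" "b < z" "insert_row bs (z # s) = b # insert_row bs' s"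
        show ?thesis
          using Cons.prems e r b w u b0 by (intro Cons.IH[of r' w' "b0' @ [b]" bs']) auto
      qed
      ultimately show ?thesis using r by simp
    next
      case Nil
      then have bs: "bs = y # bumped w' r'" using Cons.prems(4) e by simp
      \<comment> \<open>Otherwise all of \<open>bs\<close> is inserted to the right of
        \<open>z\<close>. Then \<open>bs\<close>, which begins with the bumped \<open>y\<close>,
        would fit strictly below the columns after the first, contrary to
        \<open>not_strictly_above_bumped\<close>.\<close>
      have "y < z"
      proof (rule ccontr)
        assume "\<not> y < z"
        then have i: "insert_row bs (z # s) = z # insert_row bs s"
          using bs sbs by (auto simp: insert_row_sorted_Cons)
        have "subseq bs (insert_row bs s)" using subseq_insert_row sbs Cons.prems(2) by auto
        moreover have "strictly_above (insert_row w' r') (insert_row bs s)"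
          using Cons.prems(5) i e by simp
        moreover have "sorted (insert_row w' r')"
          using Cons.prems(1) r by (simp add: sorted_insert_row)
        ultimately have "strictly_above (insert_row w' r') bs" using strictly_above_subseq by blast
        moreover have "length bs \<le> length r'"
          using list_emb_length[OF \<open>subseq bs (insert_row bs s)\<close>] Cons.prems(6) i r by simp
        ultimately have "strictly_above (take (length r') (insert_row w' r')) bs"
          by (rule strictly_above_take)
        then show False using not_strictly_above_bumped[of y r' w'] bs Cons.prems r w by simp
      qed
      then have i: "insert_row bs (z # s) = y # insert_row (bumped w' r') s"
        using bs sbs by (auto simp: insert_row_sorted_Cons)
      have "strictly_above r' s"
        using Cons.prems e r i w by (intro Cons.IH[of r' w' "[]" "bumped w' r'"]) auto
      then show ?thesis using r \<open>y < z\<close> by simp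
    qed
  qed
qed simp

section \<open>Horizontal strips and the Pieri bijection\<close>

fun horizontal_strip :: "nat list \<Rightarrow> nat \<Rightarrow> nat list \<Rightarrow> bool" where
  "horizontal_strip [] k [] \<longleftrightarrow> k = 0"
| "horizontal_strip [] k [l] \<longleftrightarrow> l = k \<and> 0 < k"
| "horizontal_strip [] k (l # l' # ls) \<longleftrightarrow> False"
| "horizontal_strip (m # ms) k [] \<longleftrightarrow> False"
| "horizontal_strip (m # ms) k (l # ls) \<longleftrightarrow>
     m \<le> l \<and> l \<le> m + k \<and> (ls = [] \<or> hd ls \<le> m) \<and> horizontal_strip ms (m + k - l) ls"

lemma length_first_row: "length (first_row T) = (if T = [] then 0 else hd (map length T))"
  by (cases T) auto

text \<open>The bumped word is sorted and has as many letters as boxes remain to be added; the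
  interlacing condition is \<open>length_insert_row_bumped\<close>.\<close>

lemma horizontal_strip_insert_word:
  assumes "is_tableau M" "sorted w"
  shows "horizontal_strip (map length M) (length w) (map length (insert_word w M))"
  using assms
proof (induction M arbitrary: w)
  case Nil
  then show ?case by (cases "w = []") (auto simp: insert_word_start insert_row_Nil)
next
  case (Cons r M)
  have b: "length (bumped w r) = length r + length w - length (insert_row w r)"
    "length (insert_row w r) \<le> length r + length w"
    using length_insert_row[of w r] by simp_all
  have "sorted (bumped w r)" using sorted_bumped Cons.prems by auto
  moreover have "length (first_row (insert_word (bumped w r) M)) \<le> length r"
    using length_insert_row_bumped[of r "first_row M" w] Cons.prems
    by (simp add: first_row_insert_word sorted_first_row)
  ultimately show ?case
    using Cons.IH[of "bumped w r"] Cons.prems b length_insert_row_ge[of r w]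
    by (auto simp: length_first_row hd_map split: if_splits)
qed

text \<open>Insertion is undone from the bottom up: the lower rows and their known shape determine
  the word bumped into them, and \<open>unbump\<close> then recovers the top row and
  \<open>w\<close>.\<close>

lemma insert_word_inject:
  assumes "is_tableau M" "is_tableau M'" "map length M = map length M'" "sorted w" "sorted w'"
    and "insert_word w M = insert_word w' M'"
  shows "M = M' \<and> w = w'"
  using assms
proof (induction M arbitrary: M' w w')
  case Nil
  then show ?case
    by (cases "w = []"; cases "w' = []") (auto simp: insert_word_start insert_row_Nil)
next
  case (Cons r M)
  then obtain r' M1 where M': "M' = r' # M1" by (cases M') auto
  have "M = M1 \<and> bumped w r = bumped w' r'"
    using Cons.prems M' sorted_bumped[of w r] sorted_bumped[of w' r']
    by (intro Cons.IH) auto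
  moreover have "r = r' \<and> w = w'"
  proof -
    have "length r = length r'" "insert_row w r = insert_row w' r'" "sorted r" "sorted r'"
      using Cons.prems M' by simp_all
    then have "(r, w) = (r', w')"
      using unbump_insert_row[of r w] unbump_insert_row[of r' w'] Cons.prems(4,5) calculation by metis
    then show ?thesis by simp
  qed
  ultimately show ?case using M' by simp
qed

text \<open>The converse half of the Pieri bijection, also from the bottom up: the lower rows yield
  the word \<open>b\<close> that must have been bumped, and reversing the top row against
  \<open>b\<close> yields \<open>r\<close> and \<open>w\<close>.\<close>

lemma insert_word_exists:
  assumes "horizontal_strip m k (map length T)" "is_tableau T" "0 \<notin> set m"
  shows "\<exists>M w. is_tableau M \<and> map length M = m \<and> sorted w \<and> length w = k \<and> insert_word w M = T"
  using assms
proof (induction m k "map length T" arbitrary: T rule: horizontal_strip.induct)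
  case (1 k)
  then show ?case by (auto intro!: exI[of _ "[]"])
next
  case (2 k l)
  then obtain r where "T = [r]" by (cases T) auto
  then show ?case using 2
    by (intro exI[of _ "[]"] exI[of _ r]) (auto simp: insert_word_start insert_row_Nil)
next
  case (3 k l l' ls)
  then show ?case by (metis horizontal_strip.simps(3))
next
  case (4 m ms k)
  then show ?case by (metis horizontal_strip.simps(4))
next
  case (5 m ms k l ls)
  then obtain t ts where T: "T = t # ts" "l = length t" "ls = map length ts" by (cases T) auto
  have hs: "m \<le> length t" "length t \<le> m + k" "length (first_row ts) \<le> m"
    "horizontal_strip ms (m + k - l) (map length ts)"
    using 5 T by (auto simp: length_first_row)
  obtain M b where M: "is_tableau M" "map length M = ms" "sorted b" "length b = m + k - l"
    "insert_word b M = ts"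
    using 5(1)[OF T(3)] 5(3-5) T hs by (auto simp: T(3))
  have ts: "first_row ts = insert_row b (first_row M)"
    using M by (auto simp: first_row_insert_word)
  have sub: "subseq b (first_row ts)"
    using ts M by (simp add: subseq_insert_row sorted_first_row)
  have t: "sorted t" "strictly_above t (first_row ts)" using 5 T by auto
  \<comment> \<open>The letters of \<open>b\<close> survive in the row below \<open>t\<close>, so
    \<open>b\<close> fits below \<open>t\<close>; the interlacing condition bounds its length by
    \<open>m\<close>, so it already fits below the first \<open>m\<close> entries.\<close>
  have "strictly_above t b" using strictly_above_subseq[OF t(2) sub t(1)] .
  then have "strictly_above (take m t) b"
    using list_emb_length[OF sub] hs(3) by (intro strictly_above_take) auto
  then obtain r w where rw: "insert_row w r = t" "bumped w r = b" "length r = m" "sorted r" "sorted w"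
    using insert_row_unbump[OF t(1) M(3) hs(1)] by (metis surj_pair)
  have "strictly_above r (first_row M)"
    using strictly_above_before[of r "first_row M" w "[]" b] rw M t ts hs
    by (simp add: sorted_first_row)
  then have "is_tableau (r # M)" using rw M 5 by auto
  moreover have "length w = k"
    using length_insert_row[of w r] rw M hs T by simp
  ultimately show ?case using rw M T
    by (intro exI[of _ "r # M"] exI[of _ w]) auto
qed

text \<open>A new last row has fewer than \<open>k\<close> boxes unless it takes them all, and then
  no other row changes. Hence \<open>m @ [k]\<close> is the only shape obtained that is maximal for
  the length followed by the last part.\<close>

lemma horizontal_strip_last:
  assumes "horizontal_strip m k l"
  shows "length l \<le> length m \<or>
    (\<exists>l' x. l = l' @ [x] \<and> length l' = length m \<and> (x < k \<or> l = m @ [k]))"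
  using assms
proof (induction m k l rule: horizontal_strip.induct)
  case (5 m ms k l ls)
  then have IH: "length ls \<le> length ms \<or> (\<exists>l' x. ls = l' @ [x] \<and> length l' = length ms \<and>
      (x < m + k - l \<or> ls = ms @ [m + k - l]))" and "m \<le> l" by auto
  show ?case
  proof (cases "length ls \<le> length ms")
    case False
    then obtain l' x where x: "ls = l' @ [x]" "length l' = length ms"
        "x < m + k - l \<or> ls = ms @ [m + k - l]" using IH by auto
    then have "x < k \<or> l # ls = (m # ms) @ [k]"
      using \<open>m \<le> l\<close> 5 by (cases "l = m") auto
    then show ?thesis using x by (intro disjI2 exI[of _ "l # l'"] exI[of _ x]) auto
  qed simp
qed auto

lemma horizontal_strip_bound:
  "horizontal_strip m k l \<Longrightarrow> length l \<le> Suc (length m) \<and> (\<forall>x\<in>set l. x \<le> sum_list m + k)"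
proof (induction m k l rule: horizontal_strip.induct)
  case (5 m ms k l ls)
  then show ?case by fastforce
qed auto

lemma finite_horizontal_strip: "finite {l. horizontal_strip m k l}"
proof (rule finite_subset)
  show "{l. horizontal_strip m k l} \<subseteq>
      {l. set l \<subseteq> {..sum_list m + k} \<and> length l \<le> Suc (length m)}"
    using horizontal_strip_bound by blast
qed (simp add: finite_lists_length_le)

lemma horizontal_strip_snoc:
  "sorted_wrt (\<ge>) (m @ [k]) \<Longrightarrow> 0 < k \<Longrightarrow> horizontal_strip m k (m @ [k])"
proof (induction m)
  case (Cons a m)
  then show ?case by (cases m) auto
qed simp

section \<open>Factorizations of a tableau\<close>

lemma is_partition_shape: "is_tableau T \<Longrightarrow> is_partition (map length T)"
proof (induction T)
  case (Cons r T)
  then have "length s \<le> length r" if "s \<in> set T" for s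
    using is_tableau_length[of T s] strictly_above_length[of r "first_row T"] that by auto
  then show ?case using Cons by (auto simp: is_partition_def)
qed (simp add: is_partition_def)

text \<open>The ways to write \<open>T\<close> in the plactic monoid as a product of tableaux of the
  given shapes.\<close>

definition factorizations ::
    "nat list \<Rightarrow> nat list \<Rightarrow> 'a::linorder list list \<Rightarrow> ('a list list \<times> 'a list list) set" where
  "factorizations \<mu> \<nu> T = {(M, N). is_tableau M \<and> map length M = \<mu> \<and>
     is_tableau N \<and> map length N = \<nu> \<and> insert_word (tableau_word N) M = T}"

lemma mset_insert_word:
  "is_tableau M \<Longrightarrow> mset (tableau_word (insert_word w M)) = mset (tableau_word M) + mset w"
  using knuth_equiv_mset[OF knuth_equiv_insert_word[of M w]] is_tableau_sorted[of M] by auto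

lemma finite_tableaux_mset: "finite {M. is_tableau M \<and> mset (tableau_word M) \<subseteq># X}"
proof -
  have "finite {w. mset w \<subseteq># X}"
  proof (rule finite_subset)
    show "{w. mset w \<subseteq># X} \<subseteq> {w. set w \<subseteq> set_mset X \<and> length w \<le> size X}"
      using set_mset_mono size_mset_mono by fastforce
  qed (simp add: finite_lists_length_le)
  moreover have "tableau_word ` {M. is_tableau M \<and> mset (tableau_word M) \<subseteq># X} \<subseteq> {w. mset w \<subseteq># X}"
    by auto
  moreover have "inj_on tableau_word {M. is_tableau M \<and> mset (tableau_word M) \<subseteq># X}"
    by (rule inj_on_inverseI[of _ "\<lambda>w. insert_word w []"]) (auto simp: insert_word_tableau_word)
  ultimately show ?thesis using finite_imageD finite_subset by blast
qed

lemma finite_factorizations: "finite (factorizations \<mu> \<nu> T)"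
proof (rule finite_subset)
  let ?A = "{M. is_tableau M \<and> mset (tableau_word M) \<subseteq># mset (tableau_word T)}"
  show "factorizations \<mu> \<nu> T \<subseteq> ?A \<times> ?A"
    by (auto simp: factorizations_def mset_insert_word)
qed (simp add: finite_tableaux_mset)

text \<open>Associativity in the plactic monoid: both sides insert into \<open>M\<close> a word
  equivalent to \<open>tableau_word N @ w\<close>.\<close>

lemma insert_word_assoc:
  assumes "is_tableau M" "is_tableau N"
  shows "insert_word (tableau_word (insert_word w N)) M
       = insert_word w (insert_word (tableau_word N) M)"
proof -
  have "knuth_equiv (tableau_word (insert_word w N)) (tableau_word N @ w)"
    using knuth_equiv_insert_word[of N w] is_tableau_sorted[OF assms(2)] knuth_equiv_sym by blast
  then show ?thesis
    using insert_word_knuth_equiv[of _ "tableau_word N @ w" M] is_tableau_sorted[OF assms(1)]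
    by (simp add: insert_word_append)
qed

text \<open>Induction on the length and then the last part of \<open>\<nu>\<close>. With \<open>\<nu> = \<nu>' @ [k]\<close>, the products of
  tableaux of shapes \<open>\<mu>\<close> and \<open>\<nu>'\<close> and a row of length \<open>k\<close> are counted in two ways by associativity: adding
  a horizontal strip to \<open>\<nu>'\<close> yields \<open>\<nu>\<close> and smaller shapes only.\<close>

lemma card_factorizations_shape:
  fixes T T' :: "'a::linorder list list"
  assumes "is_partition \<nu>" "is_tableau T" "is_tableau T'" "map length T = map length T'"
  shows "card (factorizations \<mu> \<nu> T) = card (factorizations \<mu> \<nu> T')"
  using assms
proof (induction "\<nu>" arbitrary: T T' rule: wf_induct_rule[OF
      wf_measures[of "[length, last :: nat list \<Rightarrow> nat]"]])
  case (1 \<nu>)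
  show ?case
  proof (cases \<nu> rule: rev_cases)
    case Nil
    have "factorizations \<mu> \<nu> T = (if map length T = \<mu> then {(T, [])} else {})"
      if "is_tableau T" for T :: "'a list list"
    proof (intro equalityI subsetI)
      fix p :: "'a list list \<times> 'a list list"
      assume "p \<in> factorizations \<mu> \<nu> T"
      then obtain M N where "p = (M, N)" "map length M = \<mu>" "map length N = []"
        "insert_word (tableau_word N) M = T"
        unfolding factorizations_def Nil by blast
      then show "p \<in> (if map length T = \<mu> then {(T, [])} else {})" by simp
    next
      fix p :: "'a list list \<times> 'a list list"
      assume "p \<in> (if map length T = \<mu> then {(T, [])} else {})"
      then have "p = (T, [])" "map length T = \<mu>" by (simp_all split: if_splits)
      then show "p \<in> factorizations \<mu> \<nu> T"
        unfolding factorizations_def Nil using that by simp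
    qed
    then show ?thesis using 1 by simp
  next
    case (snoc \<nu>' k)
    have \<nu>': "is_partition \<nu>'" "0 < k" "horizontal_strip \<nu>' k \<nu>"
      using 1(2) snoc horizontal_strip_snoc[of \<nu>' k]
      by (auto simp: is_partition_def sorted_wrt_append)
    define H where "H = {\<kappa>. is_partition \<kappa> \<and> horizontal_strip \<nu>' k \<kappa>}"
    have H: "finite H" "\<nu> \<in> H"
      using finite_subset[OF _ finite_horizontal_strip[of \<nu>' k], of H] \<nu>' 1(2) by (auto simp: H_def)
    define A where "A T = {((M, N), w). is_tableau M \<and> map length M = \<mu> \<and>
      is_tableau N \<and> map length N = \<nu>' \<and> sorted w \<and> length w = k \<and>
      insert_word w (insert_word (tableau_word N) M) = T}" for T :: "'a list list"
    have A1: "card (A T) = (\<Sum>\<kappa>\<in>H. card (factorizations \<mu> \<kappa> T))" for T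
    proof -
      have "bij_betw (\<lambda>((M, N), w). (M, insert_word w N)) (A T) (\<Union>\<kappa>\<in>H. factorizations \<mu> \<kappa> T)"
        unfolding bij_betw_def
      proof (intro conjI equalityI subsetI)
        show "inj_on (\<lambda>((M, N), w). (M, insert_word w N)) (A T)"
          by (auto simp: inj_on_def A_def dest: insert_word_inject)
        fix p assume "p \<in> (\<lambda>((M, N), w). (M, insert_word w N)) ` A T"
        then show "p \<in> (\<Union>\<kappa>\<in>H. factorizations \<mu> \<kappa> T)"
          by (auto simp: A_def factorizations_def H_def is_tableau_insert_word is_partition_shape
            insert_word_assoc horizontal_strip_insert_word)
      next
        fix p assume "p \<in> (\<Union>\<kappa>\<in>H. factorizations \<mu> \<kappa> T)"
        then obtain M Y where p: "p = (M, Y)" "is_tableau M" "map length M = \<mu>" "is_tableau Y"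
          "insert_word (tableau_word Y) M = T" "horizontal_strip \<nu>' k (map length Y)"
          by (auto simp: factorizations_def H_def)
        moreover obtain N w where "is_tableau N" "map length N = \<nu>'" "sorted w" "length w = k"
            "insert_word w N = Y"
          using insert_word_exists[OF p(6,4)] \<nu>'(1) by (auto simp: is_partition_def)
        ultimately show "p \<in> (\<lambda>((M, N), w). (M, insert_word w N)) ` A T"
          by (intro image_eqI[of _ _ "((M, N), w)"]) (auto simp: A_def insert_word_assoc)
      qed
      then have "card (A T) = card (\<Union>\<kappa>\<in>H. factorizations \<mu> \<kappa> T)" by (rule bij_betw_same_card)
      also have "\<dots> = (\<Sum>\<kappa>\<in>H. card (factorizations \<mu> \<kappa> T))"
        using H by (intro card_UN_disjoint) (auto simp: finite_factorizations, auto simp: factorizations_def)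
      finally show ?thesis .
    qed
    \<comment> \<open>By the induction hypothesis for the shorter \<nu>' the count depends on the
      shape alone, so any tableau of shape \<open>\<kappa>\<close> may represent it.\<close>
    define f where "f \<kappa> = card (factorizations \<mu> \<nu>'
        (SOME X :: 'a list list. is_tableau X \<and> map length X = \<kappa>))" for \<kappa>
    have f: "card (factorizations \<mu> \<nu>' X) = f (map length X)" if "is_tableau X" for X :: "'a list list"
    proof -
      let ?X = "SOME X' :: 'a list list. is_tableau X' \<and> map length X' = map length X"
      have X: "is_tableau ?X \<and> map length ?X = map length X"
        by (rule someI[of _ X]) (use that in simp)
      have "(\<nu>', \<nu>) \<in> measures [length, last]" using snoc by simp
      then show ?thesis unfolding f_def by (rule 1(1)) (use X \<nu>' that in simp_all)
    qed
    define B where "B T = {(X, w). is_tableau X \<and> sorted w \<and> length w = k \<and> insert_word w X = T}"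
      for T :: "'a list list"
    have A2: "card (A T) = (\<Sum>\<kappa> | is_partition \<kappa> \<and> horizontal_strip \<kappa> k (map length T). f \<kappa>)"
      if T: "is_tableau T" for T
    proof -
      \<comment> \<open>By the Pieri bijection, splitting off a row of length \<open>k\<close> from
        \<open>T\<close> is possible in exactly one way for each admissible shape of the rest. The
        index set, and with it the whole sum, depends only on the shape of \<open>T\<close>.\<close>
      have bB: "bij_betw (\<lambda>(X, w). map length X) (B T)
          {\<kappa>. is_partition \<kappa> \<and> horizontal_strip \<kappa> k (map length T)}"
        unfolding bij_betw_def
      proof (intro conjI equalityI subsetI)
        show "inj_on (\<lambda>(X, w). map length X) (B T)"
          by (auto simp: inj_on_def B_def dest: insert_word_inject)
        fix \<kappa> assume "\<kappa> \<in> (\<lambda>(X, w). map length X) ` B T"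
        then show "\<kappa> \<in> {\<kappa>. is_partition \<kappa> \<and> horizontal_strip \<kappa> k (map length T)}"
          by (auto simp: B_def is_partition_shape horizontal_strip_insert_word)
      next
        fix \<kappa> assume "\<kappa> \<in> {\<kappa>. is_partition \<kappa> \<and> horizontal_strip \<kappa> k (map length T)}"
        then obtain X w where "is_tableau X" "map length X = \<kappa>" "sorted w" "length w = k"
            "insert_word w X = T"
          using insert_word_exists[of \<kappa> k T] T by (auto simp: is_partition_def)
        then show "\<kappa> \<in> (\<lambda>(X, w). map length X) ` B T"
          by (intro image_eqI[of _ _ "(X, w)"]) (auto simp: B_def)
      qed
      have "finite (B T)"
      proof (rule finite_subset)
        let ?W = "{w. set w \<subseteq> set (tableau_word T) \<and> length w = k}"
        have "set w \<subseteq> set (tableau_word T)" if "(X, w) \<in> B T" for X w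
          using that mset_insert_word[of X w] unfolding B_def
          by (metis (mono_tags, lifting) case_prodD mem_Collect_eq mset_subset_eq_add_right
              set_mset_mono set_mset_mset)
        then show "B T \<subseteq> {M. is_tableau M \<and> mset (tableau_word M) \<subseteq># mset (tableau_word T)} \<times> ?W"
          by (auto simp: B_def mset_insert_word)
      qed (simp add: finite_tableaux_mset finite_lists_length_eq)
      have "bij_betw (\<lambda>((M, N), w). ((insert_word (tableau_word N) M, w), (M, N))) (A T)
          (SIGMA p : B T. factorizations \<mu> \<nu>' (fst p))"
        by (rule bij_betw_byWitness[where f' = "\<lambda>((X, w), (M, N)). ((M, N), w)"])
          (auto simp: A_def B_def factorizations_def is_tableau_insert_word)
      then have "card (A T) = (\<Sum>p\<in>B T. card (factorizations \<mu> \<nu>' (fst p)))"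
        using \<open>finite (B T)\<close> by (simp add: bij_betw_same_card card_SigmaI finite_factorizations)
      also have "\<dots> = (\<Sum>p\<in>B T. f ((\<lambda>(X, w). map length X) p))"
        by (rule sum.cong) (auto simp: B_def f)
      also have "\<dots> = (\<Sum>\<kappa> | is_partition \<kappa> \<and> horizontal_strip \<kappa> k (map length T). f \<kappa>)"
        by (rule sum.reindex_bij_betw[OF bB])
      finally show ?thesis .
    qed
    have "card (factorizations \<mu> \<kappa> T) = card (factorizations \<mu> \<kappa> T')" if "\<kappa> \<in> H - {\<nu>}" for \<kappa>
    proof -
      have "length \<kappa> \<le> length \<nu>' \<or>
        (\<exists>l' x. \<kappa> = l' @ [x] \<and> length l' = length \<nu>' \<and> x < k)"
        using horizontal_strip_last[of \<nu>' k \<kappa>] that snoc by (auto simp: H_def)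
      then have "(\<kappa>, \<nu>) \<in> measures [length, last]"
        using snoc by auto
      then show ?thesis by (rule 1(1)) (use 1(3-5) that in \<open>simp_all add: H_def\<close>)
    qed
    then have "(\<Sum>\<kappa>\<in>H - {\<nu>}. card (factorizations \<mu> \<kappa> T)) =
        (\<Sum>\<kappa>\<in>H - {\<nu>}. card (factorizations \<mu> \<kappa> T'))" by simp
    moreover have "card (A T) = card (A T')" using A2[of T] A2[of T'] 1 by simp
    ultimately show ?thesis
      using A1[of T] A1[of T'] H by (simp add: sum.remove)
  qed
qed

section \<open>Rectification and labels\<close>

lemma boxes_alt: "boxes \<delta> = {(i, j). 1 \<le> i \<and> part (snd \<delta>) i < j \<and> j \<le> part (fst \<delta>) i}"
  by (auto simp: boxes_def diagram_def)

lemma boxes_normal [simp]: "boxes (la, []) = diagram la"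
  by (auto simp: boxes_def diagram_def part_def)

lemma part_Nil [simp]: "part [] i = 0"
  by (simp add: part_def)

lemma part_pos_iff: "part la i > 0 \<Longrightarrow> 1 \<le> i \<and> i \<le> length la"
  by (auto simp: part_def split: if_splits)

lemma part_Suc [simp]: "i < length la \<Longrightarrow> part la (Suc i) = la ! i"
  by (simp add: part_def)

lemma diagram_iff: "(i, j) \<in> diagram la \<longleftrightarrow> 1 \<le> i \<and> i \<le> length la \<and> 1 \<le> j \<and> j \<le> la ! (i - 1)"
  by (auto simp: diagram_def part_def split: if_splits)

definition reading_less :: "box \<Rightarrow> box \<Rightarrow> bool" where
  "reading_less = (\<lambda>(i, j) (i', j'). i' < i \<or> i = i' \<and> j < j')"

lemma sorted_wrt_concat_rows:
  assumes "sorted_wrt (>) is" "\<And>i. i \<in> set is \<Longrightarrow> sorted_wrt (<) (g i)"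
  shows "sorted_wrt reading_less (concat (map (\<lambda>i. map (\<lambda>j. (i, j)) (g i)) is))"
  using assms
proof (induction "is")
  case (Cons i "is")
  have "sorted_wrt reading_less (map (\<lambda>j. (i, j)) (g i))"
    using Cons.prems(2)[of i] by (simp add: sorted_wrt_map reading_less_def)
  then show ?case using Cons by (auto simp: sorted_wrt_append reading_less_def)
qed simp

lemma sorted_reading: "sorted_wrt reading_less (reading \<delta>)"
  unfolding reading_def
  by (rule sorted_wrt_concat_rows) (simp_all add: sorted_wrt_rev del: upt_Suc)

lemma set_reading [simp]: "set (reading \<delta>) = boxes \<delta>"
proof -
  have "part (fst \<delta>) i < j \<Longrightarrow> j \<le> part (fst \<delta>) i \<Longrightarrow> False" for i j by simp
  moreover have "i \<le> length (fst \<delta>)" if "j \<le> part (fst \<delta>) i" "part (snd \<delta>) i < j" for i j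
    using part_pos_iff[of "fst \<delta>" i] that by simp
  ultimately show ?thesis
    unfolding reading_def boxes_alt by (fastforce simp: less_Suc_eq_le)
qed

lemma distinct_reading: "distinct (reading \<delta>)"
  unfolding distinct_conv_nth
proof (intro allI impI)
  fix p q assume pq: "p < length (reading \<delta>)" "q < length (reading \<delta>)" "p \<noteq> q"
  have "\<not> reading_less b b" for b by (auto simp: reading_less_def)
  then show "reading \<delta> ! p \<noteq> reading \<delta> ! q"
    using pq sorted_wrt_nth_less[OF sorted_reading] by (metis linorder_neqE_nat)
qed

lemma finite_boxes [simp]: "finite (boxes \<delta>)"
  by (metis List.finite_set set_reading)

lemma finite_diagram [simp]: "finite (diagram la)"
  using finite_boxes[of "(la, [])"] by simp

lemma mset_reading: "mset (reading \<delta>) = mset_set (boxes \<delta>)"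
  by (metis distinct_reading mset_set_set set_reading)

lemma reading_nth_less:
  assumes "b \<in> boxes \<delta>" "c \<in> boxes \<delta>" "reading_less b c"
  obtains p q where "p < q" "q < length (reading \<delta>)" "reading \<delta> ! p = b" "reading \<delta> ! q = c"
proof -
  obtain p q where pq: "p < length (reading \<delta>)" "reading \<delta> ! p = b"
    "q < length (reading \<delta>)" "reading \<delta> ! q = c"
    using assms(1,2) by (metis in_set_conv_nth set_reading)
  have "\<not> reading_less c b" "b \<noteq> c" using assms(3) by (auto simp: reading_less_def)
  then have "p < q" using pq sorted_wrt_nth_less[OF sorted_reading] by (metis linorder_neqE_nat)
  then show ?thesis using that pq by blast
qed

section \<open>Fillings as lists of rows\<close>

definition tableau_rows :: "nat list \<Rightarrow> (box \<Rightarrow> 'a) \<Rightarrow> 'a list list" where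
  "tableau_rows la P = map (\<lambda>i. map (\<lambda>j. P (i, j)) [1 ..< part la i + 1]) [1 ..< length la + 1]"

definition rows_filling :: "'a list list \<Rightarrow> box \<Rightarrow> 'a" where
  "rows_filling T = (\<lambda>(i, j)\<in>diagram (map length T). T ! (i - 1) ! (j - 1))"

lemma length_tableau_rows [simp]: "length (tableau_rows la P) = length la"
  by (simp add: tableau_rows_def del: upt_Suc)

lemma nth_tableau_rows: "i < length la \<Longrightarrow> tableau_rows la P ! i = map (\<lambda>j. P (Suc i, j)) [1 ..< la ! i + 1]"
  by (simp add: tableau_rows_def del: upt_Suc)

lemma nth_nth_tableau_rows:
  "i < length la \<Longrightarrow> j < la ! i \<Longrightarrow> tableau_rows la P ! i ! j = P (Suc i, Suc j)"
  by (simp add: nth_tableau_rows del: upt_Suc)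

lemma shape_tableau_rows [simp]: "map length (tableau_rows la P) = la"
  by (rule nth_equalityI) (simp_all add: nth_tableau_rows del: upt_Suc)

lemma row_word_normal: "row_word (la, []) P = tableau_word (tableau_rows la P)"
  by (simp add: row_word_def reading_def tableau_word_def tableau_rows_def rev_map map_concat
      comp_def del: upt_Suc)

lemma strictly_above_iff:
  "strictly_above r s \<longleftrightarrow> length s \<le> length r \<and> (\<forall>j<length s. r ! j < s ! j)"
  by (induction r s rule: strictly_above.induct) (auto simp: All_less_Suc2)

lemma is_tableau_iff:
  "is_tableau T \<longleftrightarrow> (\<forall>r\<in>set T. sorted r \<and> r \<noteq> []) \<and>
     (\<forall>i. Suc i < length T \<longrightarrow> strictly_above (T ! i) (T ! Suc i))"
proof (induction T)
  case (Cons r T)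
  show ?case
  proof (cases T)
    case (Cons s T')
    have "(\<forall>i. Suc i < length (r # T) \<longrightarrow> strictly_above ((r # T) ! i) ((r # T) ! Suc i)) \<longleftrightarrow>
      strictly_above r s \<and> (\<forall>i. Suc i < length T \<longrightarrow> strictly_above (T ! i) (T ! Suc i))"
      using Cons by (auto simp: nth_Cons split: nat.splits)
    then show ?thesis using Cons.IH Cons by auto
  qed simp
qed simp

lemma is_partition_nth:
  assumes "is_partition la" "i < length la"
  shows "0 < la ! i" "i' \<le> i \<Longrightarrow> la ! i \<le> la ! i'"
proof -
  show "0 < la ! i" using assms nth_mem[OF assms(2)] by (metis bot_nat_0.not_eq_extremum is_partition_def)
  show "i' \<le> i \<Longrightarrow> la ! i \<le> la ! i'"
    using assms sorted_wrt_nth_less[of "(\<ge>)" la i' i] by (cases "i' = i") (auto simp: is_partition_def)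
qed

lemma is_tableau_tableau_rows:
  assumes "is_partition la" "semistandard (la, []) P"
  shows "is_tableau (tableau_rows la P)"
  unfolding is_tableau_iff
proof (intro conjI allI impI ballI)
  fix r assume "r \<in> set (tableau_rows la P)"
  then obtain i where i: "i < length la" "r = tableau_rows la P ! i"
    by (metis in_set_conv_nth length_tableau_rows)
  have "sorted r" unfolding sorted_iff_nth_mono_less
  proof (intro allI impI)
    fix j j' assume "j < j'" "j' < length r"
    then show "r ! j \<le> r ! j'"
      using i assms(2) by (simp add: nth_tableau_rows semistandard_def diagram_iff del: upt_Suc)
  qed
  moreover have "r \<noteq> []"
    using i is_partition_nth[OF assms(1) i(1)] by (simp add: nth_tableau_rows)
  ultimately show "sorted r" "r \<noteq> []" by auto
next
  fix i assume i: "Suc i < length (tableau_rows la P)"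
  then have le: "la ! Suc i \<le> la ! i" using is_partition_nth(2)[OF assms(1), of "Suc i" i] by simp
  then show "strictly_above (tableau_rows la P ! i) (tableau_rows la P ! Suc i)"
    using i assms(2) unfolding strictly_above_iff
    by (auto simp: nth_tableau_rows semistandard_def diagram_iff simp del: upt_Suc)
qed

lemma is_tableau_columns:
  assumes "is_tableau T" "i < i'" "i' < length T" "j < length (T ! i')"
  shows "j < length (T ! i) \<and> T ! i ! j < T ! i' ! j"
  using assms(2-4)
proof (induction i' rule: less_Suc_induct)
  case (1 i)
  then show ?case using assms(1) unfolding is_tableau_iff strictly_above_iff
    by (meson order_less_le_trans)
next
  case (2 i j' k)
  then show ?case by (meson order.strict_trans)
qed

lemma semistandard_rows_filling:
  assumes "is_tableau T"
  shows "semistandard (map length T, []) (rows_filling T)"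
proof -
  have "rows_filling T (i, j) \<le> rows_filling T (i, j')"
    if "(i, j) \<in> diagram (map length T)" "(i, j') \<in> diagram (map length T)" "j < j'" for i j j'
  proof -
    have "i - 1 < length T" using that by (auto simp: diagram_iff)
    then have "sorted (T ! (i - 1))" "i - 1 < length T" using is_tableau_sorted[OF assms] by simp_all
    then show ?thesis
      using that by (auto simp: rows_filling_def diagram_iff intro!: sorted_nth_mono)
  qed
  moreover have "rows_filling T (i, j) < rows_filling T (i', j)"
    if "(i, j) \<in> diagram (map length T)" "(i', j) \<in> diagram (map length T)" "i < i'" for i i' j
    using is_tableau_columns[OF assms, of "i - 1" "i' - 1" "j - 1"] that
    by (auto simp: rows_filling_def diagram_iff)
  ultimately show ?thesis by (simp add: semistandard_def)
qed

lemma rows_filling_in_SSYT: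
  "is_tableau T \<Longrightarrow> rows_filling T \<in> SSYT_over UNIV (map length T, [])"
  using semistandard_rows_filling[of T]
  by (auto simp: SSYT_over_def fillings_def rows_filling_def)

lemma tableau_rows_rows_filling: "tableau_rows (map length T) (rows_filling T) = T"
proof (rule nth_equalityI)
  fix i assume "i < length (tableau_rows (map length T) (rows_filling T))"
  then have i: "i < length T" by simp
  show "tableau_rows (map length T) (rows_filling T) ! i = T ! i"
  proof (rule nth_equalityI)
    show "length (tableau_rows (map length T) (rows_filling T) ! i) = length (T ! i)"
      using i by (simp add: nth_tableau_rows del: upt_Suc)
    fix j assume "j < length (tableau_rows (map length T) (rows_filling T) ! i)"
    then show "tableau_rows (map length T) (rows_filling T) ! i ! j = T ! i ! j"
      using i by (simp add: nth_tableau_rows rows_filling_def diagram_iff del: upt_Suc)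
  qed
qed simp

lemma rows_filling_tableau_rows:
  assumes "P \<in> extensional (diagram la)"
  shows "rows_filling (tableau_rows la P) = P"
proof
  fix b :: box
  obtain i j where b: "b = (i, j)" by fastforce
  show "rows_filling (tableau_rows la P) b = P b"
  proof (cases "b \<in> diagram la")
    case True
    then show ?thesis using nth_nth_tableau_rows[of "i - 1" la "j - 1" P]
      by (auto simp: rows_filling_def b diagram_iff)
  next
    case False
    then show ?thesis
      using assms by (cases b) (auto simp: rows_filling_def extensional_def)
  qed
qed

lemma row_word_rows_filling: "row_word (map length T, []) (rows_filling T) = tableau_word T"
  by (simp add: row_word_normal tableau_rows_rows_filling)

text \<open>This discharges the definite description: existence comes from insertion, uniqueness
  from \<open>P_tableau_unique\<close>, and extensionality lets the rows determine the
  filling.\<close>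

lemma rect_eq:
  "rect \<delta> L = (map length (P_tableau (row_word \<delta> L)), rows_filling (P_tableau (row_word \<delta> L)))"
  unfolding rect_def
proof (rule the_equality)
  let ?T = "P_tableau (row_word \<delta> L)"
  show "case (map length ?T, rows_filling ?T) of (la, P) \<Rightarrow> is_partition la \<and>
      P \<in> SSYT_over UNIV (la, []) \<and> knuth_equiv (row_word (la, []) P) (row_word \<delta> L)"
    using is_partition_shape rows_filling_in_SSYT knuth_equiv_P is_tableau_P
    by (auto simp: row_word_rows_filling)
  fix x assume "case x of (la, P) \<Rightarrow> is_partition la \<and>
      P \<in> SSYT_over UNIV (la, []) \<and> knuth_equiv (row_word (la, []) P) (row_word \<delta> L)"
  then obtain la P where x: "x = (la, P)" "is_partition la" "P \<in> extensional (diagram la)"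
      "semistandard (la, []) P" "knuth_equiv (tableau_word (tableau_rows la P)) (row_word \<delta> L)"
    by (auto simp: SSYT_over_def fillings_def row_word_normal PiE_def)
  have "tableau_rows la P = ?T"
    using P_tableau_unique[OF is_tableau_tableau_rows[OF x(2,4)] x(5)] .
  then show "x = (map length ?T, rows_filling ?T)"
    using x rows_filling_tableau_rows[OF x(3)] shape_tableau_rows[of la P] by simp
qed

lemma rect_shape_eq: "rect_shape \<delta> L = map length (P_tableau (row_word \<delta> L))"
  and rect_tableau_eq: "rect_tableau \<delta> L = rows_filling (P_tableau (row_word \<delta> L))"
  by (simp_all add: rect_shape_def rect_tableau_def rect_eq)

text \<open>On words satisfying this condition the Knuth relations involve the same comparisons before and
  after applying a monotone \<open>f\<close>.\<close>

definition standard_over :: "('a::linorder \<Rightarrow> 'b) \<Rightarrow> 'a list \<Rightarrow> bool" where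
  "standard_over f w \<longleftrightarrow> sorted_wrt (\<lambda>x y. f x = f y \<longrightarrow> x < y) w"

text \<open>Only \<open>a\<close> and \<open>c\<close> change their order. If
  \<open>f a = f c\<close>, monotonicity makes \<open>f b\<close> equal too; then \<open>b\<close>
  before the smaller \<open>a\<close>, or \<open>c\<close> before the smaller \<open>b\<close>,
  violates the condition on both sides of the relation.\<close>

lemma standard_over_knuth_step:
  fixes f :: "'a::linorder \<Rightarrow> 'b::linorder"
  assumes "mono f" "knuth_step u v"
  shows "standard_over f u = standard_over f v \<and>
    (standard_over f u \<longrightarrow> knuth_step (map f u) (map f v))"
  using assms(2)
proof cases
  case (1 a b c p q)
  have m: "f a \<le> f b" "f b \<le> f c" using 1 assms(1) by (auto simp: mono_def)
  have "standard_over f u = standard_over f v"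
    using 1 m by (fastforce simp: standard_over_def sorted_wrt_append)
  moreover have "knuth_step (map f u) (map f v)" if "standard_over f u"
  proof -
    have "f a \<noteq> f b" using that 1 by (auto simp: standard_over_def sorted_wrt_append)
    then show ?thesis using m knuth_step.intros(1)[of "f a" "f b" "f c" "map f p" "map f q"] 1
      by simp
  qed
  ultimately show ?thesis by blast
next
  case (2 a b c p q)
  have m: "f a \<le> f b" "f b \<le> f c" using 2 assms(1) by (auto simp: mono_def)
  have "standard_over f u = standard_over f v"
    using 2 m by (fastforce simp: standard_over_def sorted_wrt_append)
  moreover have "knuth_step (map f u) (map f v)" if "standard_over f u"
  proof -
    have "f b \<noteq> f c" using that 2 by (auto simp: standard_over_def sorted_wrt_append)
    then show ?thesis using m knuth_step.intros(2)[of "f a" "f b" "f c" "map f p" "map f q"] 2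
      by simp
  qed
  ultimately show ?thesis by blast
qed

lemma standard_over_knuth_equiv:
  fixes f :: "'a::linorder \<Rightarrow> 'b::linorder"
  assumes "knuth_equiv u v" "mono f" "standard_over f u"
  shows "standard_over f v \<and> knuth_equiv (map f u) (map f v)"
  using assms(1)
proof (induction rule: knuth_equiv_induct)
  case (step v w)
  then show ?case
    using standard_over_knuth_step[OF assms(2) step(2)] knuth_equiv_step knuth_equiv_trans by metis
next
  case (sym_step v w)
  then show ?case
    using standard_over_knuth_step[OF assms(2) sym_step(2)] knuth_equiv_step knuth_equiv_sym
      knuth_equiv_trans by metis
qed (use assms in simp)

lemma strictly_above_map:
  assumes "strictly_above r s" "mono f" "\<And>x y. x \<in> set r \<Longrightarrow> y \<in> set s \<Longrightarrow> f y = f x \<Longrightarrow> y < x"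
  shows "strictly_above (map f r) (map f (s :: 'a::linorder list) :: 'b::linorder list)"
  unfolding strictly_above_iff
proof (intro conjI allI impI)
  show "length (map f s) \<le> length (map f r)" using assms(1) by (simp add: strictly_above_iff)
  fix j assume j: "j < length (map f s)"
  then have "r ! j < s ! j" "j < length r" using assms(1) by (auto simp: strictly_above_iff)
  moreover from this have "f (r ! j) \<le> f (s ! j)" using assms(2) by (simp add: mono_def)
  ultimately show "map f r ! j < map f s ! j"
    using assms(3)[of "r ! j" "s ! j"] j by fastforce
qed

text \<open>Lower rows are read first, so equal images in two rows force the lower entry to be the
  smaller one. Within a column it is the larger one, so images there differ and columns stay
  strict.\<close>

lemma is_tableau_map:
  assumes "is_tableau T" "mono f" "standard_over f (tableau_word T)"
  shows "is_tableau (map (map (f :: 'a::linorder \<Rightarrow> 'b::linorder)) T)"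
  using assms(1,3)
proof (induction T)
  case (Cons r T)
  have "strictly_above (map f r) (map f (first_row T))"
  proof (rule strictly_above_map)
    fix x y assume "x \<in> set r" "y \<in> set (first_row T)" "f y = f x"
    moreover from this have "y \<in> set (tableau_word T)"
      by (cases T) auto
    ultimately show "y < x" using Cons.prems by (auto simp: standard_over_def sorted_wrt_append)
  qed (use Cons assms in auto)
  moreover have "first_row (map (map f) T) = map f (first_row T)" by (cases T) auto
  moreover have "sorted (map f r)" using Cons.prems(1) assms(2)
    by (auto simp: sorted_map mono_def intro: sorted_wrt_mono_rel[of _ "(\<le>)"])
  ultimately show ?case using Cons by (auto simp: standard_over_def sorted_wrt_append)
qed simp

text \<open>The image of the insertion tableau is again a tableau and its word is equivalent to
  \<open>map f w\<close>, so uniqueness applies. For \<open>number\<close> this says that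
  rectification commutes with forgetting the subscripts.\<close>

lemma P_tableau_map:
  fixes f :: "'a::linorder \<Rightarrow> 'b::linorder"
  assumes "mono f" "standard_over f w"
  shows "P_tableau (map f w) = map (map f) (P_tableau w)"
proof -
  have k: "standard_over f (tableau_word (P_tableau w))"
    "knuth_equiv (map f w) (map f (tableau_word (P_tableau w)))"
    using standard_over_knuth_equiv[OF knuth_equiv_sym[OF knuth_equiv_P] assms] by auto
  have e: "map f (tableau_word T) = tableau_word (map (map f) T)" for T
    by (induction T) auto
  show ?thesis
    using P_tableau_unique[OF is_tableau_map[OF is_tableau_P assms(1) k(1)]]
      knuth_equiv_sym[OF k(2)] e by simp
qed

section \<open>The rectification of the labeled tableau\<close>

fun number :: "labeled \<Rightarrow> nat" where
  "number (Lab k l) = k"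

lemma less_Lab [simp]: "Lab k l < Lab k' l' \<longleftrightarrow> k < k' \<or> k = k' \<and> l < l'"
  by (auto simp: less_labeled_def)

lemma mono_number: "mono number"
proof
  fix x y :: labeled
  assume "x \<le> y"
  then show "number x \<le> number y" by (cases x; cases y) auto
qed

lemma number_label_tableau: "b \<in> boxes \<delta> \<Longrightarrow> number (label_tableau \<delta> L b) = L b"
  by (simp add: label_tableau_def)

lemma label_tableau_less:
  assumes "b \<in> boxes \<delta>" "c \<in> boxes \<delta>" "reading_less b c" "L b = L c"
  shows "label_tableau \<delta> L b < label_tableau \<delta> L c"
proof -
  obtain p q where pq: "p < q" "q < length (reading \<delta>)" "reading \<delta> ! p = b" "reading \<delta> ! q = c"
    using reading_nth_less[OF assms(1-3)] .
  \<comment> \<open>No box is listed twice, so \<open>takeWhile\<close> stops exactly at the index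
    of the given box.\<close>
  have tw: "takeWhile (\<lambda>x. x \<noteq> reading \<delta> ! n) (reading \<delta>) = take n (reading \<delta>)"
    if "n < length (reading \<delta>)" for n
    by (rule takeWhile_eq_take_P_nth)
      (use that distinct_reading in \<open>auto simp: nth_eq_iff_index_eq\<close>)
  have "length (filter (\<lambda>x. L x = L c) (take p (reading \<delta>)))
      < length (filter (\<lambda>x. L x = L c) (take q (reading \<delta>)))"
  proof -
    have "take q (reading \<delta>) = take p (reading \<delta>) @ b # drop (Suc p) (take q (reading \<delta>))"
      using id_take_nth_drop[of p "take q (reading \<delta>)"] pq by (simp add: min_def)
    then have "filter (\<lambda>x. L x = L c) (take q (reading \<delta>)) =
        filter (\<lambda>x. L x = L c) (take p (reading \<delta>)) @
        filter (\<lambda>x. L x = L c) (b # drop (Suc p) (take q (reading \<delta>)))"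
      by (metis filter_append)
    then show ?thesis using assms(4) by simp
  qed
  then show ?thesis
    using assms tw[of p] tw[of q] pq by (simp add: label_tableau_def)
qed

lemma standard_over_label: "standard_over number (row_word \<delta> (label_tableau \<delta> L))"
  unfolding standard_over_def row_word_def sorted_wrt_map
proof (rule sorted_wrt_mono_rel[OF _ sorted_reading])
  fix b c assume "b \<in> set (reading \<delta>)" "c \<in> set (reading \<delta>)" "reading_less b c"
  then show "number (label_tableau \<delta> L b) = number (label_tableau \<delta> L c) \<longrightarrow>
      label_tableau \<delta> L b < label_tableau \<delta> L c"
    using label_tableau_less[of b \<delta> c L] by (simp add: number_label_tableau)
qed

lemma distinct_label: "distinct (row_word \<delta> (label_tableau \<delta> L))"
  using standard_over_label[of \<delta> L] unfolding standard_over_def distinct_conv_nth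
    sorted_wrt_iff_nth_less by (metis linorder_neqE_nat order_less_irrefl)

lemma map_number_label: "map number (row_word \<delta> (label_tableau \<delta> L)) = row_word \<delta> L"
  by (simp add: row_word_def number_label_tableau)

lemma semistandard_label:
  assumes "semistandard \<delta> L"
  shows "semistandard \<delta> (label_tableau \<delta> L)"
proof -
  have less: "label_tableau \<delta> L b < label_tableau \<delta> L c"
    if "b \<in> boxes \<delta>" "c \<in> boxes \<delta>" "L b < L c" for b c
    using that by (simp add: label_tableau_def)
  show ?thesis unfolding semistandard_def
  proof (intro conjI allI impI)
    fix i j j' assume a: "(i, j) \<in> boxes \<delta>" "(i, j') \<in> boxes \<delta>" "j < j'"
    then have "L (i, j) \<le> L (i, j')" using assms by (auto simp: semistandard_def)
    then show "label_tableau \<delta> L (i, j) \<le> label_tableau \<delta> L (i, j')"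
      using less[OF a(1,2)] label_tableau_less[OF a(1,2), of L] a(3)
      by (cases "L (i, j) = L (i, j')") (auto simp: reading_less_def less_imp_le)
  next
    fix i i' j assume a: "(i, j) \<in> boxes \<delta>" "(i', j) \<in> boxes \<delta>" "i < i'"
    then have "L (i, j) < L (i', j)" using assms by (auto simp: semistandard_def)
    then show "label_tableau \<delta> L (i, j) < label_tableau \<delta> L (i', j)" using less a by blast
  qed
qed

definition label_rect :: "shape \<Rightarrow> (box \<Rightarrow> nat) \<Rightarrow> labeled list list" where
  "label_rect \<delta> L = P_tableau (row_word \<delta> (label_tableau \<delta> L))"

lemma P_tableau_eq_label_rect: "P_tableau (row_word \<delta> L) = map (map number) (label_rect \<delta> L)"
  using P_tableau_map[OF mono_number standard_over_label[of \<delta> L]]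
  by (simp add: map_number_label label_rect_def)

lemma shape_label_rect: "map length (label_rect \<delta> L) = rect_shape \<delta> L"
  by (simp add: rect_shape_eq P_tableau_eq_label_rect)

text \<open>Labels are distinct and Knuth equivalence only rearranges them, so each label fills
  exactly one box of the rectification. This is what makes the description in \<open>rho\<close>
  definite.\<close>

lemma bij_label_rect:
  "bij_betw (rows_filling (label_rect \<delta> L)) (diagram (rect_shape \<delta> L))
    (label_tableau \<delta> L ` boxes \<delta>)"
proof -
  let ?T = "label_rect \<delta> L" and ?n = "(rect_shape \<delta> L, [])"
  have w: "map (rows_filling ?T) (reading ?n) = tableau_word ?T"
    using row_word_rows_filling[of ?T] by (simp add: row_word_def shape_label_rect)
  have m: "mset (tableau_word ?T) = mset (row_word \<delta> (label_tableau \<delta> L))"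
    unfolding label_rect_def by (intro knuth_equiv_mset knuth_equiv_P)
  then have "distinct (tableau_word ?T)"
    using distinct_label by (metis mset_eq_imp_distinct_iff)
  then have "inj_on (rows_filling ?T) (set (reading ?n))"
    unfolding w[symmetric] by (simp only: distinct_map)
  moreover have "rows_filling ?T ` set (reading ?n) = set (tableau_word ?T)"
    unfolding w[symmetric] by simp
  moreover have "set (tableau_word ?T) = label_tableau \<delta> L ` boxes \<delta>"
    using mset_eq_setD[OF m] by (simp add: row_word_def)
  ultimately show ?thesis by (simp add: bij_betw_def)
qed

lemma inj_label: "inj_on (label_tableau \<delta> L) (boxes \<delta>)"
  using distinct_label[of \<delta> L] by (simp add: row_word_def distinct_map)

lemma rho_eqI:
  assumes "c \<in> diagram (rect_shape \<delta> L)"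
    "rows_filling (label_rect \<delta> L) c = label_tableau \<delta> L b"
  shows "rho \<delta> L b = c"
  unfolding rho_def rect_tableau_eq label_rect_def[symmetric]
  using assms bij_label_rect[of \<delta> L] by (intro the_equality) (auto simp: bij_betw_def inj_on_def)

lemma rho_value:
  assumes "b \<in> boxes \<delta>"
  shows "rho \<delta> L b \<in> diagram (rect_shape \<delta> L)"
    "rows_filling (label_rect \<delta> L) (rho \<delta> L b) = label_tableau \<delta> L b"
proof -
  obtain c where c: "c \<in> diagram (rect_shape \<delta> L)"
      "rows_filling (label_rect \<delta> L) c = label_tableau \<delta> L b"
    using bij_label_rect[of \<delta> L] assms unfolding bij_betw_def by (metis image_iff)
  then show "rho \<delta> L b \<in> diagram (rect_shape \<delta> L)"
    "rows_filling (label_rect \<delta> L) (rho \<delta> L b) = label_tableau \<delta> L b"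
    using rho_eqI[OF c] by simp_all
qed

lemma bij_rho: "bij_betw (rho \<delta> L) (boxes \<delta>) (diagram (rect_shape \<delta> L))"
  unfolding bij_betw_def
proof (intro conjI equalityI subsetI)
  show "inj_on (rho \<delta> L) (boxes \<delta>)"
  proof (rule inj_onI)
    fix b c assume "b \<in> boxes \<delta>" "c \<in> boxes \<delta>" "rho \<delta> L b = rho \<delta> L c"
    then show "b = c"
      using rho_value(2)[of b \<delta> L] rho_value(2)[of c \<delta> L] inj_onD[OF inj_label[of \<delta> L], of b c]
      by simp
  qed
  fix c assume "c \<in> diagram (rect_shape \<delta> L)"
  moreover from this obtain b where "b \<in> boxes \<delta>"
      "rows_filling (label_rect \<delta> L) c = label_tableau \<delta> L b"
    using bij_label_rect[of \<delta> L] unfolding bij_betw_def by blast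
  ultimately show "c \<in> rho \<delta> L ` boxes \<delta>" using rho_eqI by blast
next
  fix c assume "c \<in> rho \<delta> L ` boxes \<delta>"
  then show "c \<in> diagram (rect_shape \<delta> L)" using rho_value(1) by blast
qed

lemma rect_tableau_rho:
  assumes "b \<in> boxes \<delta>"
  shows "rect_tableau \<delta> L (rho \<delta> L b) = L b"
proof -
  obtain i j where ij: "rho \<delta> L b = (i, j)" by fastforce
  then have "(i, j) \<in> diagram (map length (label_rect \<delta> L))"
    using rho_value(1)[OF assms, of L] by (simp add: shape_label_rect)
  moreover from this have "i - 1 < length (label_rect \<delta> L)"
      "j - 1 < length (label_rect \<delta> L ! (i - 1))"
    by (auto simp: diagram_iff)
  ultimately have "rect_tableau \<delta> L (i, j) = number (rows_filling (label_rect \<delta> L) (i, j))"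
    by (simp add: rect_tableau_eq P_tableau_eq_label_rect rows_filling_def comp_def)
  then show ?thesis using rho_value(2)[OF assms, of L] assms ij by (simp add: number_label_tableau)
qed

lemma rearranged_rho: "b \<in> boxes \<delta> \<Longrightarrow> rearranged \<delta> v L (rho \<delta> L b) = v b"
  using bij_rho[of \<delta> L] rho_value(1)[of b \<delta> L]
  by (simp add: rearranged_def bij_betw_def inv_into_f_f)

section \<open>The shape of a product\<close>

lemma conjugate_eq: "conjugate la (Suc j) = length (filter (\<lambda>k. Suc j \<le> k) la)"
proof -
  have "{i. 1 \<le> i \<and> Suc j \<le> part la i} = Suc ` {i. i < length la \<and> Suc j \<le> la ! i}"
  proof (intro equalityI subsetI)
    fix i assume i: "i \<in> {i. 1 \<le> i \<and> Suc j \<le> part la i}"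
    then have "i - 1 < length la" "i = Suc (i - 1)" using part_pos_iff[of la i] by auto
    moreover from this have "Suc j \<le> la ! (i - 1)" using i part_Suc[of "i - 1" la] by simp
    ultimately show "i \<in> Suc ` {i. i < length la \<and> Suc j \<le> la ! i}" by blast
  qed auto
  then show ?thesis
    by (simp add: conjugate_def length_filter_conv_card card_image)
qed

lemma conjugate_1: "is_partition la \<Longrightarrow> conjugate la 1 = length la"
proof -
  assume "is_partition la"
  then have "filter (\<lambda>k. Suc 0 \<le> k) la = la"
    by (auto simp: is_partition_def filter_id_conv Suc_le_eq intro: gr0I)
  then show ?thesis using conjugate_eq[of la 0] by simp
qed

lemma conjugate_2: "conjugate la 2 = long_rows (tableau_rows la P)"
proof -
  have "conjugate la 2 = length (filter (\<lambda>k. 2 \<le> k) (map length (tableau_rows la P)))"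
    using conjugate_eq[of la 1] by (simp add: numeral_2_eq_2)
  then show ?thesis by (simp only: long_rows_def filter_map length_map comp_def)
qed

definition low_box :: "nat list \<Rightarrow> box \<Rightarrow> box" where
  "low_box \<nu> = (\<lambda>(i, j). (length \<nu> + i, j))"

definition right_box :: "nat list \<Rightarrow> box \<Rightarrow> box" where
  "right_box \<mu> = (\<lambda>(i, j). (i, part \<mu> 1 + j))"

lemma part_star:
  assumes "is_partition \<nu>"
  shows "part (fst (star \<mu> \<nu>)) i =
      (if 1 \<le> i \<and> i \<le> length \<nu> then part \<mu> 1 + part \<nu> i else part \<mu> (i - length \<nu>))"
    and "part (snd (star \<mu> \<nu>)) i = (if 1 \<le> i \<and> i \<le> length \<nu> then part \<mu> 1 else 0)"
  using conjugate_1[OF assms] by (auto simp: star_def part_def nth_append)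

lemma part_le_first:
  assumes "is_partition \<mu>"
  shows "part \<mu> i \<le> part \<mu> 1"
  using is_partition_nth(2)[OF assms, of "i - 1" 0] by (auto simp: part_def)

lemma boxes_star:
  assumes "is_partition \<nu>"
  shows "boxes (star \<mu> \<nu>) = low_box \<nu> ` diagram \<mu> \<union> right_box \<mu> ` diagram \<nu>" (is "?L = ?R")
proof (intro equalityI subsetI)
  fix b assume "b \<in> ?L"
  then obtain i j where b: "b = (i, j)" "1 \<le> i" "part (snd (star \<mu> \<nu>)) i < j"
    "j \<le> part (fst (star \<mu> \<nu>)) i" by (auto simp: boxes_alt)
  show "b \<in> ?R"
  proof (cases "i \<le> length \<nu>")
    case True
    then have "(i, j - part \<mu> 1) \<in> diagram \<nu>" "b = right_box \<mu> (i, j - part \<mu> 1)"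
      using b by (auto simp: part_star[OF assms] diagram_def right_box_def)
    then show ?thesis by blast
  next
    case False
    then have "(i - length \<nu>, j) \<in> diagram \<mu>" "b = low_box \<nu> (i - length \<nu>, j)"
      using b by (auto simp: part_star[OF assms] diagram_def low_box_def)
    then show ?thesis by blast
  qed
next
  fix b assume "b \<in> ?R"
  then show "b \<in> ?L"
    by (auto simp: boxes_alt part_star[OF assms] low_box_def right_box_def diagram_def
        dest: part_pos_iff) (auto simp: part_def split: if_splits)
qed

lemma boxes_star_disjoint: "low_box \<nu> ` diagram \<mu> \<inter> right_box \<mu> ` diagram \<nu> = {}"
  by (auto simp: low_box_def right_box_def diagram_iff)

lemma inj_low_box: "inj_on (low_box \<nu>) A" and inj_right_box: "inj_on (right_box \<mu>) A"
  by (auto simp: inj_on_def low_box_def right_box_def)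

lemma star_filling_low:
  assumes "is_partition \<nu>" "b \<in> diagram \<mu>"
  shows "star_filling \<mu> \<nu> s t (low_box \<nu> b) = s b"
  using assms boxes_star[OF assms(1), of \<mu>] conjugate_1[OF assms(1)]
  by (cases b) (auto simp: star_filling_def low_box_def diagram_iff)

lemma star_filling_right:
  assumes "is_partition \<nu>" "b \<in> diagram \<nu>"
  shows "star_filling \<mu> \<nu> s t (right_box \<mu> b) = t b"
  using assms boxes_star[OF assms(1), of \<mu>] conjugate_1[OF assms(1)]
  by (cases b) (auto simp: star_filling_def right_box_def diagram_iff)

lemma semistandard_star:
  assumes "is_partition \<nu>" "semistandard (star \<mu> \<nu>) L"
  shows "semistandard (\<mu>, []) (L \<circ> low_box \<nu>)" "semistandard (\<nu>, []) (L \<circ> right_box \<mu>)"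
proof -
  have "low_box \<nu> b \<in> boxes (star \<mu> \<nu>)" if "b \<in> diagram \<mu>" for b
    using that boxes_star[OF assms(1)] by auto
  moreover have "right_box \<mu> b \<in> boxes (star \<mu> \<nu>)" if "b \<in> diagram \<nu>" for b
    using that boxes_star[OF assms(1)] by auto
  ultimately show "semistandard (\<mu>, []) (L \<circ> low_box \<nu>)" "semistandard (\<nu>, []) (L \<circ> right_box \<mu>)"
    using assms(2) by (force simp: semistandard_def low_box_def right_box_def)+
qed

text \<open>No row and no column of the product shape meets both diagrams: they occupy different
  rows, and every row of \<mu> ends by column \<open>part \<mu> 1\<close>, after which \<nu>
  begins.\<close>

lemma star_filling_in_SSYT:
  assumes "is_partition \<mu>" "is_partition \<nu>" "M \<in> SSYT (\<mu>, [])" "N \<in> SSYT (\<nu>, [])"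
  shows "star_filling \<mu> \<nu> M N \<in> SSYT (star \<mu> \<nu>)"
proof -
  let ?L = "star_filling \<mu> \<nu> M N"
  have MN: "M \<in> diagram \<mu> \<rightarrow> {1..}" "N \<in> diagram \<nu> \<rightarrow> {1..}" "semistandard (\<mu>, []) M" "semistandard (\<nu>, []) N"
    using assms by (auto simp: SSYT_def SSYT_over_def fillings_def)
  have "?L \<in> boxes (star \<mu> \<nu>) \<rightarrow>\<^sub>E {1..}"
  proof (rule PiE_I)
    fix b assume "b \<in> boxes (star \<mu> \<nu>)"
    then show "?L b \<in> {1..}" unfolding boxes_star[OF assms(2)]
      using MN by (auto simp: star_filling_low[OF assms(2)] star_filling_right[OF assms(2)])
  qed (simp add: star_filling_def)
  moreover have "semistandard (star \<mu> \<nu>) ?L" unfolding semistandard_def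
  proof (intro conjI allI impI)
    fix i j j' assume a: "(i, j) \<in> boxes (star \<mu> \<nu>)" "(i, j') \<in> boxes (star \<mu> \<nu>)" "j < j'"
    show "?L (i, j) \<le> ?L (i, j')"
    proof (cases "i \<le> length \<nu>")
      case True
      then obtain b b' where "b \<in> diagram \<nu>" "b' \<in> diagram \<nu>" "(i, j) = right_box \<mu> b"
          "(i, j') = right_box \<mu> b'"
        using a unfolding boxes_star[OF assms(2)] by (fastforce simp: low_box_def diagram_iff)
      then show ?thesis using MN(4) a(3) star_filling_right[OF assms(2), of _ \<mu> M N]
        by (cases b; cases b') (auto simp: semistandard_def right_box_def)
    next
      case False
      then obtain b b' where "b \<in> diagram \<mu>" "b' \<in> diagram \<mu>" "(i, j) = low_box \<nu> b"
          "(i, j') = low_box \<nu> b'"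
        using a unfolding boxes_star[OF assms(2)] by (fastforce simp: right_box_def diagram_iff)
      then show ?thesis using MN(3) a(3) star_filling_low[OF assms(2), of _ \<mu> M N]
        by (cases b; cases b') (auto simp: semistandard_def low_box_def)
    qed
  next
    fix i i' j assume a: "(i, j) \<in> boxes (star \<mu> \<nu>)" "(i', j) \<in> boxes (star \<mu> \<nu>)" "i < i'"
    have j: "j \<le> part \<mu> 1" if "(x, j) \<in> diagram \<mu>" for x
      using that part_le_first[OF assms(1), of x] by (auto simp: diagram_def)
    show "?L (i, j) < ?L (i', j)"
    proof (cases "j \<le> part \<mu> 1")
      case True
      then obtain b b' where "b \<in> diagram \<mu>" "b' \<in> diagram \<mu>" "(i, j) = low_box \<nu> b"
          "(i', j) = low_box \<nu> b'"
        using a unfolding boxes_star[OF assms(2)] by (fastforce simp: right_box_def diagram_iff)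
      then show ?thesis using MN(3) a(3) star_filling_low[OF assms(2), of _ \<mu> M N]
        by (cases b; cases b') (auto simp: semistandard_def low_box_def)
    next
      case False
      then obtain b b' where "b \<in> diagram \<nu>" "b' \<in> diagram \<nu>" "(i, j) = right_box \<mu> b"
          "(i', j) = right_box \<mu> b'"
        using a j unfolding boxes_star[OF assms(2)] by (fastforce simp: low_box_def)
      then show ?thesis using MN(4) a(3) star_filling_right[OF assms(2), of _ \<mu> M N]
        by (cases b; cases b') (auto simp: semistandard_def right_box_def)
    qed
  qed
  ultimately show ?thesis by (simp add: SSYT_def SSYT_over_def fillings_def)
qed

lemma upt_shift: "[n + a ..< n + b] = map ((+) n) [a ..< b]"
  by (rule nth_equalityI) simp_all

text \<open>Rows are read from the bottom, so the diagram of \<mu> comes first; rectifying the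
  product therefore means inserting the second tableau into the first.\<close>

lemma row_word_star:
  assumes "is_partition \<nu>"
  shows "row_word (star \<mu> \<nu>) L =
    tableau_word (tableau_rows \<mu> (L \<circ> low_box \<nu>)) @ tableau_word (tableau_rows \<nu> (L \<circ> right_box \<mu>))"
proof -
  let ?n = "length \<nu>"
  let ?row = "\<lambda>i. map (\<lambda>j. L (i, j)) [part (snd (star \<mu> \<nu>)) i + 1 ..< part (fst (star \<mu> \<nu>)) i + 1]"
  have w: "tableau_word (tableau_rows la P) =
      concat (map (\<lambda>i. map (\<lambda>j. P (i, j)) [1 ..< part la i + 1]) (rev [1 ..< length la + 1]))"
    for la and P :: "box \<Rightarrow> 'a"
    by (simp add: tableau_word_def tableau_rows_def rev_map del: upt_Suc)
  have len: "length (fst (star \<mu> \<nu>)) = ?n + length \<mu>" by (simp add: star_def)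
  have "[1 ..< ?n + length \<mu> + 1] = [1 ..< ?n + 1] @ [?n + 1 ..< ?n + (length \<mu> + 1)]"
    using upt_add_eq_append[of 1 "?n + 1" "length \<mu>"] by (simp add: add_ac del: upt_Suc)
  also have "[?n + 1 ..< ?n + (length \<mu> + 1)] = map ((+) ?n) [1 ..< length \<mu> + 1]"
    by (rule upt_shift)
  finally have s: "rev [1 ..< ?n + length \<mu> + 1] =
      map ((+) ?n) (rev [1 ..< length \<mu> + 1]) @ rev [1 ..< ?n + 1]"
    by (simp add: rev_map del: upt_Suc)
  have low: "?row (?n + i) = map (\<lambda>j. (L \<circ> low_box \<nu>) (i, j)) [1 ..< part \<mu> i + 1]"
    if "i \<in> set [1 ..< length \<mu> + 1]" for i
    using that by (simp add: part_star[OF assms] low_box_def del: upt_Suc)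
  have right: "?row i = map (\<lambda>j. (L \<circ> right_box \<mu>) (i, j)) [1 ..< part \<nu> i + 1]"
    if "i \<in> set [1 ..< ?n + 1]" for i
    using that upt_shift[of "part \<mu> 1" 1 "part \<nu> i + 1"]
    by (simp add: part_star[OF assms] right_box_def comp_def del: upt_Suc)
  have "row_word (star \<mu> \<nu>) L = concat (map ?row (rev [1 ..< ?n + length \<mu> + 1]))"
    by (simp add: row_word_def reading_def map_concat comp_def len del: upt_Suc)
  also have "\<dots> = concat (map (\<lambda>i. ?row (?n + i)) (rev [1 ..< length \<mu> + 1])) @
      concat (map ?row (rev [1 ..< ?n + 1]))"
    unfolding s by (simp add: comp_def del: upt_Suc)
  also have "map (\<lambda>i. ?row (?n + i)) (rev [1 ..< length \<mu> + 1]) =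
      map (\<lambda>i. map (\<lambda>j. (L \<circ> low_box \<nu>) (i, j)) [1 ..< part \<mu> i + 1]) (rev [1 ..< length \<mu> + 1])"
    by (rule map_cong[OF refl], rule low) (simp del: upt_Suc)
  also have "map ?row (rev [1 ..< ?n + 1]) =
      map (\<lambda>i. map (\<lambda>j. (L \<circ> right_box \<mu>) (i, j)) [1 ..< part \<nu> i + 1]) (rev [1 ..< ?n + 1])"
    by (rule map_cong[OF refl], rule right) (simp del: upt_Suc)
  finally show ?thesis by (simp only: w)
qed

lemma P_tableau_append:
  "is_tableau M \<Longrightarrow> P_tableau (tableau_word M @ w) = insert_word w M"
  by (simp add: P_tableau_def insert_word_append insert_word_tableau_word)

text \<open>The rectification of the labeled filling becomes a product \<open>M\<close> times
  \<open>N\<close> with the origin of every label recorded, in the form to which the results on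
  first columns and first rows apply.\<close>

lemma label_rect_star:
  assumes "is_partition \<mu>" "is_partition \<nu>" "L \<in> SSYT (star \<mu> \<nu>)"
  obtains M N where "is_tableau M" "is_tableau N" "map length M = \<mu>" "map length N = \<nu>"
    "label_rect (star \<mu> \<nu>) L = insert_word (tableau_word N) M"
    "\<And>i j. (i, j) \<in> diagram \<mu> \<Longrightarrow> M ! (i - 1) ! (j - 1) = label_tableau (star \<mu> \<nu>) L (low_box \<nu> (i, j))"
    "\<And>i j. (i, j) \<in> diagram \<nu> \<Longrightarrow> N ! (i - 1) ! (j - 1) = label_tableau (star \<mu> \<nu>) L (right_box \<mu> (i, j))"
    "long_rows M = conjugate \<mu> 2"
proof -
  let ?l = "label_tableau (star \<mu> \<nu>) L"
  let ?M = "tableau_rows \<mu> (?l \<circ> low_box \<nu>)" and ?N = "tableau_rows \<nu> (?l \<circ> right_box \<mu>)"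
  have "semistandard (star \<mu> \<nu>) ?l"
    using assms(3) by (intro semistandard_label) (simp add: SSYT_def SSYT_over_def)
  then have t: "is_tableau ?M" "is_tableau ?N"
    using assms semistandard_star by (auto intro!: is_tableau_tableau_rows)
  have "?M ! (i - 1) ! (j - 1) = ?l (low_box \<nu> (i, j))" if "(i, j) \<in> diagram \<mu>" for i j
    using that nth_nth_tableau_rows[of "i - 1" \<mu> "j - 1" "?l \<circ> low_box \<nu>"] by (auto simp: diagram_iff)
  moreover have "?N ! (i - 1) ! (j - 1) = ?l (right_box \<mu> (i, j))" if "(i, j) \<in> diagram \<nu>" for i j
    using that nth_nth_tableau_rows[of "i - 1" \<nu> "j - 1" "?l \<circ> right_box \<mu>"] by (auto simp: diagram_iff)
  moreover have "label_rect (star \<mu> \<nu>) L = insert_word (tableau_word ?N) ?M"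
    unfolding label_rect_def row_word_star[OF assms(2)] using t(1) by (rule P_tableau_append)
  moreover have "long_rows ?M = conjugate \<mu> 2" by (rule conjugate_2[symmetric])
  ultimately show ?thesis using that[OF t] by simp
qed

text \<open>The lower bound on \<open>i\<close> is the hypothesis of
  \<open>insert_word_first_column\<close> at the zero-based index \<open>i - 1\<close>. The
  resulting box depends on \<open>L\<close> only through the rectified shape.\<close>

lemma rho_first_column:
  assumes "is_partition \<mu>" "is_partition \<nu>" "\<nu> \<noteq> []" "L \<in> SSYT (star \<mu> \<nu>)"
    and "conjugate \<mu> 2 + length \<nu> \<le> i" "i \<le> length \<mu>"
  defines "la \<equiv> rect_shape (star \<mu> \<nu>) L"
  shows "length \<mu> \<le> length la" "rho (star \<mu> \<nu>) L (low_box \<nu> (i, 1)) = (length la - length \<mu> + i, 1)"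
proof -
  \<comment> \<open>The bound on \<open>i\<close> is positive because \<nu> is non-empty, so
    \<open>i - 1\<close> is a true predecessor.\<close>
  have i: "1 \<le> i" using assms(3,5) by (cases \<nu>) auto
  obtain M N where MN: "is_tableau M" "is_tableau N" "map length M = \<mu>" "map length N = \<nu>"
    "label_rect (star \<mu> \<nu>) L = insert_word (tableau_word N) M"
    "\<And>i j. (i, j) \<in> diagram \<mu> \<Longrightarrow> M ! (i - 1) ! (j - 1) = label_tableau (star \<mu> \<nu>) L (low_box \<nu> (i, j))"
    "long_rows M = conjugate \<mu> 2"
    using label_rect_star[OF assms(1,2,4)] by metis
  let ?T = "insert_word (tableau_word N) M"
  have lens: "length M = length \<mu>" "length N = length \<nu>" "length ?T = length la"
    using arg_cong[OF MN(3), of length] arg_cong[OF MN(4), of length]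
      arg_cong[OF shape_label_rect[of "star \<mu> \<nu>" L], of length] MN(5) by (simp_all add: la_def)
  have T: "is_tableau ?T" using MN(1) by (rule is_tableau_insert_word)
  have "long_rows M + length N \<le> Suc (i - 1)" "i - 1 < length M"
    using assms(5,6) i lens MN(7) by auto
  note c = insert_word_first_column[OF MN(1,2) this]
  show l: "length \<mu> \<le> length la" using c(1) lens by simp
  define k where "k = length la - length \<mu> + (i - 1)"
  have k: "k < length ?T" "length la - length \<mu> + i = Suc k"
    using assms(6) i l lens by (auto simp: k_def)
  have ne: "?T ! k \<noteq> []" "M ! (i - 1) \<noteq> []"
    using is_tableau_sorted[OF T] is_tableau_sorted[OF MN(1)] k lens i assms(6) by auto
  have "(i, 1) \<in> diagram \<mu>"
    using i assms(6) is_partition_nth(1)[OF assms(1), of "i - 1"] by (auto simp: diagram_iff Suc_le_eq)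
  then have "M ! (i - 1) ! 0 = label_tableau (star \<mu> \<nu>) L (low_box \<nu> (i, 1))" using MN(6)[of i 1] by simp
  moreover have "?T ! k ! 0 = M ! (i - 1) ! 0"
    using c(2) ne lens by (simp add: k_def hd_conv_nth)
  moreover have "(Suc k, 1) \<in> diagram (map length ?T)"
    using k ne by (simp add: diagram_iff Suc_le_eq)
  moreover have "map length ?T = rect_shape (star \<mu> \<nu>) L"
    using MN(5) shape_label_rect by metis
  ultimately show "rho (star \<mu> \<nu>) L (low_box \<nu> (i, 1)) = (length la - length \<mu> + i, 1)"
    unfolding k(2) by (intro rho_eqI) (auto simp: MN(5) rows_filling_def)
qed

text \<open>The counterpart for the top row of \<nu>: the lower bound on \<open>j\<close> is the
  hypothesis of \<open>insert_word_first_row\<close> at the index \<open>j - 1\<close>.\<close>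

lemma rho_first_row:
  assumes "is_partition \<mu>" "is_partition \<nu>" "\<mu> \<noteq> []" "L \<in> SSYT (star \<mu> \<nu>)"
    and "part \<nu> 2 + part \<mu> 1 \<le> j" "j \<le> part \<nu> 1"
  defines "la \<equiv> rect_shape (star \<mu> \<nu>) L"
  shows "part \<nu> 1 \<le> part la 1" "rho (star \<mu> \<nu>) L (right_box \<mu> (1, j)) = (1, part la 1 - part \<nu> 1 + j)"
proof -
  have j: "1 \<le> j" using assms(3,5) is_partition_nth(1)[OF assms(1), of 0]
    by (auto simp: part_def Suc_le_eq split: if_splits)
  obtain M N where MN: "is_tableau M" "is_tableau N" "map length M = \<mu>" "map length N = \<nu>"
    "label_rect (star \<mu> \<nu>) L = insert_word (tableau_word N) M"
    "\<And>i j. (i, j) \<in> diagram \<nu> \<Longrightarrow> N ! (i - 1) ! (j - 1) = label_tableau (star \<mu> \<nu>) L (right_box \<mu> (i, j))"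
    using label_rect_star[OF assms(1,2,4)] by metis
  let ?T = "insert_word (tableau_word N) M"
  have shape: "map length ?T = la"
    using MN(5) shape_label_rect[of "star \<mu> \<nu>" L] by (simp add: la_def)
  have pj: "0 < part \<nu> 1" using j assms(6) by simp
  then obtain r N' where N: "N = r # N'" using MN(4) part_pos_iff[of \<nu> 1] by (cases N) auto
  have p: "part (map length X) 1 = length (first_row X)" for X :: "labeled list list"
    by (cases X) (auto simp: part_def)
  have p2: "part (map length (x # X)) 2 = length (first_row X)" for x and X :: "labeled list list"
    by (cases X) (auto simp: part_def)
  have "part (map length N) 1 = length r" "part (map length N) 2 = length (first_row N')"
    unfolding N by (simp_all only: p p2 first_row.simps)
  then have lens: "length r = part \<nu> 1" "length (first_row N') = part \<nu> 2"
      "length (first_row M) = part \<mu> 1" "length (first_row ?T) = part la 1"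
    using p[of M] p[of ?T] unfolding MN(3,4) shape by simp_all
  have "length (first_row M) + length (first_row N') \<le> Suc (j - 1)" "j - 1 < length r"
    using assms(5,6) j lens by auto
  note c = insert_word_first_row[OF MN(1) MN(2)[unfolded N] this, folded N]
  show l: "part \<nu> 1 \<le> part la 1" using c(1) lens by simp
  define k where "k = part la 1 - part \<nu> 1 + (j - 1)"
  have k: "k < part la 1" "part la 1 - part \<nu> 1 + j = Suc k"
    using assms(6) j l by (auto simp: k_def)
  have "(1, j) \<in> diagram \<nu>" using j assms(6) by (simp add: diagram_def)
  then have "N ! 0 ! (j - 1) = label_tableau (star \<mu> \<nu>) L (right_box \<mu> (1, j))"
    using MN(6)[of 1 j] by simp
  moreover have "?T ! 0 ! k = N ! 0 ! (j - 1)"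
  proof -
    have "first_row ?T = ?T ! 0" using lens(4) k(1) by (cases ?T) simp_all
    then show ?thesis using c(2) lens(1,4) by (simp add: k_def N)
  qed
  moreover have "(1, Suc k) \<in> diagram (map length ?T)"
    using k shape by (simp add: diagram_def)
  moreover have "map length ?T = rect_shape (star \<mu> \<nu>) L"
    using shape by (simp add: la_def)
  ultimately show "rho (star \<mu> \<nu>) L (right_box \<mu> (1, j)) = (1, part la 1 - part \<nu> 1 + j)"
    unfolding k(2) by (intro rho_eqI) (auto simp: MN(5) rows_filling_def)
qed

section \<open>Littlewood--Richardson coefficients\<close>

definition tableaux :: "nat list \<Rightarrow> nat list list set" where
  "tableaux la = {T. is_tableau T \<and> map length T = la \<and> 0 \<notin> set (tableau_word T)}"

lemma map_reading_normal: "map P (reading (la, [])) = tableau_word (tableau_rows la P)"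
  using row_word_normal[of la P] by (simp add: row_word_def)

lemma set_tableau_word_rows: "set (tableau_word (tableau_rows la P)) = P ` diagram la"
  using arg_cong[OF map_reading_normal[of P la], of set] by simp

lemma mset_tableau_word_rows:
  "image_mset P (mset_set (diagram la)) = mset (tableau_word (tableau_rows la P))"
  using arg_cong[OF map_reading_normal[of P la], of mset] by (simp add: mset_reading)

lemma rows_filling_tableaux:
  assumes "T \<in> tableaux la"
  shows "rows_filling T \<in> SSYT (la, [])"
proof -
  have T: "is_tableau T" "map length T = la" "0 \<notin> set (tableau_word T)"
    using assms by (auto simp: tableaux_def)
  have "rows_filling T ` diagram la = set (tableau_word T)"
    using set_tableau_word_rows[of la "rows_filling T"] tableau_rows_rows_filling[of T] T(2) by simp
  then have "rows_filling T b \<noteq> 0" if "b \<in> diagram la" for b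
    using T(3) that by (metis image_eqI)
  then show ?thesis
    using rows_filling_in_SSYT[OF T(1)] T(2)
    by (auto simp: SSYT_def SSYT_over_def fillings_def Suc_le_eq PiE_def)
qed

lemma bij_tableau_rows:
  assumes "is_partition la"
  shows "bij_betw (tableau_rows la) (SSYT (la, [])) (tableaux la)"
proof (rule bij_betw_byWitness[where f' = rows_filling])
  show "\<forall>P\<in>SSYT (la, []). rows_filling (tableau_rows la P) = P"
    by (auto simp: SSYT_def SSYT_over_def fillings_def PiE_def rows_filling_tableau_rows)
  show "\<forall>T\<in>tableaux la. tableau_rows la (rows_filling T) = T"
    by (auto simp: tableaux_def tableau_rows_rows_filling)
  show "tableau_rows la ` SSYT (la, []) \<subseteq> tableaux la"
  proof (intro image_subsetI)
    fix P assume "P \<in> SSYT (la, [])"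
    then have P: "P \<in> diagram la \<rightarrow> {1..}" "semistandard (la, []) P"
      by (auto simp: SSYT_def SSYT_over_def fillings_def)
    have "P b \<noteq> 0" if "b \<in> diagram la" for b using Pi_mem[OF P(1) that] by simp
    then have "0 \<notin> P ` diagram la" by (metis imageE)
    then show "tableau_rows la P \<in> tableaux la"
      using is_tableau_tableau_rows[OF assms P(2)]
      unfolding tableaux_def set_tableau_word_rows[symmetric] by simp
  qed
  show "rows_filling ` tableaux la \<subseteq> SSYT (la, [])"
    using rows_filling_tableaux by blast
qed

lemma schur_eq:
  assumes "is_partition la"
  shows "schur la m = int (card {T \<in> tableaux la. mset (tableau_word T) = m})"
proof -
  have "bij_betw (tableau_rows la) {M \<in> SSYT (la, []). image_mset M (mset_set (diagram la)) = m}
    {T \<in> tableaux la. mset (tableau_word T) = m}"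
    by (rule bij_betw_Collect[OF bij_tableau_rows[OF assms]]) (simp add: mset_tableau_word_rows)
  then show ?thesis by (simp add: schur_def bij_betw_same_card)
qed

section \<open>Linear independence of Schur functions\<close>

text \<open>For \<open>s = 0\<close> and a partition this is the highest weight tableau, whose
  content is its shape; the offset serves the recursion.\<close>

fun superstandard :: "nat \<Rightarrow> nat list \<Rightarrow> nat list list" where
  "superstandard s [] = []"
| "superstandard s (k # ks) = replicate k (Suc s) # superstandard (Suc s) ks"

lemma shape_superstandard [simp]: "map length (superstandard s la) = la"
  by (induction s la rule: superstandard.induct) auto

lemma superstandard_greater: "x \<in> set (tableau_word (superstandard s la)) \<Longrightarrow> s < x"
  by (induction s la rule: superstandard.induct) fastforce+

lemma superstandard_in_tableaux:
  assumes "is_partition la"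
  shows "superstandard s la \<in> tableaux la"
proof -
  have "is_tableau (superstandard s la)" using assms
  proof (induction s la rule: superstandard.induct)
    case (2 s k ks)
    have "strictly_above (replicate k (Suc s)) (first_row (superstandard (Suc s) ks))"
      using "2.prems" by (cases ks) (auto simp: strictly_above_iff is_partition_def)
    then show ?case using 2 by (auto simp: is_partition_def)
  qed simp
  then show ?thesis using superstandard_greater[of 0 s la] by (auto simp: tableaux_def)
qed

lemma count_superstandard:
  "length (filter (\<lambda>x. x \<le> s + i) (tableau_word (superstandard s la))) = sum_list (take i la)"
proof (induction s la arbitrary: i rule: superstandard.induct)
  case (2 s k ks)
  show ?case
  proof (cases i)
    case 0
    have "\<not> x \<le> s" if "x \<in> set (tableau_word (superstandard s (k # ks)))" for x
      using superstandard_greater[OF that] by simp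
    then show ?thesis unfolding 0 by (simp add: filter_empty_conv del: superstandard.simps)
  next
    case (Suc i')
    then show ?thesis using 2[of i'] by (simp add: filter_replicate)
  qed
qed simp

text \<open>Columns are strict, so the entries up to \<open>s + i\<close> lie in the first
  \<open>i\<close> rows. For \<open>s = 0\<close> this is the dominance inequality between content
  and shape, with equality for the superstandard tableau.\<close>

lemma count_tableau_le:
  assumes "is_tableau T" "\<forall>x\<in>set (first_row T). s < x"
  shows "length (filter (\<lambda>x. x \<le> s + i) (tableau_word T)) \<le> sum_list (take i (map length T))"
  using assms
proof (induction T arbitrary: s i)
  case (Cons r T)
  have f: "Suc s < x" if x: "x \<in> set (first_row T)" for x
  proof -
    obtain j where "j < length (first_row T)" "x = first_row T ! j"
      using x by (metis in_set_conv_nth)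
    then have "r ! j < x" "j < length r" using Cons.prems(1) by (auto simp: strictly_above_iff)
    moreover from this(2) have "s < r ! j" using Cons.prems(2) by simp
    ultimately show ?thesis by simp
  qed
  show ?case
  proof (cases i)
    case 0
    then show ?thesis using Cons.IH[of s 0] Cons.prems f
      by (fastforce simp: filter_empty_conv)
  next
    case (Suc i')
    then show ?thesis
      using Cons.IH[of "Suc s" i'] Cons.prems f length_filter_le[of "\<lambda>x. x \<le> Suc (s + i')" r]
      by (simp add: add.commute add_mono)
  qed
qed simp

lemma partition_eqI:
  assumes "is_partition la" "is_partition ka" "\<And>i. sum_list (take i la) = sum_list (take i ka)"
  shows "la = ka"
proof -
  have p: "sum_list (take (Suc i) l) = sum_list (take i l) + part l (Suc i)" for l i
    by (cases "i < length l") (simp_all add: take_Suc_conv_app_nth part_def)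
  have e: "part la (Suc i) = part ka (Suc i)" for i
    using p[of i la] p[of i ka] assms(3)[of i] assms(3)[of "Suc i"] by simp
  have pos: "i < length l \<longleftrightarrow> 0 < part l (Suc i)" if "is_partition l" for l i
    using is_partition_nth(1)[OF that, of i] by (auto simp: part_def)
  have "length la = length ka"
    using pos[OF assms(1)] pos[OF assms(2)] e by (metis linorder_neqE_nat order_less_irrefl)
  then show ?thesis using e by (intro nth_equalityI) (auto simp flip: part_Suc)
qed

text \<open>Unitriangularity in the dominance order: take \<open>\<eta>\<close> maximal among the
  shapes with non-zero coefficient and compare coefficients at the content of its superstandard
  tableau. Any other shape contributing there would dominate \<open>\<eta>\<close>.\<close>

lemma schur_independent:
  assumes "finite S" "\<And>\<kappa>. \<kappa> \<in> S \<Longrightarrow> is_partition \<kappa>"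
    and "\<And>m. (\<Sum>\<kappa>\<in>S. d \<kappa> * schur \<kappa> m) = 0" "\<kappa> \<in> S"
  shows "d \<kappa> = 0"
proof (rule ccontr)
  assume "d \<kappa> \<noteq> 0"
  \<comment> \<open>Partial sums turn dominance into the pointwise order on functions, for which
    \<open>finite_has_maximal\<close> is available.\<close>
  define p where "p = (\<lambda>(l :: nat list) i. sum_list (take i l))"
  have "finite (p ` {\<kappa> \<in> S. d \<kappa> \<noteq> 0})" "p ` {\<kappa> \<in> S. d \<kappa> \<noteq> 0} \<noteq> {}"
    using assms \<open>d \<kappa> \<noteq> 0\<close> by auto
  then have "\<exists>f\<in>p ` {\<kappa> \<in> S. d \<kappa> \<noteq> 0}. \<forall>g\<in>p ` {\<kappa> \<in> S. d \<kappa> \<noteq> 0}. f \<le> g \<longrightarrow> f = g"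
    by (rule finite_has_maximal)
  then obtain f where "f \<in> p ` {\<kappa> \<in> S. d \<kappa> \<noteq> 0}" "\<forall>g\<in>p ` {\<kappa> \<in> S. d \<kappa> \<noteq> 0}. f \<le> g \<longrightarrow> f = g"
    by blast
  then obtain \<eta> where \<eta>: "\<eta> \<in> S" "d \<eta> \<noteq> 0"
    "\<And>\<kappa>. \<kappa> \<in> S \<Longrightarrow> d \<kappa> \<noteq> 0 \<Longrightarrow> p \<eta> \<le> p \<kappa> \<Longrightarrow> p \<eta> = p \<kappa>" by blast
  define m where "m = mset (tableau_word (superstandard 0 \<eta>))"
  have zero: "d \<kappa> * schur \<kappa> m = 0" if \<kappa>: "\<kappa> \<in> S - {\<eta>}" for \<kappa>
  proof (rule ccontr)
    assume "d \<kappa> * schur \<kappa> m \<noteq> 0"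
    then have "d \<kappa> \<noteq> 0" "schur \<kappa> m \<noteq> 0" by auto
    then have "{T \<in> tableaux \<kappa>. mset (tableau_word T) = m} \<noteq> {}"
      using \<kappa> assms(2) by (metis Diff_iff card.empty of_nat_0 schur_eq)
    then obtain T where T: "is_tableau T" "map length T = \<kappa>" "0 \<notin> set (tableau_word T)"
        "mset (tableau_word T) = m"
      by (auto simp: tableaux_def)
    have "\<forall>x\<in>set (first_row T). 0 < x" using T(3) by (cases T) (auto intro: gr0I)
    then have "length (filter (\<lambda>x. x \<le> i) (tableau_word T)) \<le> p \<kappa> i" for i
      using count_tableau_le[OF T(1), of 0 i] T(2) by (simp add: p_def)
    moreover have "length (filter (\<lambda>x. x \<le> i) (tableau_word T)) = p \<eta> i" for i
    proof -
      have "mset (filter (\<lambda>x. x \<le> i) (tableau_word T))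
          = mset (filter (\<lambda>x. x \<le> i) (tableau_word (superstandard 0 \<eta>)))"
        using T(4) by (simp add: m_def)
      then have "length (filter (\<lambda>x. x \<le> i) (tableau_word T))
          = length (filter (\<lambda>x. x \<le> i) (tableau_word (superstandard 0 \<eta>)))"
        by (rule mset_eq_length)
      then show ?thesis using count_superstandard[of 0 i \<eta>] by (simp add: p_def)
    qed
    ultimately have "p \<eta> = p \<kappa>" using \<eta>(3) \<kappa> \<open>d \<kappa> \<noteq> 0\<close> by (simp add: le_fun_def)
    then have "\<eta> = \<kappa>" using assms(2) \<kappa> \<eta>(1) by (intro partition_eqI) (auto simp: p_def fun_eq_iff)
    then show False using \<kappa> by simp
  qed
  have "(\<Sum>\<kappa>\<in>S. d \<kappa> * schur \<kappa> m) = d \<eta> * schur \<eta> m + (\<Sum>\<kappa>\<in>S - {\<eta>}. d \<kappa> * schur \<kappa> m)"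
    using assms(1) \<eta>(1) by (rule sum.remove)
  then have "d \<eta> * schur \<eta> m = 0" using zero assms(3)[of m] by simp
  then have "schur \<eta> m = 0" using \<eta>(2) by simp
  moreover have "superstandard 0 \<eta> \<in> {T \<in> tableaux \<eta>. mset (tableau_word T) = m}"
    using superstandard_in_tableaux assms(2)[OF \<eta>(1)] by (simp add: m_def)
  moreover have "finite {T \<in> tableaux \<eta>. mset (tableau_word T) = m}"
    unfolding tableaux_def
    by (rule finite_subset[OF _ finite_tableaux_mset[of m]]) auto
  ultimately show False using schur_eq[OF assms(2)[OF \<eta>(1)], of m] by (auto simp: card_eq_0_iff)
qed

section \<open>Structure constants of the product\<close>

text \<open>By \<open>card_factorizations_shape\<close> any tableau of shape \<open>\<kappa>\<close>
  gives this number when \<nu> is a partition. The value 0 elsewhere matches the support condition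
  in \<open>lr\<close>.\<close>

definition structure_constant :: "nat list \<Rightarrow> nat list \<Rightarrow> nat list \<Rightarrow> int" where
  "structure_constant \<mu> \<nu> \<kappa> =
     (if is_partition \<kappa> then int (card (factorizations \<mu> \<nu> (superstandard 0 \<kappa>))) else 0)"

lemma card_factorizations:
  fixes T :: "nat list list"
  assumes "is_partition \<nu>" "is_tableau T"
  shows "int (card (factorizations \<mu> \<nu> T)) = structure_constant \<mu> \<nu> (map length T)"
  using card_factorizations_shape[OF assms, of "superstandard 0 (map length T)" \<mu>]
    superstandard_in_tableaux[OF is_partition_shape[OF assms(2)], of 0] is_partition_shape[OF assms(2)]
  by (simp add: structure_constant_def tableaux_def)

lemma length_tableau_word: "length (tableau_word T) = sum_list (map length T)"
  by (induction T) auto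

text \<open>Sizes add under products, and a partition of known size has bounded parts and boundedly
  many of them.\<close>

lemma finite_structure_constant: "finite {\<kappa>. structure_constant \<mu> \<nu> \<kappa> \<noteq> 0}"
proof (rule finite_subset)
  let ?n = "sum_list \<mu> + sum_list \<nu>"
  show "{\<kappa>. structure_constant \<mu> \<nu> \<kappa> \<noteq> 0} \<subseteq> {\<kappa>. set \<kappa> \<subseteq> {..?n} \<and> length \<kappa> \<le> ?n}"
  proof
    fix \<kappa> assume "\<kappa> \<in> {\<kappa>. structure_constant \<mu> \<nu> \<kappa> \<noteq> 0}"
    then have \<kappa>: "is_partition \<kappa>" "factorizations \<mu> \<nu> (superstandard 0 \<kappa>) \<noteq> {}"
      by (auto simp: structure_constant_def split: if_splits)
    then obtain M N where MN: "is_tableau M" "map length M = \<mu>" "map length N = \<nu>"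
        "insert_word (tableau_word N) M = superstandard 0 \<kappa>"
      by (auto simp: factorizations_def)
    have "sum_list \<kappa> = ?n"
      using arg_cong[OF mset_insert_word[OF MN(1), of "tableau_word N"], of size] MN(2-4)
      by (simp add: length_tableau_word)
    moreover have "length l \<le> sum_list l" if "0 \<notin> set l" for l :: "nat list"
      using that by (induction l) auto
    ultimately show "\<kappa> \<in> {\<kappa>. set \<kappa> \<subseteq> {..?n} \<and> length \<kappa> \<le> ?n}"
      using \<kappa>(1) member_le_sum_list by (fastforce simp: is_partition_def)
  qed
qed (simp add: finite_lists_length_le)

lemma finite_submultisets: "finite {a. a \<subseteq># (m :: 'a multiset)}"
proof (rule finite_subset)
  show "{a. a \<subseteq># m} \<subseteq> mset ` {w. set w \<subseteq> set_mset m \<and> length w \<le> size m}"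
  proof
    fix a assume "a \<in> {a. a \<subseteq># m}"
    moreover obtain w where "a = mset w" using ex_mset by metis
    ultimately show "a \<in> mset ` {w. set w \<subseteq> set_mset m \<and> length w \<le> size m}"
      using set_mset_mono[of a m] size_mset_mono[of a m] by auto
  qed
qed (simp add: finite_lists_length_le)

text \<open>The left side counts pairs of tableaux of total content \<open>m\<close>. Grouping them
  by their product and the products by shape yields the right side, since insertion preserves
  content.\<close>

lemma schur_product:
  assumes "is_partition \<mu>" "is_partition \<nu>"
  shows "series_mult (schur \<mu>) (schur \<nu>) m =
    (\<Sum>\<kappa> | structure_constant \<mu> \<nu> \<kappa> \<noteq> 0. structure_constant \<mu> \<nu> \<kappa> * schur \<kappa> m)"
proof -
  let ?c = "structure_constant \<mu> \<nu>"
  define A where "A la m = {T \<in> tableaux la. mset (tableau_word T) = m}" for la m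
  have finA: "finite (A la m)" for la m
    unfolding A_def tableaux_def by (rule finite_subset[OF _ finite_tableaux_mset[of m]]) auto
  define Q where "Q = {(M, N). M \<in> tableaux \<mu> \<and> N \<in> tableaux \<nu> \<and>
      mset (tableau_word M) + mset (tableau_word N) = m}"
  define R where "R = {T. is_tableau T \<and> 0 \<notin> set (tableau_word T) \<and> mset (tableau_word T) = m}"
  have finR: "finite R" unfolding R_def by (rule finite_subset[OF _ finite_tableaux_mset[of m]]) auto
  have "series_mult (schur \<mu>) (schur \<nu>) m = int (\<Sum>a | a \<subseteq># m. card (A \<mu> a \<times> A \<nu> (m - a)))"
    by (simp add: series_mult_def schur_eq assms A_def card_cartesian_product)
  also have "(\<Sum>a | a \<subseteq># m. card (A \<mu> a \<times> A \<nu> (m - a))) = card (\<Union>a\<in>{a. a \<subseteq># m}. A \<mu> a \<times> A \<nu> (m - a))"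
    using finite_submultisets[of m] finA
    by (intro card_UN_disjoint[symmetric]) (auto simp: A_def)
  also have "(\<Union>a\<in>{a. a \<subseteq># m}. A \<mu> a \<times> A \<nu> (m - a)) = Q"
    by (auto simp: A_def Q_def)
  also have "Q = (\<Union>T\<in>R. factorizations \<mu> \<nu> T)"
  proof (intro equalityI subsetI)
    fix p assume "p \<in> Q"
    then obtain M N where p: "p = (M, N)" "M \<in> tableaux \<mu>" "N \<in> tableaux \<nu>"
       "mset (tableau_word M) + mset (tableau_word N) = m" by (auto simp: Q_def)
    let ?T = "insert_word (tableau_word N) M"
    have "is_tableau ?T" "mset (tableau_word ?T) = m"
      using p by (auto simp: tableaux_def is_tableau_insert_word mset_insert_word)
    moreover from this(2) have "set (tableau_word ?T) = set (tableau_word M) \<union> set (tableau_word N)"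
      using p(4) by (metis set_mset_mset set_mset_union)
    ultimately show "p \<in> (\<Union>T\<in>R. factorizations \<mu> \<nu> T)"
      using p by (auto simp: R_def factorizations_def tableaux_def)
  next
    fix p assume "p \<in> (\<Union>T\<in>R. factorizations \<mu> \<nu> T)"
    then obtain M N where p: "p = (M, N)" "(M, N) \<in> factorizations \<mu> \<nu> (insert_word (tableau_word N) M)"
        "insert_word (tableau_word N) M \<in> R" by (auto simp: factorizations_def)
    then have m: "mset (tableau_word M) + mset (tableau_word N) = m"
      by (auto simp: R_def factorizations_def mset_insert_word)
    have "0 \<notin># m" using p(3) by (auto simp: R_def)
    then show "p \<in> Q" using p m by (auto simp: Q_def tableaux_def factorizations_def)
  qed
  also have "card (\<Union>T\<in>R. factorizations \<mu> \<nu> T) = (\<Sum>T\<in>R. card (factorizations \<mu> \<nu> T))"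
    using finR by (intro card_UN_disjoint) (auto simp: finite_factorizations, auto simp: factorizations_def)
  also have "int \<dots> = (\<Sum>T\<in>R. ?c (map length T))"
    using assms by (simp add: card_factorizations R_def)
  also have "\<dots> = (\<Sum>\<kappa>\<in>map length ` R. \<Sum>T | T \<in> R \<and> map length T = \<kappa>. ?c (map length T))"
    using finR by (rule sum.image_gen)
  also have "\<dots> = (\<Sum>\<kappa>\<in>map length ` R. ?c \<kappa> * schur \<kappa> m)"
  proof (rule sum.cong[OF refl])
    fix \<kappa> assume "\<kappa> \<in> map length ` R"
    then have "is_partition \<kappa>" by (auto simp: R_def is_partition_shape)
    moreover have "{T. T \<in> R \<and> map length T = \<kappa>} = A \<kappa> m" by (auto simp: R_def A_def tableaux_def)
    ultimately show "(\<Sum>T | T \<in> R \<and> map length T = \<kappa>. ?c (map length T)) = ?c \<kappa> * schur \<kappa> m"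
      by (simp add: schur_eq A_def[symmetric]) (simp add: A_def tableaux_def)
  qed
  also have "\<dots> = (\<Sum>\<kappa> | ?c \<kappa> \<noteq> 0. ?c \<kappa> * schur \<kappa> m)"
  proof (rule sum.mono_neutral_cong)
    fix \<kappa> assume \<kappa>: "\<kappa> \<in> {\<kappa>. ?c \<kappa> \<noteq> 0} - map length ` R"
    then have "is_partition \<kappa>" by (auto simp: structure_constant_def)
    moreover have "{T \<in> tableaux \<kappa>. mset (tableau_word T) = m} = {}"
      using \<kappa> by (auto simp: R_def tableaux_def)
    ultimately show "?c \<kappa> * schur \<kappa> m = 0"
      by (simp only: schur_eq card.empty of_nat_0 mult_zero_right)
  qed (use finR finite_structure_constant in auto)
  finally show ?thesis .
qed

text \<open>Any other expansion differs by a finite relation between Schur functions, which linear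
  independence makes trivial.\<close>

lemma lr_eq_structure_constant:
  assumes "is_partition \<mu>" "is_partition \<nu>"
  shows "lr \<mu> \<nu> = structure_constant \<mu> \<nu>"
  unfolding lr_def
proof (rule the_equality)
  let ?c = "structure_constant \<mu> \<nu>"
  show c: "finite {la. ?c la \<noteq> 0} \<and> {la. ?c la \<noteq> 0} \<subseteq> {la. is_partition la} \<and>
     series_mult (schur \<mu>) (schur \<nu>) = (\<lambda>m. \<Sum>la | ?c la \<noteq> 0. ?c la * schur la m)"
    using finite_structure_constant schur_product[OF assms]
    by (auto simp: fun_eq_iff) (auto simp: structure_constant_def split: if_splits)
  fix c assume c': "finite {la. c la \<noteq> 0} \<and> {la. c la \<noteq> 0} \<subseteq> {la. is_partition la} \<and>
     series_mult (schur \<mu>) (schur \<nu>) = (\<lambda>m. \<Sum>la | c la \<noteq> 0. c la * schur la m)"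
  define S where "S = {la. ?c la \<noteq> 0} \<union> {la. c la \<noteq> 0}"
  have S: "finite S" "\<And>\<kappa>. \<kappa> \<in> S \<Longrightarrow> is_partition \<kappa>" using c c' by (auto simp: S_def)
  have "(\<Sum>\<kappa>\<in>S. (c \<kappa> - ?c \<kappa>) * schur \<kappa> m) = 0" for m
  proof -
    have "(\<Sum>\<kappa>\<in>S. c \<kappa> * schur \<kappa> m) = (\<Sum>\<kappa> | c \<kappa> \<noteq> 0. c \<kappa> * schur \<kappa> m)"
      using S(1) by (intro sum.mono_neutral_right) (auto simp: S_def)
    moreover have "(\<Sum>\<kappa>\<in>S. ?c \<kappa> * schur \<kappa> m) = (\<Sum>\<kappa> | ?c \<kappa> \<noteq> 0. ?c \<kappa> * schur \<kappa> m)"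
      using S(1) by (intro sum.mono_neutral_right) (auto simp: S_def)
    moreover have "(\<Sum>\<kappa> | c \<kappa> \<noteq> 0. c \<kappa> * schur \<kappa> m) = (\<Sum>\<kappa> | ?c \<kappa> \<noteq> 0. ?c \<kappa> * schur \<kappa> m)"
      using c c' by (metis (no_types, lifting))
    ultimately show ?thesis by (simp add: left_diff_distrib sum_subtractf)
  qed
  then have "c \<kappa> - ?c \<kappa> = 0" if "\<kappa> \<in> S" for \<kappa>
    using schur_independent[of S "\<lambda>\<kappa>. c \<kappa> - ?c \<kappa>" \<kappa>] S that by blast
  then have "c \<kappa> = ?c \<kappa>" for \<kappa>
    by (cases "\<kappa> \<in> S") (simp_all, simp add: S_def)
  then show "c = ?c" by blast
qed

section \<open>Convergence and symmetrization\<close>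

lemma abs_summable_imp_summable_on:
  fixes f :: "'a \<Rightarrow> 'b::{banach, second_countable_topology}"
  shows "Infinite_Set_Sum.abs_summable_on f A \<Longrightarrow> f summable_on A"
  using abs_summable_equivalent abs_summable_summable by blast

lemma summable_on_sum_infsum:
  fixes f :: "'i \<Rightarrow> 'a \<Rightarrow> 'b::{t2_space, topological_comm_monoid_add}"
  assumes "finite I" "\<And>i. i \<in> I \<Longrightarrow> f i summable_on A"
  shows "(\<lambda>x. \<Sum>i\<in>I. f i x) summable_on A \<and> infsum (\<lambda>x. \<Sum>i\<in>I. f i x) A = (\<Sum>i\<in>I. infsum (f i) A)"
  using assms
proof (induction I)
  case (insert i I)
  then show ?case using summable_on_add[of "f i" A "\<lambda>x. \<Sum>i\<in>I. f i x"]
      infsum_add[of "f i" A "\<lambda>x. \<Sum>i\<in>I. f i x"] by simp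
qed simp

text \<open>Among the boxes with the largest entry take one with \<open>i + j\<close> maximal. A box
  below would have a larger entry; a box to the right would have the same entry and a larger
  \<open>i + j\<close>.\<close>

lemma exists_maximal_corner:
  assumes "M \<in> SSYT (la, [])" "diagram la \<noteq> {}"
  obtains i j where "(i, j) \<in> diagram la" "\<And>b. b \<in> diagram la \<Longrightarrow> M b \<le> M (i, j)"
    "(i + 1, j) \<notin> diagram la" "(i, j + 1) \<notin> diagram la"
proof -
  have ss: "semistandard (la, []) M" using assms(1) by (simp add: SSYT_def SSYT_over_def)
  define m where "m = Max (M ` diagram la)"
  define C where "C = {b \<in> diagram la. M b = m}"
  have m: "m \<in> M ` diagram la" "\<And>b. b \<in> diagram la \<Longrightarrow> M b \<le> m"
    using assms(2) by (simp_all add: m_def)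
  then have C: "finite C" "C \<noteq> {}" by (auto simp: C_def)
  define q where "q = Max ((\<lambda>(i, j). i + j) ` C)"
  have q: "q \<in> (\<lambda>(i, j). i + j) ` C" "\<And>i j. (i, j) \<in> C \<Longrightarrow> i + j \<le> q"
    using C by (auto simp: q_def intro: Max_ge)
  from q(1) obtain i j where ij: "(i, j) \<in> C" "i + j = q" by auto
  then have d: "(i, j) \<in> diagram la" "M (i, j) = m" by (auto simp: C_def)
  have "(i + 1, j) \<notin> diagram la"
  proof
    assume a: "(i + 1, j) \<in> diagram la"
    then have "M (i, j) < M (i + 1, j)" using ss d(1) by (auto simp: semistandard_def)
    then show False using m(2)[OF a] d(2) by simp
  qed
  moreover have "(i, j + 1) \<notin> diagram la"
  proof
    assume a: "(i, j + 1) \<in> diagram la"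
    then have "M (i, j) \<le> M (i, j + 1)" using ss d(1) by (auto simp: semistandard_def)
    then have "(i, j + 1) \<in> C" using m(2)[OF a] d(2) a by (simp add: C_def)
    then show False using q(2) ij(2) by fastforce
  qed
  ultimately show ?thesis using that[OF d(1)] m(2) d(2) by simp
qed

lemma abs_summable_powr_prod:
  assumes "finite D" "e > 0"
  shows "Infinite_Set_Sum.abs_summable_on (\<lambda>M. \<Prod>b\<in>D. real (M b) powr (-1 - e)) (D \<rightarrow>\<^sub>E {1..})"
proof -
  have "summable (\<lambda>n. norm (real n powr (-1 - e)))"
    using assms(2) summable_real_powr_iff[of "-1 - e"] by simp
  then have "Infinite_Set_Sum.abs_summable_on (\<lambda>n. real n powr (-1 - e)) UNIV"
    by (simp add: abs_summable_on_nat_iff')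
  then have "Infinite_Set_Sum.abs_summable_on (\<lambda>n. real n powr (-1 - e)) {1..}"
    by (rule Infinite_Set_Sum.abs_summable_on_subset) simp
  then show ?thesis using assms(1) by (intro abs_summable_on_prod_PiE) auto
qed

text \<open>The largest entry can be found at a corner, where the exponent exceeds 1 by at least
  \<open>\<epsilon>\<close>. This surplus is shared among all boxes, whose entries are no larger, so
  the series is dominated by a product of convergent series in the single entries.\<close>

lemma abs_summable_schur_zeta:
  fixes z :: "box \<Rightarrow> complex"
  assumes ge: "\<And>b. b \<in> diagram la \<Longrightarrow> Re (z b) \<ge> 1"
    and corner: "\<And>i j. (i, j) \<in> diagram la \<Longrightarrow> (i + 1, j) \<notin> diagram la \<Longrightarrow>
      (i, j + 1) \<notin> diagram la \<Longrightarrow> Re (z (i, j)) > 1"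
  shows "Infinite_Set_Sum.abs_summable_on (\<lambda>M. \<Prod>b\<in>diagram la. of_nat (M b) powr (- z b)) (SSYT (la, []))"
proof -
  let ?D = "diagram la"
  define S where "S = {b \<in> ?D. Re (z b) > 1}"
  \<comment> \<open>The inserted 1 keeps the minimum defined and positive when \<open>S\<close> is
    empty.\<close>
  define \<epsilon> where "\<epsilon> = Min (insert 1 ((\<lambda>b. Re (z b) - 1) ` S))"
  have finS: "finite S" by (simp add: S_def)
  have \<epsilon>: "\<epsilon> > 0" "\<And>b. b \<in> S \<Longrightarrow> 1 + \<epsilon> \<le> Re (z b)"
  proof -
    show "\<epsilon> > 0" using finS by (auto simp: \<epsilon>_def S_def)
    fix b assume "b \<in> S"
    then have "\<epsilon> \<le> Re (z b) - 1" unfolding \<epsilon>_def using finS by (intro Min_le) auto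
    then show "1 + \<epsilon> \<le> Re (z b)" by simp
  qed
  \<comment> \<open>The added 1 covers the empty diagram; what is used is
    \<open>e * card ?D \<le> \<epsilon>\<close>.\<close>
  define e where "e = \<epsilon> / (card ?D + 1)"
  have e: "e > 0" using \<epsilon>(1) by (simp add: e_def)
  have "Infinite_Set_Sum.abs_summable_on (\<lambda>M. \<Prod>b\<in>?D. real (M b) powr (-1 - e)) (SSYT (la, []))"
    by (rule Infinite_Set_Sum.abs_summable_on_subset[OF abs_summable_powr_prod[OF finite_diagram e]])
      (auto simp: SSYT_def SSYT_over_def fillings_def)
  then show ?thesis
  proof (rule Infinite_Set_Sum.abs_summable_on_comparison_test)
    fix M assume M: "M \<in> SSYT (la, [])"
    have pos: "1 \<le> M b" if "b \<in> ?D" for b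
      using M that by (auto simp: SSYT_def SSYT_over_def fillings_def dest: PiE_mem)
    have n: "norm (of_nat (M b) powr (- z b)) = real (M b) powr (- Re (z b))" if "b \<in> ?D" for b
      using norm_powr_real_powr[of "of_nat (M b)" "- z b"] by simp
    have "(\<Prod>b\<in>?D. real (M b) powr (- Re (z b))) \<le> (\<Prod>b\<in>?D. real (M b) powr (-1 - e))"
    proof (cases "?D = {}")
      case False
      obtain i j where ij: "(i, j) \<in> ?D" "\<And>b. b \<in> ?D \<Longrightarrow> M b \<le> M (i, j)"
        "(i + 1, j) \<notin> ?D" "(i, j + 1) \<notin> ?D"
        using exists_maximal_corner[OF M False] by blast
      let ?c = "(i, j)"
      have cS: "?c \<in> S" using ij corner by (simp add: S_def)
      let ?E = "\<lambda>b. if b = ?c then real (M ?c) powr (-\<epsilon>) else 1"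
      have "(\<Prod>b\<in>?D. real (M b) powr (- Re (z b))) \<le> (\<Prod>b\<in>?D. real (M b) powr (-1) * ?E b)"
      proof (rule prod_mono)
        fix b assume b: "b \<in> ?D"
        have "real (M b) powr (- Re (z b)) \<le> real (M b) powr (-1)"
          using pos[OF b] ge[OF b] by (intro powr_mono) auto
        moreover have "real (M ?c) powr (- Re (z ?c)) \<le> real (M ?c) powr (-1 - \<epsilon>)"
          using pos[OF ij(1)] \<epsilon>(2)[OF cS] by (intro powr_mono) auto
        moreover have "real (M ?c) powr (-1 - \<epsilon>) = real (M ?c) powr (-1) * real (M ?c) powr (-\<epsilon>)"
          by (simp only: powr_add[symmetric]) simp
        ultimately show "0 \<le> real (M b) powr (- Re (z b)) \<and>
            real (M b) powr (- Re (z b)) \<le> real (M b) powr (-1) * ?E b"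
          by (cases "b = ?c") simp_all
      qed
      also have "\<dots> = (\<Prod>b\<in>?D. real (M b) powr (-1)) * real (M ?c) powr (-\<epsilon>)"
        unfolding prod.distrib using ij(1) by (simp only: prod.delta finite_diagram if_True)
      also have "\<dots> \<le> (\<Prod>b\<in>?D. real (M b) powr (-1)) * (\<Prod>b\<in>?D. real (M b) powr (-e))"
      proof (rule mult_left_mono)
        have "real (M ?c) powr (-\<epsilon>) \<le> real (M ?c) powr (- e * card ?D)"
          using pos[OF ij(1)] \<epsilon>(1) by (intro powr_mono) (auto simp: e_def field_simps)
        also have "\<dots> = (\<Prod>b\<in>?D. real (M ?c) powr (-e))"
          using pos[OF ij(1)] by (simp add: powr_realpow[symmetric] powr_powr powr_power mult.commute)
        also have "\<dots> \<le> (\<Prod>b\<in>?D. real (M b) powr (-e))"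
          using e ij(2) pos by (intro prod_mono conjI powr_mono2') (auto simp: Suc_le_eq)
        finally show "real (M ?c) powr (-\<epsilon>) \<le> (\<Prod>b\<in>?D. real (M b) powr (-e))" .
      qed (simp add: prod_nonneg)
      also have "\<dots> = (\<Prod>b\<in>?D. real (M b) powr (-1 - e))"
        by (simp only: prod.distrib[symmetric] powr_add[symmetric]) simp
      finally show ?thesis .
    qed simp
    then show "norm (\<Prod>b\<in>?D. of_nat (M b) powr (- z b)) \<le> norm (\<Prod>b\<in>?D. real (M b) powr (-1 - e))"
      unfolding prod_norm[symmetric] using n by (simp cong: prod.cong)
  qed
qed

lemma countable_SSYT: "countable (SSYT \<delta>)"
proof (rule countable_subset)
  show "SSYT \<delta> \<subseteq> boxes \<delta> \<rightarrow>\<^sub>E {1..}" by (auto simp: SSYT_def SSYT_over_def fillings_def)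
qed (simp add: countable_PiE)

lemma schur_zeta_evaluate:
  "schur_zeta (la, []) (evaluate la x w) =
     (\<Sum>\<^sub>\<infinity>M\<in>SSYT (la, []). \<Prod>b\<in>diagram la. of_nat (M b) powr (- x (w b)))"
  by (simp add: schur_zeta_def evaluate_def cong: prod.cong)

section \<open>Arrangements of the variables\<close>

definition star_vars :: "nat list \<Rightarrow> nat list \<Rightarrow> box \<Rightarrow> svar" where
  "star_vars \<mu> \<nu> = star_filling \<mu> \<nu> (s_vars \<mu>) (t_vars \<nu>)"

lemma star_vars_low: "is_partition \<nu> \<Longrightarrow> b \<in> diagram \<mu> \<Longrightarrow> star_vars \<mu> \<nu> (low_box \<nu> b) = SVar b"
  and star_vars_right: "is_partition \<nu> \<Longrightarrow> b \<in> diagram \<nu> \<Longrightarrow> star_vars \<mu> \<nu> (right_box \<mu> b) = TVar b"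
  by (simp_all add: star_vars_def star_filling_low star_filling_right s_vars_def t_vars_def)

lemma bij_star_vars:
  assumes "is_partition \<nu>"
  shows "bij_betw (star_vars \<mu> \<nu>) (boxes (star \<mu> \<nu>)) (SVar ` diagram \<mu> \<union> TVar ` diagram \<nu>)"
  unfolding bij_betw_def boxes_star[OF assms]
proof
  show "inj_on (star_vars \<mu> \<nu>) (low_box \<nu> ` diagram \<mu> \<union> right_box \<mu> ` diagram \<nu>)"
    by (rule inj_onI, elim UnE imageE)
      (simp_all add: star_vars_low[OF assms] star_vars_right[OF assms])
  show "star_vars \<mu> \<nu> ` (low_box \<nu> ` diagram \<mu> \<union> right_box \<mu> ` diagram \<nu>) =
      SVar ` diagram \<mu> \<union> TVar ` diagram \<nu>"
    by (simp add: image_Un image_image star_vars_low[OF assms] star_vars_right[OF assms]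
        cong: image_cong)
qed

lemma bij_rearranged:
  assumes "is_partition \<nu>"
  shows "bij_betw (rearranged (star \<mu> \<nu>) (star_vars \<mu> \<nu>) L)
    (diagram (rect_shape (star \<mu> \<nu>) L)) (SVar ` diagram \<mu> \<union> TVar ` diagram \<nu>)"
proof -
  have "bij_betw (star_vars \<mu> \<nu> \<circ> inv_into (boxes (star \<mu> \<nu>)) (rho (star \<mu> \<nu>) L))
    (diagram (rect_shape (star \<mu> \<nu>) L)) (SVar ` diagram \<mu> \<union> TVar ` diagram \<nu>)"
    using bij_betw_inv_into[OF bij_rho] bij_star_vars[OF assms] by (rule bij_betw_trans)
  then show ?thesis by (rule bij_betw_cong[THEN iffD1, rotated]) (simp add: rearranged_def)
qed

text \<open>\<open>rho\<close> carries the entries to the rectification and the variables to their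
  rearranged places at the same time, so the product over the boxes is only reindexed.\<close>

lemma prod_rearranged:
  fixes f :: "nat \<Rightarrow> svar \<Rightarrow> 'a::comm_monoid_mult" and \<mu> \<nu> :: "nat list"
    and M N :: "box \<Rightarrow> nat"
  assumes "is_partition \<nu>"
  defines "L \<equiv> star_filling \<mu> \<nu> M N"
  shows "(\<Prod>b\<in>diagram \<mu>. f (M b) (SVar b)) * (\<Prod>b\<in>diagram \<nu>. f (N b) (TVar b)) =
    (\<Prod>c\<in>diagram (rect_shape (star \<mu> \<nu>) L).
       f (rect_tableau (star \<mu> \<nu>) L c) (rearranged (star \<mu> \<nu>) (star_vars \<mu> \<nu>) L c))"
proof -
  have "(\<Prod>b\<in>diagram \<mu>. f (M b) (SVar b)) =
      (\<Prod>b\<in>low_box \<nu> ` diagram \<mu>. f (L b) (star_vars \<mu> \<nu> b))"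
    by (simp add: prod.reindex[OF inj_low_box] L_def star_filling_low[OF assms(1)]
        star_vars_low[OF assms(1)])
  moreover have "(\<Prod>b\<in>diagram \<nu>. f (N b) (TVar b)) =
      (\<Prod>b\<in>right_box \<mu> ` diagram \<nu>. f (L b) (star_vars \<mu> \<nu> b))"
    by (simp add: prod.reindex[OF inj_right_box] L_def star_filling_right[OF assms(1)]
        star_vars_right[OF assms(1)])
  ultimately have "(\<Prod>b\<in>diagram \<mu>. f (M b) (SVar b)) * (\<Prod>b\<in>diagram \<nu>. f (N b) (TVar b)) =
      (\<Prod>b\<in>boxes (star \<mu> \<nu>). f (L b) (star_vars \<mu> \<nu> b))"
    unfolding boxes_star[OF assms(1)]
    by (simp add: prod.union_disjoint boxes_star_disjoint)
  also have "\<dots> = (\<Prod>b\<in>boxes (star \<mu> \<nu>). f (rect_tableau (star \<mu> \<nu>) L (rho (star \<mu> \<nu>) L b))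
       (rearranged (star \<mu> \<nu>) (star_vars \<mu> \<nu>) L (rho (star \<mu> \<nu>) L b)))"
    by (simp add: rect_tableau_rho rearranged_rho)
  also have "\<dots> = (\<Prod>c\<in>diagram (rect_shape (star \<mu> \<nu>) L).
       f (rect_tableau (star \<mu> \<nu>) L c) (rearranged (star \<mu> \<nu>) (star_vars \<mu> \<nu>) L c))"
    by (rule prod.reindex_bij_betw[OF bij_rho])
  finally show ?thesis .
qed

lemma rearranged_fixed_column:
  assumes "is_partition \<mu>" "is_partition \<nu>" "\<nu> \<noteq> []" "L \<in> SSYT (star \<mu> \<nu>)"
    and "conjugate \<mu> 2 + length \<nu> \<le> i" "i \<le> length \<mu>"
  defines "la \<equiv> rect_shape (star \<mu> \<nu>) L"
  shows "(length la - length \<mu> + i, 1) \<in> diagram la"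
    "rearranged (star \<mu> \<nu>) (star_vars \<mu> \<nu>) L (length la - length \<mu> + i, 1) = SVar (i, 1)"
proof -
  have "1 \<le> i" using assms(3,5) by (cases \<nu>) auto
  then have "(i, 1) \<in> diagram \<mu>"
    using assms(6) is_partition_nth(1)[OF assms(1), of "i - 1"] by (auto simp: diagram_iff Suc_le_eq)
  then have b: "low_box \<nu> (i, 1) \<in> boxes (star \<mu> \<nu>)" "star_vars \<mu> \<nu> (low_box \<nu> (i, 1)) = SVar (i, 1)"
    using boxes_star[OF assms(2)] star_vars_low[OF assms(2)] by auto
  note r = rho_first_column(2)[OF assms(1-6), folded la_def]
  show "(length la - length \<mu> + i, 1) \<in> diagram la"
    using rho_value(1)[OF b(1), of L] r by (simp add: la_def)
  show "rearranged (star \<mu> \<nu>) (star_vars \<mu> \<nu>) L (length la - length \<mu> + i, 1) = SVar (i, 1)"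
    using rearranged_rho[OF b(1), of "star_vars \<mu> \<nu>" L] r b(2) by simp
qed

lemma rearranged_fixed_row:
  assumes "is_partition \<mu>" "is_partition \<nu>" "\<mu> \<noteq> []" "L \<in> SSYT (star \<mu> \<nu>)"
    and "part \<nu> 2 + part \<mu> 1 \<le> j" "j \<le> part \<nu> 1"
  defines "la \<equiv> rect_shape (star \<mu> \<nu>) L"
  shows "(1, part la 1 - part \<nu> 1 + j) \<in> diagram la"
    "rearranged (star \<mu> \<nu>) (star_vars \<mu> \<nu>) L (1, part la 1 - part \<nu> 1 + j) = TVar (1, j)"
proof -
  have "1 \<le> j" using assms(3,5) is_partition_nth(1)[OF assms(1), of 0]
    by (auto simp: part_def Suc_le_eq split: if_splits)
  then have "(1, j) \<in> diagram \<nu>" using assms(6) by (simp add: diagram_def)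
  then have b: "right_box \<mu> (1, j) \<in> boxes (star \<mu> \<nu>)" "star_vars \<mu> \<nu> (right_box \<mu> (1, j)) = TVar (1, j)"
    using boxes_star[OF assms(2)] star_vars_right[OF assms(2)] by auto
  note r = rho_first_row(2)[OF assms(1-6), folded la_def]
  show "(1, part la 1 - part \<nu> 1 + j) \<in> diagram la"
    using rho_value(1)[OF b(1), of L] r by (simp add: la_def)
  show "rearranged (star \<mu> \<nu>) (star_vars \<mu> \<nu>) L (1, part la 1 - part \<nu> 1 + j) = TVar (1, j)"
    using rearranged_rho[OF b(1), of "star_vars \<mu> \<nu>" L] r b(2) by simp
qed

text \<open>Each variable occurs once in each arrangement, so passing from one to the other through
  the boxes is a permutation. An excluded variable lies in the same box of both, as its place is
  determined by the shape, and is therefore fixed.\<close>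

lemma rearranged_permuted:
  assumes "is_partition \<mu>" "is_partition \<nu>" "\<mu> \<noteq> []" "\<nu> \<noteq> []"
    and "L \<in> SSYT (star \<mu> \<nu>)" "L' \<in> SSYT (star \<mu> \<nu>)"
    and "rect_shape (star \<mu> \<nu>) L = la" "rect_shape (star \<mu> \<nu>) L' = la"
  obtains \<tau> where "\<tau> permutes permuted_vars \<mu> \<nu>"
    "\<And>c. c \<in> diagram la \<Longrightarrow> rearranged (star \<mu> \<nu>) (star_vars \<mu> \<nu>) L' c =
       \<tau> (rearranged (star \<mu> \<nu>) (star_vars \<mu> \<nu>) L c)"
proof -
  let ?r = "rearranged (star \<mu> \<nu>) (star_vars \<mu> \<nu>)"
  let ?V = "SVar ` diagram \<mu> \<union> TVar ` diagram \<nu>"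
  let ?inv = "inv_into (diagram la) (?r L)"
  have bij: "bij_betw (?r L) (diagram la) ?V" "bij_betw (?r L') (diagram la) ?V"
    using bij_rearranged[OF assms(2), of \<mu> L] bij_rearranged[OF assms(2), of \<mu> L']
    unfolding assms(7,8) .
  define \<tau> where "\<tau> y = (if y \<in> ?V then ?r L' (?inv y) else y)" for y
  have inv: "?inv (?r L c) = c" if "c \<in> diagram la" for c
    using bij(1) that by (simp add: bij_betw_def inv_into_f_f)
  have "bij_betw (?r L' \<circ> ?inv) ?V ?V"
    using bij_betw_inv_into[OF bij(1)] bij(2) by (rule bij_betw_trans)
  then have "bij_betw \<tau> ?V ?V" by (rule bij_betw_cong[THEN iffD1, rotated]) (simp add: \<tau>_def)
  then have "\<tau> permutes ?V" by (rule bij_imp_permutes) (simp add: \<tau>_def)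
  moreover have "\<tau> y = y" if y: "y \<in> ?V - permuted_vars \<mu> \<nu>" for y
  proof -
    have "\<exists>c\<in>diagram la. ?r L c = y \<and> ?r L' c = y"
    proof -
      consider i where "y = SVar (i, 1)" "conjugate \<mu> 2 + conjugate \<nu> 1 \<le> i" "i \<le> conjugate \<mu> 1"
        | j where "y = TVar (1, j)" "part \<nu> 2 + part \<mu> 1 \<le> j" "j \<le> part \<nu> 1"
        using y by (auto simp: permuted_vars_def)
      then show ?thesis
      proof cases
        case 1
        then have i: "conjugate \<mu> 2 + length \<nu> \<le> i" "i \<le> length \<mu>"
          using conjugate_1 assms(1,2) by simp_all
        show ?thesis
          using rearranged_fixed_column[OF assms(1,2,4,5) i, unfolded assms(7)]
            rearranged_fixed_column[OF assms(1,2,4,6) i, unfolded assms(8)] 1(1)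
          by (intro bexI[of _ "(length la - length \<mu> + i, 1)"]) simp_all
      next
        case 2
        then show ?thesis
          using rearranged_fixed_row[OF assms(1,2,3,5) 2(2,3), unfolded assms(7)]
            rearranged_fixed_row[OF assms(1,2,3,6) 2(2,3), unfolded assms(8)] 2(1)
          by (intro bexI[of _ "(1, part la 1 - part \<nu> 1 + j)"]) simp_all
      qed
    qed
    then obtain c where c: "c \<in> diagram la" "?r L c = y" "?r L' c = y" by blast
    then show ?thesis using y inv[OF c(1)] by (simp add: \<tau>_def)
  qed
  ultimately have "\<tau> permutes permuted_vars \<mu> \<nu>" by (rule permutes_superset)
  moreover have "?r L' c = \<tau> (?r L c)" if "c \<in> diagram la" for c
    using inv[OF that] bij_betw_apply[OF bij(1) that] by (simp add: \<tau>_def)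
  ultimately show ?thesis using that by blast
qed

text \<open>Replacing \<sigma> by its composition with the permutation between the two arrangements
  only reorders the sum.\<close>

lemma sum_permuted_rearranged:
  fixes f :: "box \<Rightarrow> svar \<Rightarrow> 'a::comm_semiring_1"
  assumes "is_partition \<mu>" "is_partition \<nu>" "\<mu> \<noteq> []" "\<nu> \<noteq> []"
    and "L \<in> SSYT (star \<mu> \<nu>)" "L' \<in> SSYT (star \<mu> \<nu>)"
    and "rect_shape (star \<mu> \<nu>) L = la" "rect_shape (star \<mu> \<nu>) L' = la"
  shows "(\<Sum>\<sigma> | \<sigma> permutes permuted_vars \<mu> \<nu>. \<Prod>c\<in>diagram la.
        f c (\<sigma> (rearranged (star \<mu> \<nu>) (star_vars \<mu> \<nu>) L c))) =
      (\<Sum>\<sigma> | \<sigma> permutes permuted_vars \<mu> \<nu>. \<Prod>c\<in>diagram la.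
        f c (\<sigma> (rearranged (star \<mu> \<nu>) (star_vars \<mu> \<nu>) L' c)))"
proof -
  obtain \<tau> where \<tau>: "\<tau> permutes permuted_vars \<mu> \<nu>"
    "\<And>c. c \<in> diagram la \<Longrightarrow> rearranged (star \<mu> \<nu>) (star_vars \<mu> \<nu>) L' c =
       \<tau> (rearranged (star \<mu> \<nu>) (star_vars \<mu> \<nu>) L c)"
    using rearranged_permuted[OF assms] by blast
  show ?thesis
    unfolding sum_permutations_compose_right[OF \<tau>(1), of "\<lambda>\<sigma>. \<Prod>c\<in>diagram la.
        f c (\<sigma> (rearranged (star \<mu> \<nu>) (star_vars \<mu> \<nu>) L c))"]
    by (simp add: \<tau>(2) cong: prod.cong)
qed

section \<open>Fibers of the rectification\<close>

lemma rect_star_filling: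
  assumes "is_partition \<mu>" "is_partition \<nu>" "M \<in> SSYT (\<mu>, [])" "N \<in> SSYT (\<nu>, [])"
  defines "T \<equiv> insert_word (tableau_word (tableau_rows \<nu> N)) (tableau_rows \<mu> M)"
  shows "rect (star \<mu> \<nu>) (star_filling \<mu> \<nu> M N) = (map length T, rows_filling T)"
proof -
  let ?L = "star_filling \<mu> \<nu> M N"
  have cong: "tableau_rows la P = tableau_rows la Q" if "\<And>b. b \<in> diagram la \<Longrightarrow> P b = Q b"
    for la and P Q :: "box \<Rightarrow> nat"
    using that
    by (intro nth_equalityI) (auto simp: nth_tableau_rows diagram_iff simp del: upt_Suc)
  have "tableau_rows \<mu> (?L \<circ> low_box \<nu>) = tableau_rows \<mu> M"
    by (rule cong) (simp add: star_filling_low[OF assms(2)])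
  moreover have "tableau_rows \<nu> (?L \<circ> right_box \<mu>) = tableau_rows \<nu> N"
    by (rule cong) (simp add: star_filling_right[OF assms(2)])
  moreover have "is_tableau (tableau_rows \<mu> M)"
    using bij_betw_apply[OF bij_tableau_rows[OF assms(1)] assms(3)] by (simp add: tableaux_def)
  ultimately have "P_tableau (row_word (star \<mu> \<nu>) ?L) = T"
    by (simp add: row_word_star[OF assms(2)] P_tableau_append T_def)
  then show ?thesis by (simp add: rect_eq)
qed

text \<open>As lists of rows, the pairs in the fiber are the factorizations of the tableau
  \<open>P\<close>. Entries of the factors are positive automatically, since insertion preserves
  content.\<close>

lemma card_rect_fibre:
  assumes "is_partition \<mu>" "is_partition \<nu>" "is_partition la" "P \<in> SSYT (la, [])"
  defines "F \<equiv> {(M, N). M \<in> SSYT (\<mu>, []) \<and> N \<in> SSYT (\<nu>, []) \<and>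
      rect (star \<mu> \<nu>) (star_filling \<mu> \<nu> M N) = (la, P)}"
  shows "finite F" "int (card F) = lr \<mu> \<nu> la"
proof -
  let ?T = "tableau_rows la P"
  let ?h = "map_prod (tableau_rows \<mu>) (tableau_rows \<nu>)"
  have T: "?T \<in> tableaux la" using bij_betw_apply[OF bij_tableau_rows[OF assms(3)] assms(4)] .
  have ext: "P \<in> extensional (diagram la)"
    using assms(4) by (auto simp: SSYT_def SSYT_over_def fillings_def PiE_def)
  have b: "bij_betw ?h (SSYT (\<mu>, []) \<times> SSYT (\<nu>, [])) (tableaux \<mu> \<times> tableaux \<nu>)"
    using bij_tableau_rows assms(1,2) by (intro bij_betw_map_prod) auto
  have iff: "p \<in> F \<longleftrightarrow> ?h p \<in> factorizations \<mu> \<nu> ?T"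
    if p: "p \<in> SSYT (\<mu>, []) \<times> SSYT (\<nu>, [])" for p
  proof -
    obtain M N where MN: "p = (M, N)" "M \<in> SSYT (\<mu>, [])" "N \<in> SSYT (\<nu>, [])" using p by auto
    let ?X = "insert_word (tableau_word (tableau_rows \<nu> N)) (tableau_rows \<mu> M)"
    have "p \<in> F \<longleftrightarrow> map length ?X = la \<and> rows_filling ?X = P"
      using MN rect_star_filling[OF assms(1,2) MN(2,3)] by (auto simp: F_def)
    also have "\<dots> \<longleftrightarrow> ?X = ?T"
      using tableau_rows_rows_filling[of ?X] rows_filling_tableau_rows[OF ext] by auto
    also have "\<dots> \<longleftrightarrow> ?h p \<in> factorizations \<mu> \<nu> ?T"
      using MN bij_betw_apply[OF bij_tableau_rows[OF assms(1)] MN(2)]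
        bij_betw_apply[OF bij_tableau_rows[OF assms(2)] MN(3)]
      by (simp add: factorizations_def tableaux_def)
    finally show ?thesis .
  qed
  have sub: "factorizations \<mu> \<nu> ?T \<subseteq> tableaux \<mu> \<times> tableaux \<nu>"
  proof
    fix q assume "q \<in> factorizations \<mu> \<nu> ?T"
    then obtain M N where q: "q = (M, N)" "is_tableau M" "map length M = \<mu>" "is_tableau N"
        "map length N = \<nu>" "insert_word (tableau_word N) M = ?T" by (auto simp: factorizations_def)
    have "mset (tableau_word ?T) = mset (tableau_word M) + mset (tableau_word N)"
      using mset_insert_word[OF q(2), of "tableau_word N"] q(6) by simp
    then have "set (tableau_word ?T) = set (tableau_word M) \<union> set (tableau_word N)"
      by (metis set_mset_mset set_mset_union)
    then show "q \<in> tableaux \<mu> \<times> tableaux \<nu>" using q T by (auto simp: tableaux_def)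
  qed
  have "F = {p \<in> SSYT (\<mu>, []) \<times> SSYT (\<nu>, []). p \<in> F}" by (auto simp: F_def)
  moreover have "bij_betw ?h {p \<in> SSYT (\<mu>, []) \<times> SSYT (\<nu>, []). p \<in> F}
      {q \<in> tableaux \<mu> \<times> tableaux \<nu>. q \<in> factorizations \<mu> \<nu> ?T}"
    by (rule bij_betw_Collect[OF b]) (use iff in blast)
  moreover have "{q \<in> tableaux \<mu> \<times> tableaux \<nu>. q \<in> factorizations \<mu> \<nu> ?T} = factorizations \<mu> \<nu> ?T"
    using sub by blast
  ultimately have h: "bij_betw ?h F (factorizations \<mu> \<nu> ?T)" by simp
  then show "finite F" using finite_factorizations bij_betw_finite by blast
  have "int (card (factorizations \<mu> \<nu> ?T)) = structure_constant \<mu> \<nu> la"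
    using card_factorizations[OF assms(2), of ?T \<mu>] T by (simp add: tableaux_def)
  then show "int (card F) = lr \<mu> \<nu> la"
    using bij_betw_same_card[OF h] by (simp add: lr_eq_structure_constant[OF assms(1,2)])
qed

theorem theorem1p1:
  fixes \<mu> \<nu> :: "nat list"
    and s t :: "nat \<times> nat \<Rightarrow> complex"
    and G :: "nat list set"
    and u :: "nat list \<Rightarrow> nat \<times> nat \<Rightarrow> svar"
  assumes "is_partition \<mu>" and "\<mu> \<noteq> []"
    and "is_partition \<nu>" and "\<nu> \<noteq> []"
    and "s \<in> fillings (normal_shape \<mu>) UNIV"
    and "t \<in> fillings (normal_shape \<nu>) UNIV"
    and "\<And>i. conjugate \<mu> 2 + conjugate \<nu> 1 \<le> i \<Longrightarrow> i \<le> conjugate \<mu> 1 - 1 \<Longrightarrow> Re (s (i, 1)) \<ge> 1"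
    and "\<And>j. part \<nu> 2 + part \<mu> 1 \<le> j \<Longrightarrow> j \<le> part \<nu> 1 - 1 \<Longrightarrow> Re (t (1, j)) \<ge> 1"
    and "\<And>i j. (i, j) \<in> diagram \<mu> \<Longrightarrow>
           \<not> (j = 1 \<and> conjugate \<mu> 2 + conjugate \<nu> 1 \<le> i \<and> i \<le> conjugate \<mu> 1 - 1) \<Longrightarrow>
           Re (s (i, j)) > 1"
    and "\<And>i j. (i, j) \<in> diagram \<nu> \<Longrightarrow>
           \<not> (i = 1 \<and> part \<nu> 2 + part \<mu> 1 \<le> j \<and> j \<le> part \<nu> 1 - 1) \<Longrightarrow>
           Re (t (i, j)) > 1"
    and G_def: "G = {la. is_partition la \<and> lr \<mu> \<nu> la > 0}"
    and "\<And>la. la \<in> G \<Longrightarrow>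
           u la \<in> U_set la (star \<mu> \<nu>) (star_filling \<mu> \<nu> (s_vars \<mu>) (t_vars \<nu>))"
  shows "(\<Sum>\<sigma> | \<sigma> permutes permuted_vars \<mu> \<nu>.
            schur_zeta (normal_shape \<mu>) (evaluate \<mu> (var_value s t \<circ> \<sigma>) (s_vars \<mu>)) *
            schur_zeta (normal_shape \<nu>) (evaluate \<nu> (var_value s t \<circ> \<sigma>) (t_vars \<nu>))) =
         (\<Sum>\<sigma> | \<sigma> permutes permuted_vars \<mu> \<nu>. \<Sum>la\<in>G.
            of_int (lr \<mu> \<nu> la) *
            schur_zeta (normal_shape la) (evaluate la (var_value s t \<circ> \<sigma>) (u la)))"
proof -
  note \<mu> = assms(1,2) and \<nu> = assms(3,4)
  have len: "conjugate \<mu> 1 = length \<mu>" "conjugate \<nu> 1 = length \<nu>"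
    using conjugate_1 \<mu> \<nu> by auto
  let ?PV = "permuted_vars \<mu> \<nu>"
  define V where "V = SVar ` diagram \<mu> \<union> TVar ` diagram \<nu>"
  define x where "x = (\<lambda>\<sigma> :: svar \<Rightarrow> svar. var_value s t \<circ> \<sigma>)"
  \<comment> \<open>The variables whose real part may be only 1: the excluded ones without the last
    of each family.\<close>
  define weak where "weak y \<longleftrightarrow>
      (\<exists>i. y = SVar (i, 1) \<and> conjugate \<mu> 2 + conjugate \<nu> 1 \<le> i \<and> i \<le> conjugate \<mu> 1 - 1) \<or>
      (\<exists>j. y = TVar (1, j) \<and> part \<nu> 2 + part \<mu> 1 \<le> j \<and> j \<le> part \<nu> 1 - 1)" for y
  \<comment> \<open>The permutations move no weak variable, so a variable that is not weak is
    replaced by one that is not weak either.\<close>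
  have Re_x: "1 \<le> Re (x \<sigma> y) \<and> (\<not> weak y \<longrightarrow> 1 < Re (x \<sigma> y))"
    if \<sigma>: "\<sigma> permutes ?PV" and y: "y \<in> V" for \<sigma> y
  proof -
    have base: "1 \<le> Re (var_value s t y) \<and> (\<not> weak y \<longrightarrow> 1 < Re (var_value s t y))"
      if yV: "y \<in> V" for y
    proof -
      consider i j where "(i, j) \<in> diagram \<mu>" "y = SVar (i, j)"
        | i j where "(i, j) \<in> diagram \<nu>" "y = TVar (i, j)"
        using yV by (auto simp: V_def)
      then show ?thesis
      proof cases
        case 1
        then show ?thesis using assms(7)[of i] assms(9)[OF 1(1)]
          by (cases "weak y") (auto simp: weak_def)
      next
        case 2
        then show ?thesis using assms(8)[of j] assms(10)[OF 2(1)]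
          by (cases "weak y") (auto simp: weak_def)
      qed
    qed
    have "\<sigma> y \<in> V" using y permutes_in_image[OF \<sigma>, of y] permutes_not_in[OF \<sigma>, of y]
      by (cases "y \<in> ?PV") (auto simp: V_def permuted_vars_def)
    moreover have "weak y" if "weak (\<sigma> y)"
    proof -
      have "\<sigma> y \<notin> ?PV" using that by (auto simp: weak_def permuted_vars_def)
      then show ?thesis
        using that permutes_in_image[OF \<sigma>, of y] permutes_not_in[OF \<sigma>, of y] by simp
    qed
    ultimately show ?thesis using base[of "\<sigma> y"] by (auto simp: x_def)
  qed
  define summand where "summand = (\<lambda>la w \<sigma> M. \<Prod>b\<in>diagram la. of_nat (M b) powr (- x \<sigma> (w b)))"
  have summable: "Infinite_Set_Sum.abs_summable_on (summand la w \<sigma>) (SSYT (la, []))"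
    if \<sigma>: "\<sigma> permutes ?PV" and w: "\<And>b. b \<in> diagram la \<Longrightarrow> w b \<in> V"
      and corner: "\<And>i j. (i, j) \<in> diagram la \<Longrightarrow> weak (w (i, j)) \<Longrightarrow>
        (i + 1, j) \<in> diagram la \<or> (i, j + 1) \<in> diagram la" for la w \<sigma>
    unfolding summand_def
  proof (rule abs_summable_schur_zeta)
    show "1 \<le> Re (x \<sigma> (w b))" if "b \<in> diagram la" for b
      using Re_x[OF \<sigma> w[OF that]] by simp
    show "1 < Re (x \<sigma> (w (i, j)))"
      if "(i, j) \<in> diagram la" "(i + 1, j) \<notin> diagram la" "(i, j + 1) \<notin> diagram la" for i j
      using Re_x[OF \<sigma> w[OF that(1)]] corner[OF that(1)] that(2,3) by blast
  qed
  have d\<mu>: "(i, 1) \<in> diagram \<mu> \<longleftrightarrow> 1 \<le> i \<and> i \<le> length \<mu>" for i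
    using is_partition_nth(1)[OF \<mu>(1), of "i - 1"] by (auto simp: diagram_iff Suc_le_eq)
  have d\<nu>: "(1, j) \<in> diagram \<nu> \<longleftrightarrow> 1 \<le> j \<and> j \<le> part \<nu> 1" for j
    by (simp add: diagram_def)
  have summable_\<mu>: "Infinite_Set_Sum.abs_summable_on (summand \<mu> SVar \<sigma>) (SSYT (\<mu>, []))"
    if "\<sigma> permutes ?PV" for \<sigma>
  proof (rule summable[OF that])
    fix i j assume "(i, j) \<in> diagram \<mu>" "weak (SVar (i, j))"
    then show "(i + 1, j) \<in> diagram \<mu> \<or> (i, j + 1) \<in> diagram \<mu>"
      using d\<mu>[of "i + 1"] d\<mu>[of i] len by (auto simp: weak_def)
  qed (simp add: V_def)
  have summable_\<nu>: "Infinite_Set_Sum.abs_summable_on (summand \<nu> TVar \<sigma>) (SSYT (\<nu>, []))"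
    if "\<sigma> permutes ?PV" for \<sigma>
  proof (rule summable[OF that])
    fix i j assume "(i, j) \<in> diagram \<nu>" "weak (TVar (i, j))"
    then show "(i + 1, j) \<in> diagram \<nu> \<or> (i, j + 1) \<in> diagram \<nu>"
      using d\<nu>[of "j + 1"] d\<nu>[of j] by (auto simp: weak_def)
  qed (simp add: V_def)
  have u: "\<exists>L. L \<in> SSYT (star \<mu> \<nu>) \<and> rect_shape (star \<mu> \<nu>) L = la \<and>
      u la = rearranged (star \<mu> \<nu>) (star_vars \<mu> \<nu>) L" if "la \<in> G" for la
    using assms(12)[OF that] by (auto simp: U_set_def star_vars_def)
  have summable_u: "Infinite_Set_Sum.abs_summable_on (summand la (u la) \<sigma>) (SSYT (la, []))"
    if \<sigma>: "\<sigma> permutes ?PV" and la: "la \<in> G" for \<sigma> la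
  proof (rule summable[OF \<sigma>])
    obtain L where L: "L \<in> SSYT (star \<mu> \<nu>)" "rect_shape (star \<mu> \<nu>) L = la"
      "u la = rearranged (star \<mu> \<nu>) (star_vars \<mu> \<nu>) L" using u[OF la] by blast
    have bij: "bij_betw (u la) (diagram la) V"
      using bij_rearranged[OF \<nu>(1), of \<mu> L] by (simp add: L V_def)
    then show "b \<in> diagram la \<Longrightarrow> u la b \<in> V" for b by (rule bij_betw_apply)
    fix i j assume ij: "(i, j) \<in> diagram la" "weak (u la (i, j))"
    have inj: "b = c" if "b \<in> diagram la" "c \<in> diagram la" "u la b = u la c" for b c
      using bij that by (auto simp: bij_betw_def inj_on_def)
    from ij(2) consider k where "u la (i, j) = SVar (k, 1)" "conjugate \<mu> 2 + length \<nu> \<le> k"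
        "k + 1 \<le> length \<mu>"
      | k where "u la (i, j) = TVar (1, k)" "part \<nu> 2 + part \<mu> 1 \<le> k" "k + 1 \<le> part \<nu> 1"
    proof -
      \<comment> \<open>Natural subtraction hides the case \<open>part \<nu> 1 = 0\<close>; there
        \<open>k\<close> would have to be 0 although it is at least
        \<open>part \<mu> 1\<close>.\<close>
      have "0 < part \<mu> 1"
        using is_partition_nth(1)[OF \<mu>(1), of 0] \<mu>(2) by (cases \<mu>) (auto simp: part_def)
      then have "k + 1 \<le> part \<nu> 1" if "part \<nu> 2 + part \<mu> 1 \<le> k" "k \<le> part \<nu> 1 - 1" for k
        using that by linarith
      moreover have "k + 1 \<le> length \<mu>" if "k \<le> length \<mu> - 1" for k
        using that \<mu>(2) by (cases \<mu>) auto
      ultimately show ?thesis using ij(2) that unfolding weak_def len by blast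
    qed
    then show "(i + 1, j) \<in> diagram la \<or> (i, j + 1) \<in> diagram la"
    proof cases
      case 1
      \<comment> \<open>The index \<open>k + 1\<close> is still excluded, and its variable sits one
        box further down; so the box of the weak variable is no corner. The row case is
        analogous.\<close>
      have "k \<le> length \<mu>" "conjugate \<mu> 2 + length \<nu> \<le> k + 1" using 1 by simp_all
      note f = rearranged_fixed_column[OF \<mu>(1) \<nu> L(1) 1(2) this(1), unfolded L(2), folded L(3)]
        and g = rearranged_fixed_column(1)[OF \<mu>(1) \<nu> L(1) this(2) 1(3), unfolded L(2)]
      have "(i, j) = (length la - length \<mu> + k, 1)" using inj[OF ij(1) f(1)] f(2) 1(1) by simp
      then show ?thesis using g by simp
    next
      case 2
      have "k \<le> part \<nu> 1" "part \<nu> 2 + part \<mu> 1 \<le> k + 1" using 2 by simp_all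
      note f = rearranged_fixed_row[OF \<mu>(1) \<nu>(1) \<mu>(2) L(1) 2(2) this(1), unfolded L(2), folded L(3)]
        and g = rearranged_fixed_row(1)[OF \<mu>(1) \<nu>(1) \<mu>(2) L(1) this(2) 2(3), unfolded L(2)]
      have "(i, j) = (1, part la 1 - part \<nu> 1 + k)" using inj[OF ij(1) f(1)] f(2) 2(1) by simp
      then show ?thesis using g by simp
    qed
  qed
  have fin_PV: "finite {\<sigma>. \<sigma> permutes ?PV}"
    by (rule finite_permutations) (simp add: permuted_vars_def)
  have lr: "lr \<mu> \<nu> = structure_constant \<mu> \<nu>"
    using \<mu>(1) \<nu>(1) by (rule lr_eq_structure_constant)
  have fin_G: "finite G"
    using finite_structure_constant[of \<mu> \<nu>] unfolding G_def lr
    by (rule rev_finite_subset) auto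
  define A where "A = SSYT (\<mu>, []) \<times> SSYT (\<nu>, [])"
  define R where "R p = rect (star \<mu> \<nu>) (star_filling \<mu> \<nu> (fst p) (snd p))"
    for p :: "(box \<Rightarrow> nat) \<times> (box \<Rightarrow> nat)"
  define g where "g = (\<lambda>(la, P). \<Sum>\<sigma> | \<sigma> permutes ?PV. summand la (u la) \<sigma> P)"
  define B where "B = Sigma G (\<lambda>la. SSYT (la, []))"
  define fibre where "fibre q = {p \<in> A. R p = q}" for q
  have R_in_B: "R p \<in> B" if "p \<in> A" for p
  proof -
    obtain M N where p: "p = (M, N)" "M \<in> SSYT (\<mu>, [])" "N \<in> SSYT (\<nu>, [])"
      using \<open>p \<in> A\<close> by (auto simp: A_def)
    define M' N' where "M' = tableau_rows \<mu> M" and "N' = tableau_rows \<nu> N"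
    define T where "T = insert_word (tableau_word N') M'"
    have MN': "M' \<in> tableaux \<mu>" "N' \<in> tableaux \<nu>"
      using p bij_betw_apply[OF bij_tableau_rows[OF \<mu>(1)]] bij_betw_apply[OF bij_tableau_rows[OF \<nu>(1)]]
      by (auto simp: M'_def N'_def)
    have T: "is_tableau T" using MN' by (simp add: T_def tableaux_def is_tableau_insert_word)
    have "mset (tableau_word T) = mset (tableau_word M') + mset (tableau_word N')"
      using MN' by (simp add: T_def tableaux_def mset_insert_word)
    then have "set (tableau_word T) = set (tableau_word M') \<union> set (tableau_word N')"
      by (metis set_mset_mset set_mset_union)
    then have "T \<in> tableaux (map length T)" using T MN' by (auto simp: tableaux_def)
    then have "rows_filling T \<in> SSYT (map length T, [])"
      by (rule rows_filling_tableaux)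
    moreover have "map length T \<in> G"
    proof -
      have "(M', N') \<in> factorizations \<mu> \<nu> T" using MN' by (simp add: factorizations_def T_def tableaux_def)
      then have "card (factorizations \<mu> \<nu> T) > 0"
        using finite_factorizations[of \<mu> \<nu> T] by (auto simp: card_gt_0_iff)
      then show ?thesis
        using card_factorizations[OF \<nu>(1) T, of \<mu>] is_partition_shape[OF T] by (simp add: G_def lr)
    qed
    moreover have "R p = (map length T, rows_filling T)"
      using rect_star_filling[OF \<mu>(1) \<nu>(1) p(2,3)] by (simp add: R_def p(1) T_def M'_def N'_def)
    ultimately show ?thesis by (simp add: B_def)
  qed
  \<comment> \<open>Before symmetrization the summand involves the arrangement belonging to this
    filling. After it, the chosen \<open>u la\<close> may be substituted, and the summand depends
    only on the rectification.\<close>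
  have term_g: "(\<Sum>\<sigma> | \<sigma> permutes ?PV. summand \<mu> SVar \<sigma> M * summand \<nu> TVar \<sigma> N) = g (R (M, N))"
    if "(M, N) \<in> A" for M N
  proof -
    let ?L = "star_filling \<mu> \<nu> M N"
    let ?P = "rect_tableau (star \<mu> \<nu>) ?L"
    define la where "la = rect_shape (star \<mu> \<nu>) ?L"
    have R: "R (M, N) = (la, ?P)" by (simp add: R_def la_def rect_shape_def rect_tableau_def)
    then have "la \<in> G" using R_in_B[OF that] by (simp add: B_def)
    then obtain L' where L': "L' \<in> SSYT (star \<mu> \<nu>)" "rect_shape (star \<mu> \<nu>) L' = la"
      "u la = rearranged (star \<mu> \<nu>) (star_vars \<mu> \<nu>) L'" using u by blast
    have L: "?L \<in> SSYT (star \<mu> \<nu>)"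
      using that star_filling_in_SSYT[OF \<mu>(1) \<nu>(1)] by (simp add: A_def)
    have "summand \<mu> SVar \<sigma> M * summand \<nu> TVar \<sigma> N =
        (\<Prod>c\<in>diagram la. of_nat (?P c) powr (- var_value s t (\<sigma> (rearranged (star \<mu> \<nu>) (star_vars \<mu> \<nu>) ?L c))))"
      for \<sigma>
      using prod_rearranged[OF \<nu>(1), of "\<lambda>m y. of_nat m powr (- x \<sigma> y)" M \<mu> N]
      by (simp add: summand_def la_def x_def)
    then have "(\<Sum>\<sigma> | \<sigma> permutes ?PV. summand \<mu> SVar \<sigma> M * summand \<nu> TVar \<sigma> N) =
        (\<Sum>\<sigma> | \<sigma> permutes ?PV. \<Prod>c\<in>diagram la.
          of_nat (?P c) powr (- var_value s t (\<sigma> (rearranged (star \<mu> \<nu>) (star_vars \<mu> \<nu>) ?L c))))"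
      by simp
    also have "\<dots> = (\<Sum>\<sigma> | \<sigma> permutes ?PV. \<Prod>c\<in>diagram la.
          of_nat (?P c) powr (- var_value s t (\<sigma> (u la c))))"
      unfolding L'(3)
      by (rule sum_permuted_rearranged[OF \<mu>(1) \<nu>(1) \<mu>(2) \<nu>(2) L L'(1) la_def[symmetric] L'(2)])
    finally show ?thesis by (simp add: g_def R summand_def x_def)
  qed
  have product: "Infinite_Set_Sum.abs_summable_on
      (\<lambda>(M, N). summand \<mu> SVar \<sigma> M * summand \<nu> TVar \<sigma> N) A"
    if "\<sigma> permutes ?PV" for \<sigma>
    unfolding A_def
    by (rule abs_summable_on_product) (use that summable_\<mu> summable_\<nu> countable_SSYT in auto)
  note product = abs_summable_imp_summable_on[OF product]
  have zeta: "schur_zeta (la, []) (evaluate la (x \<sigma>) w) = infsum (summand la w \<sigma>) (SSYT (la, []))"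
    for la \<sigma> w
    by (simp add: schur_zeta_evaluate summand_def)
  have vars: "evaluate \<mu> y (s_vars \<mu>) = evaluate \<mu> y SVar" "evaluate \<nu> y (t_vars \<nu>) = evaluate \<nu> y TVar" for y
    by (auto simp: evaluate_def s_vars_def t_vars_def)
  \<comment> \<open>The pairs of tableaux are split into the fibers of the rectification.\<close>
  have b: "bij_betw snd (Sigma B fibre) A"
    by (rule bij_betw_byWitness[where f' = "\<lambda>p. (R p, p)"]) (auto simp: fibre_def R_in_B)
  define h where "h = (\<lambda>(la, P). of_int (lr \<mu> \<nu> la) * g (la, P))"
  have h: "(\<Sum>\<^sub>\<infinity>(q, p)\<in>Sigma B fibre. g q) = infsum h B" "h summable_on B"
  proof -
    have "(\<lambda>p. \<Sum>\<sigma> | \<sigma> permutes ?PV. case p of (M, N) \<Rightarrow> summand \<mu> SVar \<sigma> M * summand \<nu> TVar \<sigma> N)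
        summable_on A"
      using summable_on_sum_infsum[OF fin_PV, of "\<lambda>\<sigma> (M, N). summand \<mu> SVar \<sigma> M * summand \<nu> TVar \<sigma> N" A]
        product by simp
    then have "(\<lambda>p. g (R p)) summable_on A"
      by (rule summable_on_cong[THEN iffD1, rotated]) (use term_g in auto)
    then have "(\<lambda>p. g (R (snd p))) summable_on Sigma B fibre"
      by (rule summable_on_reindex_bij_betw[OF b, THEN iffD2])
    then have S: "(\<lambda>(q, p). g q) summable_on Sigma B fibre"
      by (rule summable_on_cong[THEN iffD1, rotated]) (auto simp: fibre_def)
    \<comment> \<open>The summand is constant on the finite fiber, whose cardinality is the
      Littlewood--Richardson coefficient.\<close>
    have hq: "(\<Sum>\<^sub>\<infinity>p\<in>fibre q. g q) = h q" if q: "q \<in> B" for q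
    proof -
      obtain la P where laP: "q = (la, P)" "la \<in> G" "P \<in> SSYT (la, [])" using q by (auto simp: B_def)
      then have "is_partition la" by (simp add: G_def)
      note card = card_rect_fibre[OF \<mu>(1) \<nu>(1) this laP(3)]
      have "fibre q = {(M, N). M \<in> SSYT (\<mu>, []) \<and> N \<in> SSYT (\<nu>, []) \<and>
          rect (star \<mu> \<nu>) (star_filling \<mu> \<nu> M N) = (la, P)}"
        by (auto simp: fibre_def A_def R_def laP)
      then show ?thesis using card by (simp add: laP(1) h_def flip: card(2))
    qed
    show "(\<Sum>\<^sub>\<infinity>(q, p)\<in>Sigma B fibre. g q) = infsum h B"
      using infsum_Sigma'_banach[OF S] hq by (simp cong: infsum_cong)
    show "h summable_on B"
      using summable_on_Sigma_banach[OF S] by (rule summable_on_cong[THEN iffD1, rotated]) (use hq in auto)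
  qed
  have "(\<Sum>\<sigma> | \<sigma> permutes ?PV.
      schur_zeta (\<mu>, []) (evaluate \<mu> (x \<sigma>) (s_vars \<mu>)) * schur_zeta (\<nu>, []) (evaluate \<nu> (x \<sigma>) (t_vars \<nu>))) =
    (\<Sum>\<sigma> | \<sigma> permutes ?PV. \<Sum>\<^sub>\<infinity>(M, N)\<in>A. summand \<mu> SVar \<sigma> M * summand \<nu> TVar \<sigma> N)"
  proof (rule sum.cong[OF refl])
    fix \<sigma> assume "\<sigma> \<in> {\<sigma>. \<sigma> permutes ?PV}"
    then show "schur_zeta (\<mu>, []) (evaluate \<mu> (x \<sigma>) (s_vars \<mu>)) *
        schur_zeta (\<nu>, []) (evaluate \<nu> (x \<sigma>) (t_vars \<nu>)) =
      (\<Sum>\<^sub>\<infinity>(M, N)\<in>A. summand \<mu> SVar \<sigma> M * summand \<nu> TVar \<sigma> N)"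
      using infsum_Sigma'_banach[of "\<lambda>M N. summand \<mu> SVar \<sigma> M * summand \<nu> TVar \<sigma> N"
          "SSYT (\<mu>, [])" "\<lambda>_. SSYT (\<nu>, [])"] product[of \<sigma>]
      by (simp add: vars zeta A_def infsum_cmult_right' infsum_cmult_left')
  qed
  also have "\<dots> = (\<Sum>\<^sub>\<infinity>p\<in>A. \<Sum>\<sigma> | \<sigma> permutes ?PV. case p of (M, N) \<Rightarrow> summand \<mu> SVar \<sigma> M * summand \<nu> TVar \<sigma> N)"
    using summable_on_sum_infsum[OF fin_PV, of "\<lambda>\<sigma> (M, N). summand \<mu> SVar \<sigma> M * summand \<nu> TVar \<sigma> N" A]
      product by simp
  also have "\<dots> = (\<Sum>\<^sub>\<infinity>p\<in>A. g (R p))"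
    by (rule infsum_cong) (use term_g in auto)
  also have "\<dots> = (\<Sum>\<^sub>\<infinity>(q, p)\<in>Sigma B fibre. g q)"
  proof -
    have "(\<Sum>\<^sub>\<infinity>p\<in>A. g (R p)) = (\<Sum>\<^sub>\<infinity>p\<in>Sigma B fibre. g (R (snd p)))"
      by (rule infsum_reindex_bij_betw[OF b, symmetric])
    also have "\<dots> = (\<Sum>\<^sub>\<infinity>(q, p)\<in>Sigma B fibre. g q)"
      by (rule infsum_cong) (auto simp: fibre_def)
    finally show ?thesis .
  qed
  also have "\<dots> = infsum h B" by (rule h(1))
  \<comment> \<open>Summability of \<open>h\<close> is inherited from the product side through the
    fibers, so the sum may be split by shape.\<close>
  also have "infsum h B = (\<Sum>la\<in>G. \<Sum>\<^sub>\<infinity>P\<in>SSYT (la, []). of_int (lr \<mu> \<nu> la) * g (la, P))"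
    using infsum_Sigma'_banach[of "\<lambda>la P. of_int (lr \<mu> \<nu> la) * g (la, P)" G "\<lambda>la. SSYT (la, [])"] fin_G h(2)
    by (simp add: B_def h_def)
  also have "\<dots> = (\<Sum>la\<in>G. of_int (lr \<mu> \<nu> la) *
      (\<Sum>\<sigma> | \<sigma> permutes ?PV. schur_zeta (la, []) (evaluate la (x \<sigma>) (u la))))"
  proof (rule sum.cong[OF refl])
    fix la assume la: "la \<in> G"
    \<comment> \<open>Here every single \<sigma> needs a convergent series for \<zeta>_\<lambda>,
      which is the purpose of \<open>summable_u\<close>.\<close>
    have "(\<Sum>\<^sub>\<infinity>P\<in>SSYT (la, []). g (la, P)) =
        (\<Sum>\<sigma> | \<sigma> permutes ?PV. schur_zeta (la, []) (evaluate la (x \<sigma>) (u la)))"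
      using summable_on_sum_infsum[OF fin_PV, of "summand la (u la)" "SSYT (la, [])"]
        abs_summable_imp_summable_on[OF summable_u[OF _ la]] by (simp add: g_def zeta)
    then show "(\<Sum>\<^sub>\<infinity>P\<in>SSYT (la, []). of_int (lr \<mu> \<nu> la) * g (la, P)) = of_int (lr \<mu> \<nu> la) *
      (\<Sum>\<sigma> | \<sigma> permutes ?PV. schur_zeta (la, []) (evaluate la (x \<sigma>) (u la)))"
      by (simp add: infsum_cmult_right')
  qed
  also have "\<dots> = (\<Sum>\<sigma> | \<sigma> permutes ?PV. \<Sum>la\<in>G. of_int (lr \<mu> \<nu> la) *
      schur_zeta (la, []) (evaluate la (x \<sigma>) (u la)))"
    unfolding sum_distrib_left by (rule sum.swap)
  finally show ?thesis by (simp only: x_def)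
qed

end
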